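(* Let $a>0$, $\gamma>1$, and let $\nu,\lambda\in\mathbb{R}$ satisfy $\nu>0$ and $\lambda+\frac{2}{3}\nu>0$. Suppose that $(\rho,\mathbf{u})$ is a smooth solution on $\mathbb{R}^3$ of the stationary barotropic compressible Navier-Stokes equations $$\operatorname{div}(\rho\mathbf{u})=0,\qquad \operatorname{div}(\rho\mathbf{u}\otimes\mathbf{u})-\nu\Delta\mathbf{u}-(\lambda+\nu)\nabla\operatorname{div}\mathbf{u}+\nabla P=0,\qquad P=a\rho^{\gamma},$$ with $\rho\in L^\infty(\mathbb{R}^3)$, $\nabla\mathbf{u}\in L^2(\mathbb{R}^3)$ and $\mathbf{u}\in L^{p,q}(\mathbb{R}^3)$, where either $3<p<\frac{9}{2}$ and $3\le q\le\infty$, or $p=q=3$. Then $\mathbf{u}\equiv 0$ and $\rho$ is constant on $\mathbb{R}^3$.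
   Context: Here $\mathbf{u}=(u_1,u_2,u_3):\mathbb{R}^3\to\mathbb{R}^3$ is the velocity field and $\rho:\mathbb{R}^3\to[0,\infty)$ is the density. A smooth solution means that $\rho$ and $\mathbf{u}$ are smooth functions on $\mathbb{R}^3$ satisfying the equations. The $i$-th component of $\operatorname{div}(\rho\mathbf{u}\otimes\mathbf{u})$ is $\sum_j\partial_j(\rho u_iu_j)$. Lorentz space: for a measurable $E\subseteq\mathbb{R}^3$, $1\le p<\infty$, $1\le q\le\infty$, and a measurable function $f$ on $E$ (scalar- or vector-valued), define $$\|f\|_{L^{p,q}(E)}:=\left(\int_0^\infty t^{q-1}\,|\{x\in E:|f(x)|>t\}|^{q/p}\,dt\right)^{1/q}\ \text{ if } q<\infty,\qquad \|f\|_{L^{p,\infty}(E)}:=\sup_{t>0}t\,|\{x\in E:|f(x)|>t\}|^{1/p},$$ where $|\cdot|$ of a set is Lebesgue measure; $f\in L^{p,q}(E)$ means $\|f\|_{L^{p,q}(E)}<\infty$. *)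

theory Defs
  imports "HOL-Analysis.Analysis" "HOL-Probability.Essential_Supremum"
begin

section \<open>Smooth functions and differential operators\<close>

primrec Ck_fun :: "nat \<Rightarrow> ('a::real_normed_vector \<Rightarrow> 'b::real_normed_vector) \<Rightarrow> bool" where
  "Ck_fun 0 f \<longleftrightarrow> continuous_on UNIV f"
| "Ck_fun (Suc k) f \<longleftrightarrow>
     (\<forall>x. f differentiable (at x)) \<and> (\<forall>v. Ck_fun k (\<lambda>x. frechet_derivative f (at x) v))"

definition smooth_fun :: "('a::real_normed_vector \<Rightarrow> 'b::real_normed_vector) \<Rightarrow> bool" where
  "smooth_fun f \<longleftrightarrow> (\<forall>k. Ck_fun k f)"

text \<open>The value of \<open>frechet_derivative\<close> is unspecified where the function is not differentiable.
  Below, the operators are applied to functions built from smooth \<open>\<rho>\<close> and \<open>u\<close>, and to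
  \<open>\<rho>\<^sup>\<gamma>\<close> with \<open>\<rho> \<ge> 0\<close> and \<open>\<gamma> > 1\<close>, which is differentiable also at the zeros of \<open>\<rho>\<close>.\<close>

definition partial_deriv :: "3 \<Rightarrow> (real^3 \<Rightarrow> real) \<Rightarrow> real^3 \<Rightarrow> real" where
  "partial_deriv i f x = frechet_derivative f (at x) (axis i 1)"

definition gradient :: "(real^3 \<Rightarrow> real) \<Rightarrow> real^3 \<Rightarrow> real^3" where
  "gradient f x = (\<chi> i. partial_deriv i f x)"

definition divergence :: "(real^3 \<Rightarrow> real^3) \<Rightarrow> real^3 \<Rightarrow> real" where
  "divergence v x = (\<Sum>i\<in>UNIV. partial_deriv i (\<lambda>y. v y $ i) x)"

definition tensor_divergence :: "(real^3 \<Rightarrow> real^3^3) \<Rightarrow> real^3 \<Rightarrow> real^3" where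
  "tensor_divergence T x = (\<chi> i. \<Sum>j\<in>UNIV. partial_deriv j (\<lambda>y. T y $ i $ j) x)"

definition vector_laplacian :: "(real^3 \<Rightarrow> real^3) \<Rightarrow> real^3 \<Rightarrow> real^3" where
  "vector_laplacian v x =
     (\<chi> i. \<Sum>j\<in>UNIV. partial_deriv j (partial_deriv j (\<lambda>y. v y $ i)) x)"

definition tensor_product :: "real^3 \<Rightarrow> real^3 \<Rightarrow> real^3^3" where
  "tensor_product v w = (\<chi> i j. v $ i * w $ j)"


section \<open>Function spaces\<close>

text \<open>On \<open>real^3^3\<close> the type class norm is the Frobenius norm.\<close>

definition in_L2 :: "('a::euclidean_space \<Rightarrow> 'b::euclidean_space) \<Rightarrow> bool" where
  "in_L2 f \<longleftrightarrow> f \<in> borel_measurable lebesgue \<and> integrable lebesgue (\<lambda>x. (norm (f x))\<^sup>2)"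

definition in_Linf :: "('a::euclidean_space \<Rightarrow> 'b::euclidean_space) \<Rightarrow> bool" where
  "in_Linf f \<longleftrightarrow> f \<in> borel_measurable lebesgue \<and> esssup lebesgue (\<lambda>x. ereal (norm (f x))) < \<infinity>"

text \<open>Powers with a positive exponent, with \<open>\<infinity>\<^sup>s = \<infinity>\<close>.\<close>

definition ennreal_powr :: "ennreal \<Rightarrow> real \<Rightarrow> ennreal" where
  "ennreal_powr x s = (if x = \<infinity> then \<infinity> else ennreal (enn2real x powr s))"

definition distribution_fun ::
    "'a::euclidean_space set \<Rightarrow> ('a \<Rightarrow> 'b::euclidean_space) \<Rightarrow> real \<Rightarrow> ennreal" where
  "distribution_fun E f t = emeasure lebesgue {x \<in> E. norm (f x) > t}"

definition lorentz_norm ::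
    "real \<Rightarrow> ennreal \<Rightarrow> 'a::euclidean_space set \<Rightarrow> ('a \<Rightarrow> 'b::euclidean_space) \<Rightarrow> ennreal" where
  "lorentz_norm p q E f =
     (if q = \<infinity>
      then (SUP t\<in>{0<..}. ennreal t * ennreal_powr (distribution_fun E f t) (1 / p))
      else let r = enn2real q in
        ennreal_powr
          (\<integral>\<^sup>+t\<in>{0<..}. ennreal (t powr (r - 1)) *
                       ennreal_powr (distribution_fun E f t) (r / p) \<partial>lborel)
          (1 / r))"

definition in_lorentz ::
    "real \<Rightarrow> ennreal \<Rightarrow> 'a::euclidean_space set \<Rightarrow> ('a \<Rightarrow> 'b::euclidean_space) \<Rightarrow> bool" where
  "in_lorentz p q E f \<longleftrightarrow>
     f \<in> borel_measurable (lebesgue_on E) \<and> lorentz_norm p q E f < \<infinity>"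

end

theory Submission
  imports Defs
begin

text \<open>
  Write \<open>\<mu>(t)\<close> for the measure of the set where \<open>\<bar>u\<bar> > t\<close>. The Lorentz hypothesis enters through
  the weak bound \<open>\<mu>(t) \<le> A t\<^sup>-\<^sup>p\<close>, and the proof compares two growth rates in the radius \<open>R\<close> of a ball.

  \<^emph>\<open>Energy.\<close> For the cutoff \<open>\<phi>(x) = max(0, 1 - \<bar>x/R\<bar>\<^sup>2)\<^sup>2\<close>, testing the momentum equation with \<open>\<phi> u\<close> gives
  \<open>\<integral> \<phi> (\<nu>\<bar>\<nabla>u\<bar>\<^sup>2 + (lam + \<nu>)(div u)\<^sup>2) = \<integral> E \<sqdot> \<nabla>\<phi>\<close> (lemma \<open>energy_identity\<close>). The flux \<open>E\<close> has terms of
  size \<open>\<bar>u\<bar>\<^sup>3\<close>, \<open>\<bar>u\<bar>\<bar>\<nabla>u\<bar>\<close>, and the pressure flux \<open>\<gamma>/(\<gamma>-1) P u\<close>; the latter appears because conservation of mass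
  turns \<open>\<nabla>P \<sqdot> u\<close> into \<open>\<gamma>/(\<gamma>-1) div (P u)\<close>. A bounded \<open>P\<close> would leave this flux far too large. But
  \<open>div (\<rho>u) = 0\<close> allows subtracting \<open>\<beta> \<rho> u\<close> for any constant \<open>\<beta>\<close>, and for a suitable \<open>\<beta>\<close> one has
  \<open>\<bar>\<gamma>/(\<gamma>-1) P - \<beta> \<rho>\<bar> \<le> \<gamma>/(\<gamma>-1) \<bar>P - c\<bar>\<close>, where \<open>c \<ge> 0\<close> may depend on \<open>R\<close> (lemma \<open>energy_flux_le\<close>).
  Only the oscillation of the pressure on the ball of radius \<open>R\<close> is left.

  \<^emph>\<open>Pressure.\<close> The momentum equation says \<open>\<nabla>P = div S\<close> with the stress
  \<open>S = \<nu>\<nabla>u + (lam + \<nu>)(div u) I - \<rho> u \<otimes> u\<close>. Lemma \<open>pressure_estimate\<close> bounds the square integral of \<open>P - c\<close> over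
  the ball of radius \<open>R\<close> by that of \<open>S\<close> over the ball of radius \<open>3R\<close>. It is a duality argument: a function \<open>h\<close> is,
  up to smoothing at unit scale, the Laplacian of a compactly supported \<open>w\<close>, obtained by convolution with a truncated
  Newtonian kernel; then \<open>\<integral> P \<Delta>w = \<integral> S : \<nabla>\<^sup>2w\<close>, and the Hessian of \<open>w\<close> has the same square integral as \<open>\<Delta>w\<close>.

  \<^emph>\<open>Velocity.\<close> The stress contains \<open>\<rho> u \<otimes> u\<close>, so the fourth power of \<open>\<bar>u\<bar>\<close> has to be integrated over balls, whereas
  \<open>p\<close> may be as small as 3. Square integrability of \<open>\<nabla>u\<close> helps: comparing \<open>u\<close> with its translates over a ball whose
  volume is twice \<open>\<mu>(t/2)\<close> yields \<open>\<mu>(t) \<le> C t\<^sup>-\<^sup>2 \<mu>(t/2)\<^bsup>2/3\<^esup>\<close>, which improves the weak exponent \<open>p\<close> to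
  \<open>2 + 2p/3\<close> (lemma \<open>weak_Lp_gradient_improve\<close>). After two steps every \<open>p \<ge> 3\<close> exceeds \<open>9/2\<close>, and interpolation with the
  original bound gives a weak exponent \<open>r\<close> with \<open>4 < r < 9/2\<close>. Hence \<open>\<integral> \<bar>u\<bar>\<^sup>4\<close> over the ball of radius \<open>R\<close> is
  \<open>O(R\<^sup>\<kappa>)\<close> with \<open>\<kappa> = 3 - 12/r < 1/3\<close>.

  With the Cauchy-Schwarz inequality every term of \<open>\<integral> E \<sqdot> \<nabla>\<phi>\<close> is then \<open>O(R\<^bsup>3\<kappa>/4 - 1/4\<^esup>)\<close>, which tends to 0
  (lemma \<open>dissipation_decay\<close>). So \<open>\<nabla>u = 0\<close>; the constant \<open>u\<close> lies in a weak Lebesgue space and is 0; then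
  \<open>\<nabla>P = 0\<close>, and \<open>\<rho>\<close> is constant.
\<close>

section \<open>Directional derivatives and integration by parts\<close>

text \<open>Only the existence of single directional derivatives is recorded, and continuity is assumed separately where
  it matters. All products, convolutions and kernels below can then be differentiated by one-variable rules.\<close>

definition has_dirderiv :: "('a::real_normed_vector \<Rightarrow> real) \<Rightarrow> 'a \<Rightarrow> ('a \<Rightarrow> real) \<Rightarrow> bool" where
  "has_dirderiv f e g \<longleftrightarrow> (\<forall>x. ((\<lambda>s. f (x + s *\<^sub>R e)) has_real_derivative g x) (at 0))"

lemma has_dirderiv_at:
  assumes "has_dirderiv f e g"
  shows "((\<lambda>s. f (x + s *\<^sub>R e)) has_real_derivative g (x + t *\<^sub>R e)) (at t)"
proof -
  have "((\<lambda>s. f ((x + t *\<^sub>R e) + s *\<^sub>R e)) has_real_derivative g (x + t *\<^sub>R e)) (at 0)"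
    using assms unfolding has_dirderiv_def by blast
  then have "((\<lambda>s. f (x + (s + t) *\<^sub>R e)) has_real_derivative g (x + t *\<^sub>R e)) (at 0)"
    by (simp add: algebra_simps)
  then show ?thesis
    using DERIV_shift[of "\<lambda>s. f (x + s *\<^sub>R e)" _ 0 t] by simp
qed

lemma has_dirderiv_const: "has_dirderiv (\<lambda>x. c) e (\<lambda>x. 0)"
  unfolding has_dirderiv_def by simp

lemma has_dirderiv_add:
  assumes "has_dirderiv f e f'" "has_dirderiv g e g'"
  shows "has_dirderiv (\<lambda>x. f x + g x) e (\<lambda>x. f' x + g' x)"
  using assms unfolding has_dirderiv_def by (auto intro!: derivative_intros)

lemma has_dirderiv_diff:
  assumes "has_dirderiv f e f'" "has_dirderiv g e g'"
  shows "has_dirderiv (\<lambda>x. f x - g x) e (\<lambda>x. f' x - g' x)"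
  using assms unfolding has_dirderiv_def by (auto intro!: derivative_intros)

lemma has_dirderiv_mult:
  assumes "has_dirderiv f e f'" "has_dirderiv g e g'"
  shows "has_dirderiv (\<lambda>x. f x * g x) e (\<lambda>x. f' x * g x + f x * g' x)"
  using assms unfolding has_dirderiv_def by (auto intro!: derivative_eq_intros)

lemma has_dirderiv_cmult:
  assumes "has_dirderiv f e f'"
  shows "has_dirderiv (\<lambda>x. c * f x) e (\<lambda>x. c * f' x)"
  using assms unfolding has_dirderiv_def by (auto intro!: derivative_eq_intros)

lemma has_dirderiv_sum:
  assumes "\<And>i. i \<in> I \<Longrightarrow> has_dirderiv (f i) e (f' i)"
  shows "has_dirderiv (\<lambda>x. \<Sum>i\<in>I. f i x) e (\<lambda>x. \<Sum>i\<in>I. f' i x)"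
  using assms unfolding has_dirderiv_def by (auto intro!: derivative_intros)

lemma has_dirderiv_inner: "has_dirderiv (\<lambda>x. a \<bullet> x) e (\<lambda>x. a \<bullet> e)"
  unfolding has_dirderiv_def by (auto intro!: derivative_eq_intros simp: inner_add_right)

lemma has_dirderiv_self_inner: "has_dirderiv (\<lambda>x. x \<bullet> x) e (\<lambda>x. 2 * (x \<bullet> e))"
  unfolding has_dirderiv_def
  by (auto intro!: derivative_eq_intros simp: inner_add_right inner_add_left inner_commute)

lemma has_dirderiv_chain:
  assumes "\<And>t. (\<theta> has_real_derivative \<theta>' t) (at t)" "has_dirderiv f e g"
  shows "has_dirderiv (\<lambda>x. \<theta> (f x)) e (\<lambda>x. \<theta>' (f x) * g x)"
  unfolding has_dirderiv_def
proof
  fix x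
  have "((\<lambda>s. f (x + s *\<^sub>R e)) has_real_derivative g x) (at 0)"
    using assms(2) by (simp add: has_dirderiv_def)
  from DERIV_chain2[OF assms(1) this]
  show "((\<lambda>s. \<theta> (f (x + s *\<^sub>R e))) has_real_derivative \<theta>' (f x) * g x) (at 0)"
    by simp
qed

lemma has_dirderiv_scale:
  assumes "has_dirderiv f e g"
  shows "has_dirderiv (\<lambda>x. f (c *\<^sub>R x)) e (\<lambda>x. c * g (c *\<^sub>R x))"
  unfolding has_dirderiv_def
proof
  fix x
  have "((\<lambda>s. f (c *\<^sub>R x + s *\<^sub>R e)) has_real_derivative g (c *\<^sub>R x)) (at (c * 0))"
    using assms by (simp add: has_dirderiv_def)
  from DERIV_chain2[OF this DERIV_cmult_Id[of c]]
  show "((\<lambda>s. f (c *\<^sub>R (x + s *\<^sub>R e))) has_real_derivative c * g (c *\<^sub>R x)) (at 0)"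
    by (simp add: scaleR_add_right mult.commute)
qed

lemma has_dirderiv_reflect:
  assumes "has_dirderiv f e g"
  shows "has_dirderiv (\<lambda>x. f (z - x)) e (\<lambda>x. - g (z - x))"
  unfolding has_dirderiv_def
proof
  fix x
  have "((\<lambda>s. f ((z - x) + s *\<^sub>R e)) has_real_derivative g (z - x)) (at (- 0))"
    using assms by (simp add: has_dirderiv_def)
  moreover have "((\<lambda>s. - s) has_real_derivative - 1) (at (0::real))"
    by (auto intro!: derivative_eq_intros)
  ultimately have "((\<lambda>s. f ((z - x) + (- s) *\<^sub>R e)) has_real_derivative g (z - x) * - 1) (at 0)"
    by (rule DERIV_chain2)
  then show "((\<lambda>s. f (z - (x + s *\<^sub>R e))) has_real_derivative - g (z - x)) (at 0)"
    by (simp add: algebra_simps)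
qed

lemma has_dirderiv_has_derivative:
  assumes "\<And>x. (f has_derivative f' x) (at x)"
  shows "has_dirderiv f e (\<lambda>x. f' x e)"
  unfolding has_dirderiv_def
proof
  fix x
  have 1: "((\<lambda>s. x + s *\<^sub>R e) has_derivative (\<lambda>s. s *\<^sub>R e)) (at (0::real))"
    by (auto intro!: derivative_eq_intros)
  have "((\<lambda>s. f (x + s *\<^sub>R e)) has_derivative (\<lambda>s. f' x (s *\<^sub>R e))) (at 0)"
    using has_derivative_compose[OF 1] assms[of x] by simp
  moreover have "(\<lambda>s. f' x (s *\<^sub>R e)) = (*) (f' x e)"
    using has_derivative_linear[OF assms[of x]] by (auto simp: linear_scale)
  ultimately show "((\<lambda>s. f (x + s *\<^sub>R e)) has_real_derivative f' x e) (at 0)"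
    by (simp add: has_field_derivative_def)
qed

definition vanishes_beyond :: "real \<Rightarrow> ('a::real_normed_vector \<Rightarrow> real) \<Rightarrow> bool" where
  "vanishes_beyond r f \<longleftrightarrow> (\<forall>x. r < norm x \<longrightarrow> f x = 0)"

text \<open>Outside the closed ball the function is locally constant along every line.\<close>

lemma vanishes_beyond_dirderiv:
  assumes "vanishes_beyond r f" "has_dirderiv f e g"
  shows "vanishes_beyond r g"
  unfolding vanishes_beyond_def
proof (intro allI impI)
  fix x :: 'a assume x: "r < norm x"
  have "((\<lambda>s::real. norm (x + s *\<^sub>R e)) \<longlongrightarrow> norm (x + 0 *\<^sub>R e)) (nhds 0)"
    by (intro tendsto_intros filterlim_ident)
  then have "eventually (\<lambda>s::real. r < norm (x + s *\<^sub>R e)) (nhds 0)"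
    using x by (intro order_tendstoD(1)) auto
  then have "eventually (\<lambda>s::real. f (x + s *\<^sub>R e) = 0) (nhds 0)"
    by eventually_elim (use assms(1) in \<open>auto simp: vanishes_beyond_def\<close>)
  moreover have "((\<lambda>s. f (x + s *\<^sub>R e)) has_real_derivative g x) (at 0)"
    using assms(2) by (simp add: has_dirderiv_def)
  ultimately have "((\<lambda>s. 0) has_real_derivative g x) (at (0::real))"
    by (subst (asm) DERIV_cong_ev[OF refl _ refl])
  then show "g x = 0"
    using DERIV_const DERIV_unique by blast
qed

lemma vanishes_beyond_mult1: "vanishes_beyond r f \<Longrightarrow> vanishes_beyond r (\<lambda>x. f x * g x)"
  and vanishes_beyond_mult2: "vanishes_beyond r g \<Longrightarrow> vanishes_beyond r (\<lambda>x. f x * g x)"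
  by (auto simp: vanishes_beyond_def)

lemma vanishes_beyond_mono: "vanishes_beyond r f \<Longrightarrow> r \<le> s \<Longrightarrow> vanishes_beyond s f"
  by (auto simp: vanishes_beyond_def)

lemma vanishes_beyond_scale:
  assumes "vanishes_beyond 1 f" "0 < R"
  shows "vanishes_beyond R (\<lambda>x. f ((1/R) *\<^sub>R x))"
  unfolding vanishes_beyond_def
proof (intro allI impI)
  fix x :: 'a assume "R < norm x"
  then have "1 < norm ((1/R) *\<^sub>R x)" using assms(2) by simp
  then show "f ((1/R) *\<^sub>R x) = 0" using assms(1) unfolding vanishes_beyond_def by blast
qed

lemma ex_cbox_cball:
  obtains a b :: "'a::euclidean_space" where "cball 0 r \<subseteq> cbox a b"
  by (metis bounded_cball bounded_subset_cbox_symmetric)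

lemma integrable_compactly_supported:
  fixes f :: "'a::euclidean_space \<Rightarrow> real"
  assumes "continuous_on UNIV f" "vanishes_beyond r f"
  shows "integrable lborel f"
proof -
  have "integrable lborel (\<lambda>x. indicator (cball 0 r) x *\<^sub>R f x)"
    using assms(1) by (intro borel_integrable_compact) (auto intro: continuous_on_subset)
  moreover have "(\<lambda>x. indicator (cball 0 r) x *\<^sub>R f x) = f"
    using assms(2) by (auto simp: vanishes_beyond_def indicator_def fun_eq_iff not_le)
  ultimately show ?thesis by simp
qed

lemma integral_eq_cbox:
  fixes f :: "'a::euclidean_space \<Rightarrow> real"
  assumes "continuous_on UNIV f" "vanishes_beyond r f" "cball 0 r \<subseteq> cbox a b"
  shows "integral\<^sup>L lborel f = integral (cbox a b) f"
proof -
  have "integral\<^sup>L lborel f = integral UNIV f"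
    using integral_lborel[OF integrable_compactly_supported[OF assms(1,2)]] by simp
  also have "\<dots> = integral UNIV (\<lambda>x. if x \<in> cbox a b then f x else 0)"
    using assms(2,3) by (intro arg_cong[of _ _ "integral UNIV"])
      (force simp: vanishes_beyond_def fun_eq_iff subset_eq not_less[symmetric])
  also have "\<dots> = integral (cbox a b) f"
    by (rule integral_restrict_UNIV)
  finally show ?thesis .
qed

lemma lborel_integral_shift:
  fixes f :: "'a::euclidean_space \<Rightarrow> real"
  assumes "f \<in> borel_measurable borel"
  shows "(\<integral>x. f (c + x) \<partial>lborel) = integral\<^sup>L lborel f"
  by (subst (2) lborel_distr_plus[of c, symmetric], subst integral_distr) (use assms in auto)

lemma lborel_integral_minus:
  fixes f :: "'a::euclidean_space \<Rightarrow> real"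
  assumes "f \<in> borel_measurable borel"
  shows "(\<integral>x. f (c - x) \<partial>lborel) = integral\<^sup>L lborel f"
proof -
  have "lborel = density (distr lborel borel (\<lambda>x::'a. c + (-1) *\<^sub>R x)) (\<lambda>_. ennreal (\<bar>-1\<bar>^DIM('a)))"
    by (rule lborel_affine) simp
  then have eq: "lborel = distr lborel borel (\<lambda>x::'a. c - x)"
    by (simp add: density_1)
  then show ?thesis
    using assms by (subst (2) eq, subst integral_distr) auto
qed

lemma lborel_integral_scale:
  fixes f :: "'a::euclidean_space \<Rightarrow> real"
  assumes "f \<in> borel_measurable borel" "0 < c"
  shows "integral\<^sup>L lborel f = c ^ DIM('a) * (\<integral>x. f (c *\<^sub>R x) \<partial>lborel)"
proof -
  have "lborel = density (distr lborel borel (\<lambda>x::'a. 0 + c *\<^sub>R x)) (\<lambda>_. ennreal (\<bar>c\<bar>^DIM('a)))"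
    using assms(2) by (intro lborel_affine) simp
  then have eq: "lborel = density (distr lborel borel (\<lambda>x::'a. c *\<^sub>R x)) (\<lambda>_. ennreal (c^DIM('a)))"
    using assms(2) by simp
  show ?thesis
    using assms by (subst (1) eq, subst integral_density)
      (auto simp: integral_distr ennreal_power)
qed

text \<open>The integral of a translate of \<open>f\<close> does not depend on the translation; differentiating
  \<open>\<integral> f(x + s e) dx\<close> under the integral sign at \<open>s = 0\<close> gives the integral of \<open>g\<close>.\<close>

lemma integral_dirderiv_eq_0:
  fixes f :: "'a::euclidean_space \<Rightarrow> real"
  assumes cf: "continuous_on UNIV f" and cg: "continuous_on UNIV g"
    and v: "vanishes_beyond r f" and dd: "has_dirderiv f e g"
  shows "integral\<^sup>L lborel g = 0"
proof -
  obtain a b :: 'a where ab: "cball 0 (r + norm e) \<subseteq> cbox a b"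
    using ex_cbox_cball .
  define F where "F s = integral (cbox a b) (\<lambda>x. f (x + s *\<^sub>R e))" for s :: real
  have F: "F s = integral\<^sup>L lborel f" if s: "s \<in> {-1<..<1}" for s
  proof -
    have "F s = (\<integral>x. f (s *\<^sub>R e + x) \<partial>lborel)"
      unfolding F_def add.commute[of "s *\<^sub>R e"]
    proof (rule integral_eq_cbox[OF _ _ ab, symmetric])
      show "continuous_on UNIV (\<lambda>x. f (x + s *\<^sub>R e))"
        by (intro continuous_on_compose2[OF cf] continuous_intros) auto
      show "vanishes_beyond (r + norm e) (\<lambda>x. f (x + s *\<^sub>R e))"
        unfolding vanishes_beyond_def
      proof (intro allI impI)
        fix x :: 'a assume "r + norm e < norm x"
        moreover have "norm x \<le> norm (x + s *\<^sub>R e) + norm (s *\<^sub>R e)"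
          using norm_triangle_ineq4[of "x + s *\<^sub>R e" "s *\<^sub>R e"] by simp
        moreover have "norm (s *\<^sub>R e) \<le> norm e"
          using s by (auto intro!: mult_left_le_one_le)
        ultimately have "r < norm (x + s *\<^sub>R e)" by linarith
        then show "f (x + s *\<^sub>R e) = 0" using v by (simp add: vanishes_beyond_def)
      qed
    qed
    also have "\<dots> = integral\<^sup>L lborel f"
      by (rule lborel_integral_shift) (use cf borel_measurable_continuous_onI in blast)
    finally show ?thesis .
  qed
  have "((\<lambda>s. integral (cbox a b) (\<lambda>x. f (x + s *\<^sub>R e))) has_real_derivative
      integral (cbox a b) (\<lambda>x. g (x + 0 *\<^sub>R e))) (at 0 within UNIV)"
  proof (rule leibniz_rule_field_derivative)
    show "((\<lambda>s. f (t + s *\<^sub>R e)) has_real_derivative g (t + x *\<^sub>R e)) (at x within UNIV)" for x t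
      using has_dirderiv_at[OF dd] by simp
    show "(\<lambda>t. f (t + x *\<^sub>R e)) integrable_on cbox a b" for x
      by (intro integrable_continuous continuous_on_compose2[OF cf] continuous_intros) auto
    show "continuous_on (UNIV \<times> cbox a b) (\<lambda>(x, t). g (t + x *\<^sub>R e))"
      unfolding case_prod_beta by (intro continuous_on_compose2[OF cg] continuous_intros) auto
  qed auto
  then have "(F has_real_derivative integral (cbox a b) g) (at 0)"
    by (simp add: F_def[abs_def])
  moreover have "eventually (\<lambda>s. F s = integral\<^sup>L lborel f) (nhds 0)"
    by (rule eventually_nhds_in_open[THEN eventually_mono, of "{-1<..<1}"]) (auto intro: F)
  ultimately have "((\<lambda>s. integral\<^sup>L lborel f) has_real_derivative integral (cbox a b) g) (at 0)"
    by (subst (asm) DERIV_cong_ev[OF refl _ refl])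
  then have "integral (cbox a b) g = 0"
    using DERIV_const DERIV_unique by blast
  moreover have "integral\<^sup>L lborel g = integral (cbox a b) g"
    using vanishes_beyond_dirderiv[OF v dd] vanishes_beyond_mono
    by (intro integral_eq_cbox[OF cg _ ab]) force
  ultimately show ?thesis by simp
qed

lemma integration_by_parts:
  fixes f :: "'a::euclidean_space \<Rightarrow> real"
  assumes "continuous_on UNIV f" "continuous_on UNIV f'" "has_dirderiv f e f'"
    and "continuous_on UNIV g" "continuous_on UNIV g'" "has_dirderiv g e g'"
    and v: "vanishes_beyond r g"
  shows "(\<integral>x. f x * g' x \<partial>lborel) = - (\<integral>x. f' x * g x \<partial>lborel)"
proof -
  have v': "vanishes_beyond r g'" using vanishes_beyond_dirderiv v assms by blast
  have 1: "integrable lborel (\<lambda>x. f' x * g x)" "integrable lborel (\<lambda>x. f x * g' x)"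
    using assms v v'
    by (auto intro!: integrable_compactly_supported[of _ r] vanishes_beyond_mult2 continuous_intros)
  have "(\<integral>x. f' x * g x + f x * g' x \<partial>lborel) = 0"
  proof (rule integral_dirderiv_eq_0[where f="\<lambda>x. f x * g x"])
    show "has_dirderiv (\<lambda>x. f x * g x) e (\<lambda>x. f' x * g x + f x * g' x)"
      using assms by (intro has_dirderiv_mult)
  qed (use assms v v' in \<open>auto intro!: vanishes_beyond_mult2 continuous_intros\<close>)
  then show ?thesis using 1 by simp
qed

text \<open>The discriminant argument for \<open>\<integral> (f + t g)\<^sup>2 \<ge> 0\<close>.\<close>

lemma integral_Cauchy_Schwarz:
  fixes f g :: "'a \<Rightarrow> real"
  assumes "integrable M (\<lambda>x. (f x)\<^sup>2)" "integrable M (\<lambda>x. (g x)\<^sup>2)" "integrable M (\<lambda>x. f x * g x)"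
  shows "(\<integral>x. f x * g x \<partial>M)\<^sup>2 \<le> (\<integral>x. (f x)\<^sup>2 \<partial>M) * (\<integral>x. (g x)\<^sup>2 \<partial>M)"
proof -
  define A B C where "A = (\<integral>x. (f x)\<^sup>2 \<partial>M)" and "B = (\<integral>x. f x * g x \<partial>M)" and "C = (\<integral>x. (g x)\<^sup>2 \<partial>M)"
  have q: "0 \<le> A + 2 * t * B + t\<^sup>2 * C" for t
  proof -
    have "0 \<le> (\<integral>x. (f x + t * g x)\<^sup>2 \<partial>M)" by simp
    also have "\<dots> = (\<integral>x. (f x)\<^sup>2 + (2 * t * (f x * g x) + t\<^sup>2 * (g x)\<^sup>2) \<partial>M)"
      by (simp add: power2_eq_square algebra_simps)
    also have "\<dots> = A + (2 * t * B + t\<^sup>2 * C)"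
      using assms unfolding A_def B_def C_def by simp
    finally show ?thesis by simp
  qed
  have "A \<ge> 0" "C \<ge> 0" unfolding A_def C_def by auto
  have "B\<^sup>2 \<le> A * C"
  proof (cases "C = 0")
    case True
    have "B = 0"
    proof (rule ccontr)
      assume "B \<noteq> 0"
      then show False using q[of "- (A + 1) / (2 * B)"] True by (simp add: field_simps)
    qed
    then show ?thesis using \<open>A \<ge> 0\<close> \<open>C \<ge> 0\<close> by simp
  next
    case False
    then have "0 \<le> (A + 2 * (-B / C) * B + (-B / C)\<^sup>2 * C) * C"
      using q[of "-B / C"] \<open>C \<ge> 0\<close> by (metis mult_nonneg_nonneg)
    also have "\<dots> = A * C - B\<^sup>2"
      using False by (simp add: field_simps power2_eq_square)
    finally show ?thesis by simp
  qed
  then show ?thesis by (simp add: A_def B_def C_def)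
qed

lemma integral_set_cball:
  fixes f :: "'a::euclidean_space \<Rightarrow> real"
  assumes "continuous_on UNIV f"
  shows "integrable lborel (\<lambda>x. indicator (cball 0 r) x * f x)"
    and "set_integrable lborel (cball 0 r) f"
proof -
  show "set_integrable lborel (cball 0 r) f"
    using borel_integrable_compact[OF compact_cball, of 0 r f] assms
    by (auto simp: set_integrable_def intro: continuous_on_subset)
  then show "integrable lborel (\<lambda>x. indicator (cball 0 r) x * f x)"
    by (simp add: set_integrable_def)
qed

lemma set_integral_Cauchy_Schwarz:
  fixes f g :: "'a::euclidean_space \<Rightarrow> real"
  assumes f: "continuous_on UNIV f" and g: "continuous_on UNIV g"
  shows "(LINT x:cball 0 R|lborel. f x * g x)
    \<le> sqrt (LINT x:cball 0 R|lborel. (f x)\<^sup>2) * sqrt (LINT x:cball 0 R|lborel. (g x)\<^sup>2)"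
proof -
  let ?I = "indicator (cball (0::'a) R) :: 'a \<Rightarrow> real"
  have eq: "(?I x * f x) * (?I x * g x) = ?I x * (f x * g x)" "(?I x * f x)\<^sup>2 = ?I x * (f x)\<^sup>2"
    "(?I x * g x)\<^sup>2 = ?I x * (g x)\<^sup>2" for x by (auto simp: indicator_def)
  have "(\<integral>x. (?I x * f x) * (?I x * g x) \<partial>lborel)\<^sup>2
      \<le> (\<integral>x. (?I x * f x)\<^sup>2 \<partial>lborel) * (\<integral>x. (?I x * g x)\<^sup>2 \<partial>lborel)"
    by (rule integral_Cauchy_Schwarz; unfold eq; intro integral_set_cball continuous_intros f g)
  then have "(LINT x:cball 0 R|lborel. f x * g x)\<^sup>2 \<le>
      (LINT x:cball 0 R|lborel. (f x)\<^sup>2) * (LINT x:cball 0 R|lborel. (g x)\<^sup>2)"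
    unfolding eq set_lebesgue_integral_def by simp
  then show ?thesis unfolding real_sqrt_mult[symmetric] by (rule real_le_rsqrt)
qed

section \<open>Convolution\<close>

definition convol :: "('a::euclidean_space \<Rightarrow> real) \<Rightarrow> ('a \<Rightarrow> real) \<Rightarrow> 'a \<Rightarrow> real" where
  "convol K h x = (\<integral>y. K (x - y) * h y \<partial>lborel)"

lemma vanishes_beyond_shift:
  assumes "vanishes_beyond r K"
  shows "vanishes_beyond (norm x + r) (\<lambda>y. K (x - y))"
  unfolding vanishes_beyond_def
proof (intro allI impI)
  fix y :: 'a assume "norm x + r < norm y"
  then have "r < norm (x - y)" using norm_triangle_sub[of y x] by (simp add: norm_minus_commute)
  then show "K (x - y) = 0" using assms by (simp add: vanishes_beyond_def)
qed

lemma continuous_on_UNIV_compose: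
  assumes "continuous_on UNIV f" "continuous_on A g"
  shows "continuous_on A (\<lambda>x. f (g x))"
  using continuous_on_compose2[OF assms] by simp

lemma convol_integrable:
  assumes "continuous_on UNIV K" "vanishes_beyond r K" "continuous_on UNIV h"
  shows "integrable lborel (\<lambda>y. K (x - y) * h y)"
  using assms
  by (intro integrable_compactly_supported[of _ "norm x + r"] vanishes_beyond_mult1 vanishes_beyond_shift)
    (auto intro!: continuous_intros continuous_on_UNIV_compose[OF assms(1)])

lemma convol_commute:
  assumes "continuous_on UNIV K" "continuous_on UNIV h"
  shows "convol K h x = (\<integral>y. K y * h (x - y) \<partial>lborel)"
proof -
  have "(\<lambda>y. K (x - y) * h y) \<in> borel_measurable borel"
    using assms by (intro borel_measurable_continuous_onI continuous_intros continuous_on_UNIV_compose[OF assms(1)])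
  from lborel_integral_minus[OF this, of x] show ?thesis by (simp add: convol_def)
qed

lemma continuous_on_convol:
  assumes K: "continuous_on UNIV K" and v: "vanishes_beyond r K" and h: "continuous_on UNIV h"
  shows "continuous_on UNIV (convol K h)"
proof -
  obtain a b :: 'a where ab: "cball 0 r \<subseteq> cbox a b" using ex_cbox_cball .
  have "convol K h x = integral (cbox a b) (\<lambda>y. K y * h (x - y))" for x
    unfolding convol_commute[OF K h]
    using K h v by (intro integral_eq_cbox[OF _ _ ab] vanishes_beyond_mult1)
      (auto intro!: continuous_intros continuous_on_UNIV_compose[OF h])
  moreover have "continuous_on UNIV (\<lambda>x. integral (cbox a b) (\<lambda>y. K y * h (x - y)))"
    unfolding case_prod_beta
    by (rule integral_continuous_on_param)
      (auto simp: case_prod_beta intro!: continuous_intros continuous_on_UNIV_compose[OF h]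
         continuous_on_UNIV_compose[OF K])
  ultimately show ?thesis by (simp add: fun_eq_iff cong: continuous_on_cong)
qed

lemma vanishes_beyond_convol:
  assumes "vanishes_beyond r K" "vanishes_beyond s h"
  shows "vanishes_beyond (r + s) (convol K h)"
  unfolding vanishes_beyond_def
proof (intro allI impI)
  fix x :: 'a assume x: "r + s < norm x"
  have "K (x - y) * h y = 0" for y
  proof (cases "s < norm y")
    case False
    then have "r < norm (x - y)" using x norm_triangle_sub[of x y] by simp
    then show ?thesis using assms by (simp add: vanishes_beyond_def)
  qed (use assms in \<open>simp add: vanishes_beyond_def\<close>)
  then have "(\<lambda>y. K (x - y) * h y) = (\<lambda>_. 0)" by blast
  then show "convol K h x = 0" by (simp add: convol_def)
qed

text \<open>All derivatives fall on the kernel. The second factor is an arbitrary continuous function, such as the pressure.\<close>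

lemma has_dirderiv_convol:
  assumes K: "continuous_on UNIV K" and K': "continuous_on UNIV K'" and v: "vanishes_beyond r K"
    and dd: "has_dirderiv K e K'" and h: "continuous_on UNIV h"
  shows "has_dirderiv (convol K h) e (convol K' h)"
  unfolding has_dirderiv_def
proof
  fix x :: 'a
  have v': "vanishes_beyond r K'" using vanishes_beyond_dirderiv[OF v dd] .
  define \<rho> where "\<rho> = norm x + norm e + r"
  obtain a b :: 'a where ab: "cball 0 \<rho> \<subseteq> cbox a b" using ex_cbox_cball .
  have eq: "convol J h (x + s *\<^sub>R e) = integral (cbox a b) (\<lambda>y. J (x + s *\<^sub>R e - y) * h y)"
    if s: "s \<in> {-1<..<1}" and J: "continuous_on UNIV J" "vanishes_beyond r J" for s J
    unfolding convol_def
  proof (rule integral_eq_cbox[OF _ _ ab])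
    have "norm (x + s *\<^sub>R e) \<le> norm x + norm (s *\<^sub>R e)" by (rule norm_triangle_ineq)
    also have "norm (s *\<^sub>R e) \<le> norm e" using s by (auto intro!: mult_left_le_one_le)
    finally have "norm (x + s *\<^sub>R e) + r \<le> \<rho>" by (simp add: \<rho>_def)
    then show "vanishes_beyond \<rho> (\<lambda>y. J (x + s *\<^sub>R e - y) * h y)"
      using vanishes_beyond_mult1 vanishes_beyond_shift[OF J(2)] vanishes_beyond_mono by blast
  qed (auto intro!: continuous_intros continuous_on_UNIV_compose[OF h] continuous_on_UNIV_compose[OF J(1)])
  have "((\<lambda>s. integral (cbox a b) (\<lambda>y. K (x + s *\<^sub>R e - y) * h y)) has_real_derivative
      integral (cbox a b) (\<lambda>y. K' (x + 0 *\<^sub>R e - y) * h y)) (at 0 within UNIV)"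
  proof (rule leibniz_rule_field_derivative)
    show "((\<lambda>s. K (x + s *\<^sub>R e - t) * h t) has_real_derivative K' (x + s *\<^sub>R e - t) * h t)
        (at s within UNIV)" for s t
      using DERIV_cmult_right[OF has_dirderiv_at[OF dd, of "x - t" s], of "h t"]
      by (simp add: algebra_simps)
    show "(\<lambda>y. K (x + s *\<^sub>R e - y) * h y) integrable_on cbox a b" for s
      by (auto intro!: integrable_continuous continuous_intros continuous_on_UNIV_compose[OF h]
          continuous_on_UNIV_compose[OF K])
    show "continuous_on (UNIV \<times> cbox a b) (\<lambda>(s, y). K' (x + s *\<^sub>R e - y) * h y)"
      by (auto simp: case_prod_beta intro!: continuous_intros continuous_on_UNIV_compose[OF h]
          continuous_on_UNIV_compose[OF K'])
  qed auto
  moreover have "integral (cbox a b) (\<lambda>y. K' (x + 0 *\<^sub>R e - y) * h y) = convol K' h x"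
    using eq[OF _ K' v', of 0] by simp
  moreover have "eventually (\<lambda>s. convol K h (x + s *\<^sub>R e) =
      integral (cbox a b) (\<lambda>y. K (x + s *\<^sub>R e - y) * h y)) (nhds 0)"
    by (rule eventually_nhds_in_open[THEN eventually_mono, of "{-1<..<1}"]) (auto intro: eq[OF _ K v])
  ultimately show "((\<lambda>s. convol K h (x + s *\<^sub>R e)) has_real_derivative convol K' h x) (at 0)"
    by (subst DERIV_cong_ev[OF refl _ refl]) auto
qed

text \<open>Fubini: convolution with an even kernel is symmetric for the pairing \<open>\<integral> f h\<close>.\<close>

lemma integral_convol_swap:
  fixes f h :: "'a::euclidean_space \<Rightarrow> real"
  assumes K: "continuous_on UNIV K" and v: "vanishes_beyond r K" and even: "\<And>x. K (- x) = K x"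
    and h: "continuous_on UNIV h" and vh: "vanishes_beyond s h" and f: "continuous_on UNIV f"
  shows "(\<integral>x. f x * convol K h x \<partial>lborel) = (\<integral>x. h x * convol K f x \<partial>lborel)"
proof -
  have "integrable (lborel :: ('a \<times> 'a) measure) (\<lambda>(x, y). f x * (K (x - y) * h y))"
  proof (rule integrable_compactly_supported)
    show "vanishes_beyond ((r + s) + s) (\<lambda>(x::'a, y::'a). f x * (K (x - y) * h y))"
      unfolding vanishes_beyond_def
    proof (clarify)
      fix x y :: 'a assume n: "r + s + s < norm (x, y)"
      show "f x * (K (x - y) * h y) = 0"
      proof (cases "s < norm y")
        case False
        then have "r < norm (x - y)"
          using n norm_Pair_le[of x y] norm_triangle_sub[of x y] by simp
        then show ?thesis using v by (simp add: vanishes_beyond_def)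
      qed (use vh in \<open>simp add: vanishes_beyond_def\<close>)
    qed
  qed (auto simp: case_prod_beta intro!: continuous_intros continuous_on_UNIV_compose[OF h]
      continuous_on_UNIV_compose[OF f] continuous_on_UNIV_compose[OF K])
  then have int: "integrable (lborel \<Otimes>\<^sub>M lborel) (\<lambda>(x::'a, y::'a). f x * (K (x - y) * h y))"
    by (simp add: lborel_prod)
  have "(\<integral>x. f x * convol K h x \<partial>lborel) = (\<integral>x. (\<integral>y. f x * (K (x - y) * h y) \<partial>lborel) \<partial>lborel)"
    by (simp add: convol_def)
  also have "\<dots> = (\<integral>y. (\<integral>x. f x * (K (x - y) * h y) \<partial>lborel) \<partial>lborel)"
    by (rule lborel_pair.Fubini_integral[OF int, symmetric])
  also have "\<dots> = (\<integral>y. h y * convol K f y \<partial>lborel)"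
  proof (rule Bochner_Integration.integral_cong[OF refl])
    fix y
    have "(\<lambda>x. f x * (K (x - y) * h y)) = (\<lambda>x. h y * (K (y - x) * f x))"
      using even[of "y - _"] by (auto simp: fun_eq_iff)
    then show "(\<integral>x. f x * (K (x - y) * h y) \<partial>lborel) = h y * convol K f y"
      by (simp add: convol_def)
  qed
  finally show ?thesis .
qed

lemma integral_kernel_shift:
  assumes "continuous_on UNIV (K :: 'a::euclidean_space \<Rightarrow> real)"
  shows "(\<integral>y. K (x - y) \<partial>lborel) = integral\<^sup>L lborel K"
  using assms by (intro lborel_integral_minus borel_measurable_continuous_onI)

text \<open>Young's inequality for a nonnegative kernel: by Cauchy-Schwarz with weight \<open>K(x - y)\<close>, the square of the
  convolution is at most \<open>\<integral>K\<close> times the convolution of \<open>h\<^sup>2\<close>, and the latter can be integrated by Fubini.\<close>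

lemma convol_L2_le:
  fixes h :: "'a::euclidean_space \<Rightarrow> real"
  assumes K: "continuous_on UNIV K" and v: "vanishes_beyond r K" and even: "\<And>x. K (- x) = K x"
    and nn: "\<And>x. 0 \<le> K x"
    and h: "continuous_on UNIV h" and vh: "vanishes_beyond s h"
  shows "(\<integral>x. (convol K h x)\<^sup>2 \<partial>lborel) \<le> (integral\<^sup>L lborel K)\<^sup>2 * (\<integral>x. (h x)\<^sup>2 \<partial>lborel)"
proof -
  define N where "N = integral\<^sup>L lborel K"
  have h2: "continuous_on UNIV (\<lambda>x. (h x)\<^sup>2)" using h by (intro continuous_intros)
  have vh2: "vanishes_beyond s (\<lambda>x. (h x)\<^sup>2)" using vh by (auto simp: vanishes_beyond_def)
  have pw: "(convol K h x)\<^sup>2 \<le> N * convol K (\<lambda>x. (h x)\<^sup>2) x" for x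
  proof -
    have "(\<integral>y. sqrt (K (x - y)) * (sqrt (K (x - y)) * h y) \<partial>lborel)\<^sup>2
       \<le> (\<integral>y. (sqrt (K (x - y)))\<^sup>2 \<partial>lborel) * (\<integral>y. (sqrt (K (x - y)) * h y)\<^sup>2 \<partial>lborel)"
      using convol_integrable[OF K v h, of x] convol_integrable[OF K v h2, of x]
        convol_integrable[OF K v continuous_on_const[of _ 1], of x] nn
      by (intro integral_Cauchy_Schwarz) (auto simp: power_mult_distrib mult.assoc[symmetric])
    then show ?thesis
      using nn integral_kernel_shift[OF K, of x]
      by (simp add: power_mult_distrib mult.assoc[symmetric] convol_def N_def)
  qed
  have cc: "continuous_on UNIV (convol K h)" "vanishes_beyond (r + s) (convol K h)"
    and cc2: "continuous_on UNIV (convol K (\<lambda>x. (h x)\<^sup>2))" "vanishes_beyond (r + s) (convol K (\<lambda>x. (h x)\<^sup>2))"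
    using continuous_on_convol K v h h2 vanishes_beyond_convol vh vh2 by blast+
  have "(\<integral>x. (convol K h x)\<^sup>2 \<partial>lborel) \<le> (\<integral>x. N * convol K (\<lambda>x. (h x)\<^sup>2) x \<partial>lborel)"
    using cc cc2 by (intro integral_mono pw integrable_compactly_supported[of _ "r + s"] vanishes_beyond_mult2)
      (auto intro!: continuous_intros simp: vanishes_beyond_def)
  also have "\<dots> = N * (\<integral>x. 1 * convol K (\<lambda>x. (h x)\<^sup>2) x \<partial>lborel)" by simp
  also have "(\<integral>x. 1 * convol K (\<lambda>x. (h x)\<^sup>2) x \<partial>lborel) = (\<integral>x. (h x)\<^sup>2 * convol K (\<lambda>_. 1) x \<partial>lborel)"
    by (rule integral_convol_swap[OF K v even h2 vh2]) auto
  also have "convol K (\<lambda>_. 1) = (\<lambda>_. N)"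
    using integral_kernel_shift[OF K] by (simp add: convol_def N_def fun_eq_iff)
  also have "N * (\<integral>x. (h x)\<^sup>2 * N \<partial>lborel) = N\<^sup>2 * (\<integral>x. (h x)\<^sup>2 \<partial>lborel)"
    by (simp add: power2_eq_square[of N])
  finally show ?thesis by (simp add: N_def)
qed

text \<open>The normalization keeps the integral of \<open>K\<close>.\<close>

definition dilate :: "real \<Rightarrow> ('a::euclidean_space \<Rightarrow> real) \<Rightarrow> 'a \<Rightarrow> real" where
  "dilate s K x = K (x /\<^sub>R s) / s ^ DIM('a)"

lemma dilate_basic:
  fixes K :: "'a::euclidean_space \<Rightarrow> real"
  assumes "continuous_on UNIV K" "vanishes_beyond 1 K" "0 < s"
  shows continuous_on_dilate: "continuous_on UNIV (dilate s K)"
    and vanishes_beyond_dilate: "vanishes_beyond s (dilate s K)"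
    and integral_dilate: "integral\<^sup>L lborel (dilate s K) = integral\<^sup>L lborel K"
proof -
  show "continuous_on UNIV (dilate s K)"
    unfolding dilate_def[abs_def] using assms
    by (auto intro!: continuous_intros continuous_on_UNIV_compose[OF assms(1)])
  then have m: "dilate s K \<in> borel_measurable borel"
    by (rule borel_measurable_continuous_onI)
  show "vanishes_beyond s (dilate s K)"
    using assms(2,3) by (auto simp: vanishes_beyond_def dilate_def field_simps)
  show "integral\<^sup>L lborel (dilate s K) = integral\<^sup>L lborel K"
    using lborel_integral_scale[OF m assms(3)] assms(3) by (simp add: dilate_def)
qed

text \<open>Convolution with kernels concentrating at the origin converges uniformly to a multiple of \<open>h\<close>, because \<open>h\<close> is
  uniformly continuous. The limit is stated as one good scale for each tolerance.\<close>

lemma convol_approximates: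
  fixes h f :: "'a::euclidean_space \<Rightarrow> real"
  assumes K: "continuous_on UNIV K" and v: "vanishes_beyond 1 K" and nn: "\<And>x. 0 \<le> K x"
    and h: "continuous_on UNIV h" and vh: "vanishes_beyond r h" and f: "continuous_on UNIV f"
    and "0 < \<epsilon>"
  shows "\<exists>s. 0 < s \<and> s < 1 \<and> \<bar>(\<integral>x. f x * convol (dilate s K) h x \<partial>lborel)
      - integral\<^sup>L lborel K * (\<integral>x. f x * h x \<partial>lborel)\<bar> \<le> \<epsilon>"
proof -
  define N where "N = integral\<^sup>L lborel K"
  define M where "M = (LINT x:cball 0 (r+1)|lborel. \<bar>f x\<bar>)"
  have N: "N \<ge> 0" and M: "M \<ge> 0" using nn by (auto simp: N_def M_def set_lebesgue_integral_def)
  define \<eta> where "\<eta> = \<epsilon> / (M * N + 1)"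
  have \<eta>: "\<eta> > 0" using N M \<open>0 < \<epsilon>\<close> by (auto simp: \<eta>_def intro!: divide_pos_pos add_nonneg_pos)
  have "uniformly_continuous_on (cball 0 (r+2)) h"
    using h by (intro compact_uniformly_continuous) (auto intro: continuous_on_subset)
  then obtain d where d: "d > 0" "\<And>x y. x \<in> cball 0 (r+2) \<Longrightarrow> y \<in> cball 0 (r+2) \<Longrightarrow> dist y x < d \<Longrightarrow> dist (h y) (h x) < \<eta>"
    unfolding uniformly_continuous_on_def using \<eta> by metis
  define s where "s = min (d/2) (1/2)"
  have s: "0 < s" "s < 1" "s < d" using d(1) by (auto simp: s_def)
  define k where "k = dilate s K"
  have k: "continuous_on UNIV k" "vanishes_beyond s k" "integral\<^sup>L lborel k = N"
    using dilate_basic[OF K v s(1)] by (auto simp: k_def N_def)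
  have knn: "0 \<le> k x" for x using nn s by (simp add: k_def dilate_def)
  have kint: "integrable lborel k" using integrable_compactly_supported k by blast
  have close: "\<bar>convol k h x - N * h x\<bar> \<le> N * \<eta>" if x: "x \<in> cball 0 (r+1)" for x
  proof -
    have i1: "integrable lborel (\<lambda>y. k y * h (x - y))"
      using k h by (intro integrable_compactly_supported[of _ s] vanishes_beyond_mult1 continuous_intros
         continuous_on_UNIV_compose[OF h])
    have "convol k h x - N * h x = (\<integral>y. k y * h (x - y) \<partial>lborel) - (\<integral>y. k y * h x \<partial>lborel)"
      using k(3) by (simp add: convol_commute[OF k(1) h])
    also have "\<dots> = (\<integral>y. k y * h (x - y) - k y * h x \<partial>lborel)"
      using i1 kint by simp
    finally have "\<bar>convol k h x - N * h x\<bar> \<le> (\<integral>y. \<bar>k y * h (x - y) - k y * h x\<bar> \<partial>lborel)"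
      by simp
    also have "\<dots> \<le> (\<integral>y. k y * \<eta> \<partial>lborel)"
    proof (rule integral_mono)
      fix y
      show "\<bar>k y * h (x - y) - k y * h x\<bar> \<le> k y * \<eta>"
      proof (cases "s < norm y")
        case True then show ?thesis using k(2) by (simp add: vanishes_beyond_def)
      next
        case False
        then have "\<bar>h (x - y) - h x\<bar> < \<eta>"
          using d(2)[of x "x - y"] x s norm_triangle_ineq4[of x y]
            norm_minus_commute[of y x] by (simp add: dist_norm)
        then have "k y * \<bar>h (x - y) - h x\<bar> \<le> k y * \<eta>" using knn[of y] by (intro mult_left_mono) auto
        then show ?thesis using knn[of y] by (simp add: right_diff_distrib[symmetric] abs_mult)
      qed
    qed (use i1 kint in auto)
    also have "\<dots> = N * \<eta>" using k(3) by simp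
    finally show ?thesis .
  qed
  have vk: "vanishes_beyond (r + 1) (convol k h)"
    using vanishes_beyond_mono[OF vanishes_beyond_convol[OF k(2) vh]] s by simp
  have vh': "vanishes_beyond (r + 1) h" using vanishes_beyond_mono[OF vh] by simp
  have cont: "continuous_on UNIV (convol k h)" using continuous_on_convol[OF k(1,2) h] .
  have int: "integrable lborel (\<lambda>x. f x * convol k h x)" "integrable lborel (\<lambda>x. f x * h x)"
    using f cont h vk vh'
    by (auto intro!: integrable_compactly_supported vanishes_beyond_mult2 continuous_intros)
  have "\<bar>(\<integral>x. f x * convol k h x \<partial>lborel) - N * (\<integral>x. f x * h x \<partial>lborel)\<bar>
      = \<bar>\<integral>x. f x * convol k h x - N * (f x * h x) \<partial>lborel\<bar>"
    using int by simp
  also have "\<dots> \<le> (\<integral>x. \<bar>f x * convol k h x - N * (f x * h x)\<bar> \<partial>lborel)" by simp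
  also have "\<dots> \<le> (\<integral>x. (indicator (cball 0 (r+1)) x * \<bar>f x\<bar>) * (N * \<eta>) \<partial>lborel)"
  proof (rule integral_mono)
    show "integrable lborel (\<lambda>x. (indicator (cball 0 (r+1)) x * \<bar>f x\<bar>) * (N * \<eta>))"
      using integral_set_cball(1)[of "\<lambda>x. \<bar>f x\<bar>"] f by (intro integrable_mult_left) (auto intro: continuous_intros)
    fix x
    show "\<bar>f x * convol k h x - N * (f x * h x)\<bar> \<le> indicator (cball 0 (r+1)) x * \<bar>f x\<bar> * (N * \<eta>)"
    proof (cases "x \<in> cball 0 (r+1)")
      case True
      have "\<bar>f x * convol k h x - N * (f x * h x)\<bar> = \<bar>f x\<bar> * \<bar>convol k h x - N * h x\<bar>"
        by (simp add: abs_mult[symmetric] algebra_simps)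
      also have "\<dots> \<le> \<bar>f x\<bar> * (N * \<eta>)" using close[OF True] by (intro mult_left_mono) auto
      finally show ?thesis using True by simp
    next
      case False
      then show ?thesis using vk vh' by (simp add: vanishes_beyond_def)
    qed
  qed (use int in auto)
  also have "\<dots> = M * N * \<eta>" by (simp add: M_def set_lebesgue_integral_def)
  also have "\<dots> \<le> (M * N + 1) * \<eta>" using \<eta> by (simp add: algebra_simps)
  also have "\<dots> = \<epsilon>"
  proof -
    have "M * N + 1 \<noteq> 0" using M N by (metis add_nonneg_pos less_irrefl mult_nonneg_nonneg zero_less_one)
    then show ?thesis by (simp add: \<eta>_def)
  qed
  finally show ?thesis using s unfolding k_def N_def by blast
qed

section \<open>A truncated Newtonian kernel\<close>

text \<open>Besides being a cutoff, this is, up to a factor, the density whose Newtonian potential is the kernel of the next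
  definitions.\<close>

definition bump :: "'a::real_inner \<Rightarrow> real" where
  "bump x = (max 0 (1 - x \<bullet> x))\<^sup>2"

text \<open>The profile of \<open>bump\<close> is continuously differentiable across its edge.\<close>

lemma DERIV_max0_squared:
  "((\<lambda>t. (max 0 (1 - t))\<^sup>2) has_real_derivative - 2 * max 0 (1 - t)) (at t)" for t :: real
proof (cases t "1::real" rule: linorder_cases)
  case less
  then have "eventually (\<lambda>t. (max 0 (1 - t))\<^sup>2 = (1 - t)\<^sup>2) (nhds t)"
    by (intro eventually_nhds_in_open[THEN eventually_mono, of "{..<1}"]) auto
  moreover have "((\<lambda>t. (1 - t)\<^sup>2) has_real_derivative - 2 * max 0 (1 - t)) (at t)"
    using less by (auto intro!: derivative_eq_intros)
  ultimately show ?thesis by (subst DERIV_cong_ev[OF refl _ refl])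
next
  case greater
  then have "eventually (\<lambda>t::real. (max 0 (1 - t))\<^sup>2 = 0) (nhds t)"
    by (intro eventually_nhds_in_open[THEN eventually_mono, of "{1<..}"]) auto
  moreover have "((\<lambda>t. 0) has_real_derivative - 2 * max 0 (1 - t)) (at t)"
    using greater by simp
  ultimately show ?thesis by (subst DERIV_cong_ev[OF refl _ refl])
next
  case equal
  have "((\<lambda>h::real. max 0 (- h) * (max 0 (- h) / h)) \<longlongrightarrow> 0) (at 0)"
  proof (rule Lim_null_comparison[where g="\<lambda>h. max 0 (- h)"])
    show "((\<lambda>h::real. max 0 (- h)) \<longlongrightarrow> 0) (at 0)"
      by (rule tendsto_eq_intros refl)+ simp
    show "eventually (\<lambda>h::real. norm (max 0 (- h) * (max 0 (- h) / h)) \<le> max 0 (- h)) (at 0)"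
      by (intro always_eventually) (auto simp: max_def abs_mult)
  qed
  then have "(\<lambda>h::real. ((max 0 (1 - (1 + h)))\<^sup>2 - (max 0 (1 - 1))\<^sup>2) / h) \<midarrow>0\<rightarrow> 0"
    by (simp add: power2_eq_square)
  then show ?thesis using equal by (simp add: DERIV_def)
qed

lemma continuous_on_bump [continuous_intros]: "continuous_on A bump"
  unfolding bump_def[abs_def] by (intro continuous_intros)

lemma has_dirderiv_bump: "has_dirderiv bump e (\<lambda>x. - 4 * max 0 (1 - x \<bullet> x) * (x \<bullet> e))"
proof -
  have "has_dirderiv (\<lambda>x. (max 0 (1 - x \<bullet> x))\<^sup>2) e (\<lambda>x. - 2 * max 0 (1 - x \<bullet> x) * (2 * (x \<bullet> e)))"
    by (rule has_dirderiv_chain[OF DERIV_max0_squared has_dirderiv_self_inner])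
  then show ?thesis by (simp add: bump_def[abs_def] mult_ac)
qed

lemma norm_gt_1_iff: "1 < norm x \<longleftrightarrow> 1 < x \<bullet> x"
  by (metis abs_norm_cancel abs_one abs_square_le_1 linorder_not_less one_power2 power2_norm_eq_inner)

lemma vanishes_beyond_bump: "vanishes_beyond 1 bump"
  by (auto simp: vanishes_beyond_def bump_def norm_gt_1_iff)

lemma bump_nonneg: "0 \<le> bump x" by (simp add: bump_def)

lemma bump_le_1: "bump x \<le> 1"
  by (auto simp: bump_def intro!: power_le_one)

lemma bump_minus: "bump (- x) = bump x" by (simp add: bump_def)

lemma bump_pos:
  assumes "norm x < 1" shows "0 < bump x"
proof -
  have "(norm x)\<^sup>2 < 1\<^sup>2" using assms by (intro power_strict_mono) auto
  then have "0 < max 0 (1 - x \<bullet> x)" unfolding power2_norm_eq_inner by simp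
  then show ?thesis unfolding bump_def by (rule zero_less_power)
qed

lemma bump_half_ge:
  assumes "norm x \<le> 1/2" shows "9/16 \<le> bump x"
proof -
  have "x \<bullet> x \<le> 1/4"
    using power_mono[OF assms, of 2] unfolding power2_norm_eq_inner by (simp add: power2_eq_square)
  then have "(3/4)\<^sup>2 \<le> (max 0 (1 - x \<bullet> x))\<^sup>2" by (intro power_mono) auto
  then show ?thesis by (simp add: bump_def power2_eq_square)
qed

lemma integral_bump_pos: "0 < integral\<^sup>L lborel (bump :: 'a::euclidean_space \<Rightarrow> real)"
proof -
  have int: "integrable lborel (bump :: 'a \<Rightarrow> real)"
    by (rule integrable_compactly_supported[OF continuous_on_bump vanishes_beyond_bump])
  have "0 < (9/16) * measure lborel (cball (0::'a) (1/2))"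
    using content_cball_pos[of "1/2" "0::'a"] by simp
  also have "\<dots> = (\<integral>x. (9/16) * indicator (cball (0::'a) (1/2)) x \<partial>lborel)"
    by simp
  also have "\<dots> \<le> integral\<^sup>L lborel (bump :: 'a \<Rightarrow> real)"
  proof (rule integral_mono)
    show "integrable lborel (\<lambda>x. (9/16) * indicator (cball (0::'a) (1/2)) x :: real)"
      using emeasure_lborel_cball_finite[of "0::'a" "1/2"] by simp
    fix x :: 'a show "(9/16) * indicator (cball (0::'a) (1/2)) x \<le> bump x"
      using bump_half_ge[of x] bump_nonneg[of x] by (auto simp: indicator_def)
  qed (rule int)
  finally show ?thesis .
qed

lemma DERIV_piecewise:
  fixes f g :: "real \<Rightarrow> real"
  assumes "\<And>t. t \<le> c \<Longrightarrow> (f has_real_derivative f' t) (at t)"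
    and "\<And>t. c \<le> t \<Longrightarrow> (g has_real_derivative g' t) (at t)"
    and "f c = g c" "f' c = g' c"
  shows "((\<lambda>t. if t \<le> c then f t else g t) has_real_derivative (if t \<le> c then f' t else g' t)) (at t)"
proof -
  have "((\<lambda>t. if t \<in> {..c} then f t else g t) has_derivative
      (if t \<in> {..c} then (*) (f' t) else (*) (g' t))) (at t within {..c} \<union> {c<..})"
  proof (rule has_derivative_If_within_closures)
    have *: "{..c} \<union> (closure {..c} \<inter> closure {c<..}) = {..c}"
      "{c<..} \<union> (closure {..c} \<inter> closure {c<..}) = {c..}" by auto
    show "(f has_derivative (*) (f' t)) (at t within {..c} \<union> (closure {..c} \<inter> closure {c<..}))"
      if "t \<in> {..c} \<union> (closure {..c} \<inter> closure {c<..})"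
      using assms(1)[of t] that unfolding * has_field_derivative_def
      by (auto intro: has_derivative_at_withinI)
    show "(g has_derivative (*) (g' t)) (at t within {c<..} \<union> (closure {..c} \<inter> closure {c<..}))"
      if "t \<in> {c<..} \<union> (closure {..c} \<inter> closure {c<..})"
      using assms(2)[of t] that unfolding * has_field_derivative_def
      by (auto intro: has_derivative_at_withinI)
  qed (use assms in auto)
  moreover have "{..c} \<union> {c<..} = UNIV" by auto
  moreover have "(if t \<in> {..c} then (*) (f' t) else (*) (g' t)) = (*) (if t \<le> c then f' t else g' t)"
    by auto
  ultimately show ?thesis by (simp add: has_field_derivative_def)
qed

text \<open>The function \<open>t \<mapsto> t\<^sup>-\<^sup>1\<^sup>/\<^sup>2\<close>, continued below \<open>t = 1\<close> by its Taylor polynomial of degree 3 at 1, so that three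
  derivatives (\<open>newton1\<close>, \<open>newton2\<close>, \<open>newton3\<close>) are continuous. With \<open>t = \<bar>x\<bar>\<^sup>2\<close> it is the function \<open>1/\<bar>x\<bar>\<close> with the
  singularity removed inside the unit ball.\<close>

definition newton0 :: "real \<Rightarrow> real" where
  "newton0 t = (if t \<le> 1 then 1 - (t - 1) / 2 + 3 / 8 * (t - 1)\<^sup>2 - 5 / 16 * (t - 1)^3 else t powr (- (1/2)))"
definition newton1 :: "real \<Rightarrow> real" where
  "newton1 t = (if t \<le> 1 then - 1 / 2 + 3 / 4 * (t - 1) - 15 / 16 * (t - 1)\<^sup>2 else - 1 / 2 * t powr (- (3/2)))"
definition newton2 :: "real \<Rightarrow> real" where
  "newton2 t = (if t \<le> 1 then 3 / 4 - 15 / 8 * (t - 1) else 3 / 4 * t powr (- (5/2)))"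
definition newton3 :: "real \<Rightarrow> real" where
  "newton3 t = (if t \<le> 1 then - 15 / 8 else - 15 / 8 * t powr (- (7/2)))"

lemma DERIV_newton0: "(newton0 has_real_derivative newton1 t) (at t)"
  unfolding newton0_def[abs_def] newton1_def
  by (rule DERIV_piecewise) (auto intro!: derivative_eq_intros has_real_derivative_powr simp: power2_eq_square)

lemma DERIV_newton1: "(newton1 has_real_derivative newton2 t) (at t)"
  unfolding newton1_def[abs_def] newton2_def
  by (rule DERIV_piecewise) (auto intro!: derivative_eq_intros has_real_derivative_powr)

lemma DERIV_newton2: "(newton2 has_real_derivative newton3 t) (at t)"
  unfolding newton2_def[abs_def] newton3_def
  by (rule DERIV_piecewise) (auto intro!: derivative_eq_intros has_real_derivative_powr)

lemma continuous_on_newton: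
  "continuous_on UNIV newton0" "continuous_on UNIV newton1"
  "continuous_on UNIV newton2" "continuous_on UNIV newton3"
proof -
  show "continuous_on UNIV newton0" "continuous_on UNIV newton1" "continuous_on UNIV newton2"
    using DERIV_newton0 DERIV_newton1 DERIV_newton2
    by (auto intro!: continuous_at_imp_continuous_on DERIV_isCont)
  have "newton3 = (\<lambda>t. - 15 / 8 * max 1 t powr (- (7/2)))"
    by (auto simp: newton3_def fun_eq_iff max_def)
  moreover have "continuous_on UNIV (\<lambda>t::real. - 15 / 8 * max 1 t powr (- (7/2)))"
    by (intro continuous_intros) (auto simp: max_def)
  ultimately show "continuous_on UNIV newton3" by (simp only:)
qed

text \<open>The left-hand side is the Laplacian of \<open>x \<mapsto> newton0 (\<bar>x\<bar>\<^sup>2)\<close> at \<open>t = \<bar>x\<bar>\<^sup>2\<close> in dimension three. It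
  vanishes for \<open>t > 1\<close>, since \<open>1/\<bar>x\<bar>\<close> is harmonic, and the Taylor polynomial happens to make it a multiple of the profile of
  \<open>bump\<close> for \<open>t \<le> 1\<close>.\<close>

lemma newton_laplace: "6 * newton1 t + 4 * t * newton2 t = - (105 / 8) * (max 0 (1 - t))\<^sup>2"
proof (cases "t \<le> 1")
  case True
  then show ?thesis by (simp add: newton1_def newton2_def) (simp add: power2_eq_square field_simps)
next
  case False
  have "t powr (- (3/2)) = t powr (1 + - (5/2))" by simp
  also have "\<dots> = t * t powr (- (5/2))" using False by (subst powr_add) auto
  finally show ?thesis using False by (simp add: newton1_def newton2_def)
qed

text \<open>The kernel \<open>1/\<bar>x\<bar>\<close> smoothed inside the ball of radius \<open>s\<close>; the definitions that follow are its first three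
  derivatives in the directions \<open>a\<close>, \<open>b\<close>, \<open>c\<close>.\<close>

definition newton_kernel :: "real \<Rightarrow> 'a::real_inner \<Rightarrow> real" where
  "newton_kernel s x = newton0 (x \<bullet> x / s\<^sup>2) / s"
definition newton_kernel1 :: "real \<Rightarrow> 'a::real_inner \<Rightarrow> 'a \<Rightarrow> real" where
  "newton_kernel1 s a x = 2 / s^3 * ((x \<bullet> a) * newton1 (x \<bullet> x / s\<^sup>2))"
definition newton_kernel2 :: "real \<Rightarrow> 'a::real_inner \<Rightarrow> 'a \<Rightarrow> 'a \<Rightarrow> real" where
  "newton_kernel2 s a b x = 2 / s^3 * ((a \<bullet> b) * newton1 (x \<bullet> x / s\<^sup>2))
     + 4 / s^5 * ((x \<bullet> a) * (x \<bullet> b) * newton2 (x \<bullet> x / s\<^sup>2))"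
definition newton_kernel3 :: "real \<Rightarrow> 'a::real_inner \<Rightarrow> 'a \<Rightarrow> 'a \<Rightarrow> 'a \<Rightarrow> real" where
  "newton_kernel3 s a b c x = 4 / s^5 * (((a \<bullet> b) * (x \<bullet> c) + (a \<bullet> c) * (x \<bullet> b) + (b \<bullet> c) * (x \<bullet> a))
       * newton2 (x \<bullet> x / s\<^sup>2))
     + 8 / s^7 * ((x \<bullet> a) * (x \<bullet> b) * (x \<bullet> c) * newton3 (x \<bullet> x / s\<^sup>2))"

lemma has_dirderiv_inner': "has_dirderiv (\<lambda>x. x \<bullet> a) e (\<lambda>x. e \<bullet> a)"
  using has_dirderiv_inner[of a e] by (simp add: inner_commute)

lemma has_dirderiv_cong: "has_dirderiv f e g \<Longrightarrow> (\<And>x. g x = g' x) \<Longrightarrow> has_dirderiv f e g'"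
  by (simp add: has_dirderiv_def)

lemma has_dirderiv_radial:
  assumes "\<And>t. (\<theta> has_real_derivative \<theta>' t) (at t)"
  shows "has_dirderiv (\<lambda>x. \<theta> (x \<bullet> x / s\<^sup>2)) e (\<lambda>x. 2 / s\<^sup>2 * ((x \<bullet> e) * \<theta>' (x \<bullet> x / s\<^sup>2)))"
  using has_dirderiv_chain[OF assms has_dirderiv_cmult[OF has_dirderiv_self_inner[of e], of "1 / s\<^sup>2"]]
  by (simp add: mult_ac)

lemma has_dirderiv_newton_kernel:
  "has_dirderiv (newton_kernel s) a (newton_kernel1 s a)"
  "has_dirderiv (newton_kernel1 s a) b (newton_kernel2 s a b)"
  "has_dirderiv (newton_kernel2 s a b) c (newton_kernel3 s a b c)"
proof -
  note ddi = has_dirderiv_cmult has_dirderiv_mult has_dirderiv_add has_dirderiv_radial[OF DERIV_newton0]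
    has_dirderiv_radial[OF DERIV_newton1] has_dirderiv_radial[OF DERIV_newton2] has_dirderiv_inner' has_dirderiv_const
  have "has_dirderiv (\<lambda>x. (1 / s) * newton0 (x \<bullet> x / s\<^sup>2)) a (newton_kernel1 s a)"
    unfolding newton_kernel1_def
    by (rule has_dirderiv_cong, (rule ddi)+) (auto simp: power2_eq_square power3_eq_cube)
  then show "has_dirderiv (newton_kernel s) a (newton_kernel1 s a)"
    by (simp add: newton_kernel_def[abs_def])
  show "has_dirderiv (newton_kernel1 s a) b (newton_kernel2 s a b)"
    unfolding newton_kernel1_def[abs_def] newton_kernel2_def
    by (rule has_dirderiv_cong, (rule ddi)+)
      (auto simp: inner_commute algebra_simps eval_nat_numeral divide_simps)
  show "has_dirderiv (newton_kernel2 s a b) c (newton_kernel3 s a b c)"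
    unfolding newton_kernel2_def[abs_def] newton_kernel3_def
    by (rule has_dirderiv_cong, (rule ddi)+)
      (auto simp: inner_commute algebra_simps eval_nat_numeral divide_simps)
qed

lemma continuous_on_newton_kernel:
  fixes a b c :: "'a::real_inner"
  shows "continuous_on UNIV (newton_kernel s :: 'a \<Rightarrow> real)" "continuous_on UNIV (newton_kernel1 s a)"
  "continuous_on UNIV (newton_kernel2 s a b)" "continuous_on UNIV (newton_kernel3 s a b c)"
proof -
  have q: "continuous_on UNIV (\<lambda>x::'a. x \<bullet> x / s\<^sup>2)"
    by (cases "s = 0") (auto intro!: continuous_intros)
  show "continuous_on UNIV (newton_kernel s :: 'a \<Rightarrow> real)"
    unfolding newton_kernel_def[abs_def] divide_inverse[of _ s]
    by (intro continuous_intros continuous_on_UNIV_compose[OF continuous_on_newton(1) q])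
  show "continuous_on UNIV (newton_kernel1 s a)"
    "continuous_on UNIV (newton_kernel2 s a b)" "continuous_on UNIV (newton_kernel3 s a b c)"
    unfolding newton_kernel1_def[abs_def] newton_kernel2_def[abs_def] newton_kernel3_def[abs_def]
    by (intro continuous_intros continuous_on_UNIV_compose[OF continuous_on_newton(2) q]
       continuous_on_UNIV_compose[OF continuous_on_newton(3) q]
       continuous_on_UNIV_compose[OF continuous_on_newton(4) q])+
qed

lemma newton_kernel_outside:
  assumes "0 < s" "s \<le> norm x"
  shows "newton_kernel s x = 1 / norm x"
proof -
  have x: "0 < norm x" using assms by linarith
  have eq: "x \<bullet> x / s\<^sup>2 = (norm x / s)\<^sup>2" by (simp add: power_divide power2_norm_eq_inner)
  have "newton0 ((norm x / s)\<^sup>2) = s / norm x"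
  proof (cases "(norm x / s)\<^sup>2 \<le> 1")
    case True
    then have "norm x / s \<le> 1" using x assms(1) by (simp add: abs_square_le_1)
    then have "norm x / s = 1" using assms by (simp add: field_simps)
    then show ?thesis using assms by (simp add: newton0_def field_simps)
  next
    case False
    have "((norm x / s)\<^sup>2) powr (- (1/2)) = inverse (sqrt ((norm x / s)\<^sup>2))"
      by (simp add: powr_minus powr_half_sqrt)
    also have "\<dots> = s / norm x" using x assms by (simp add: real_sqrt_abs)
    finally show ?thesis using False by (simp add: newton0_def)
  qed
  then show ?thesis using x assms unfolding newton_kernel_def eq by (simp add: field_simps)
qed

text \<open>Both kernels equal \<open>1/\<bar>x\<bar>\<close> outside the unit ball. Their difference is a compactly supported substitute
  for the Newtonian kernel.\<close>

lemma vanishes_beyond_newton_kernel_diff: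
  assumes "0 < s" "s < 1"
  shows "vanishes_beyond 1 (\<lambda>x. newton_kernel s x - newton_kernel 1 x)"
  using assms by (auto simp: vanishes_beyond_def newton_kernel_outside)

lemma newton_kernel_laplace:
  fixes x :: "real^3"
  assumes "0 < s"
  shows "(\<Sum>i\<in>UNIV. newton_kernel2 s (axis i 1) (axis i 1) x) = - (105/8) * dilate s bump x"
proof -
  define t where "t = x \<bullet> x / s\<^sup>2"
  have sq: "(\<Sum>i\<in>UNIV. x $ i * x $ i) = t * s\<^sup>2" using assms by (simp add: t_def inner_vec_def)
  have "(\<Sum>i\<in>UNIV. newton_kernel2 s (axis i 1) (axis i 1) x)
      = (\<Sum>i\<in>UNIV. 2 / s^3 * newton1 t + 4 / s^5 * newton2 t * (x $ i * x $ i))"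
    by (intro sum.cong) (auto simp: newton_kernel2_def inner_axis inner_axis_axis t_def)
  also have "\<dots> = 6 / s^3 * newton1 t + 4 / s^5 * newton2 t * (t * s\<^sup>2)"
    unfolding sum.distrib sum_distrib_left[symmetric] sq by simp
  also have "\<dots> = (6 * newton1 t + 4 * t * newton2 t) / s^3"
    using assms by (simp add: field_simps eval_nat_numeral)
  also have "\<dots> = - (105/8) * dilate s bump x"
  proof -
    have "(x /\<^sub>R s) \<bullet> (x /\<^sub>R s) = t" by (simp add: t_def power2_eq_square divide_inverse mult_ac)
    then show ?thesis unfolding newton_laplace by (simp add: dilate_def bump_def)
  qed
  finally show ?thesis .
qed

section \<open>Local square-integral bound for the pressure\<close>

text \<open>Two integrations by parts: \<open>\<integral> (\<partial>\<^sub>i\<partial>\<^sub>jw)\<^sup>2 = \<integral> \<partial>\<^sub>i\<partial>\<^sub>iw \<partial>\<^sub>j\<partial>\<^sub>jw\<close>. The gradient \<open>w1\<close>, the Hessian \<open>w2\<close> and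
  the third derivatives \<open>w3\<close> are given as functions.\<close>

lemma integral_hessian_squared:
  fixes w2 :: "3 \<Rightarrow> 3 \<Rightarrow> real^3 \<Rightarrow> real"
  assumes c: "\<And>i. continuous_on UNIV (w1 i)" "\<And>i j. continuous_on UNIV (w2 i j)"
      "\<And>i j k. continuous_on UNIV (w3 i j k)"
    and v: "\<And>i. vanishes_beyond r (w1 i)"
    and d1: "\<And>i j. has_dirderiv (w1 i) (axis j 1) (w2 i j)"
    and d2: "\<And>i j k. has_dirderiv (w2 i j) (axis k 1) (w3 i j k)"
    and sym: "\<And>i j x. w3 i j j x = w3 j j i x"
  shows "(\<Sum>i\<in>UNIV. \<Sum>j\<in>UNIV. \<integral>x. (w2 i j x)\<^sup>2 \<partial>lborel) = (\<integral>x. (\<Sum>i\<in>UNIV. w2 i i x)\<^sup>2 \<partial>lborel)"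
proof -
  have v2: "vanishes_beyond r (w2 i j)" for i j using vanishes_beyond_dirderiv[OF v d1] .
  have int: "integrable lborel (\<lambda>x. w2 i j x * w2 k l x)" for i j k l
    using c v2 by (intro integrable_compactly_supported[of _ r] vanishes_beyond_mult1 continuous_intros)
  have "(\<integral>x. (w2 i j x)\<^sup>2 \<partial>lborel) = (\<integral>x. w2 i i x * w2 j j x \<partial>lborel)" for i j
  proof -
    have "(\<integral>x. w2 i j x * w2 i j x \<partial>lborel) = - (\<integral>x. w3 i j j x * w1 i x \<partial>lborel)"
      by (rule integration_by_parts[OF c(2) c(3) d2 c(1) c(2) d1 v])
    also have "\<dots> = - (\<integral>x. w3 j j i x * w1 i x \<partial>lborel)" by (simp only: sym[of i j])
    also have "\<dots> = (\<integral>x. w2 j j x * w2 i i x \<partial>lborel)"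
      by (rule integration_by_parts[OF c(2) c(3) d2 c(1) c(2) d1 v, symmetric])
    finally show ?thesis by (simp add: power2_eq_square mult.commute)
  qed
  then have "(\<Sum>i\<in>UNIV. \<Sum>j\<in>UNIV. \<integral>x. (w2 i j x)\<^sup>2 \<partial>lborel)
      = (\<integral>x. (\<Sum>i\<in>UNIV. \<Sum>j\<in>UNIV. w2 i i x * w2 j j x) \<partial>lborel)"
    using int by (subst Bochner_Integration.integral_sum, simp)+ simp
  then show ?thesis by (simp add: power2_eq_square sum_product)
qed

lemma integral_mult_le_local:
  fixes f g :: "'a::euclidean_space \<Rightarrow> real"
  assumes f: "continuous_on UNIV f" and g: "continuous_on UNIV g" and v: "vanishes_beyond r g"
  shows "\<bar>\<integral>x. f x * g x \<partial>lborel\<bar> \<le> sqrt (LINT x:cball 0 r|lborel. (f x)\<^sup>2) * sqrt (\<integral>x. (g x)\<^sup>2 \<partial>lborel)"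
proof -
  let ?I = "indicator (cball (0::'a) r) :: 'a \<Rightarrow> real"
  have eq: "(\<lambda>x. f x * g x) = (\<lambda>x. (?I x * f x) * g x)"
    using v by (auto simp: fun_eq_iff vanishes_beyond_def indicator_def not_le)
  have sq: "(?I x * f x)\<^sup>2 = ?I x * (f x)\<^sup>2" for x by (simp add: indicator_def)
  have "(\<integral>x. (?I x * f x) * g x \<partial>lborel)\<^sup>2
      \<le> (\<integral>x. (?I x * f x)\<^sup>2 \<partial>lborel) * (\<integral>x. (g x)\<^sup>2 \<partial>lborel)"
  proof (rule integral_Cauchy_Schwarz)
    show "integrable lborel (\<lambda>x. (?I x * f x)\<^sup>2)"
      unfolding sq using f by (intro integral_set_cball continuous_intros)
    show "integrable lborel (\<lambda>x. (g x)\<^sup>2)" "integrable lborel (\<lambda>x. (?I x * f x) * g x)"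
      using f g v unfolding eq[symmetric] power2_eq_square
      by (auto intro!: integrable_compactly_supported[of _ r] vanishes_beyond_mult2 continuous_intros)
  qed
  then have "\<bar>\<integral>x. f x * g x \<partial>lborel\<bar> \<le>
      sqrt ((LINT x:cball 0 r|lborel. (f x)\<^sup>2) * (\<integral>x. (g x)\<^sup>2 \<partial>lborel))"
    unfolding eq sq set_lebesgue_integral_def by (intro real_le_rsqrt) simp
  then show ?thesis by (simp add: real_sqrt_mult)
qed

text \<open>The equation \<open>\<nabla>P = div S\<close>, row by row and with continuous partial derivatives.\<close>

definition stress_balance :: "(real^3 \<Rightarrow> real) \<Rightarrow> (3 \<Rightarrow> 3 \<Rightarrow> real^3 \<Rightarrow> real) \<Rightarrow> bool" where
  "stress_balance P S \<longleftrightarrow> continuous_on UNIV P \<and> (\<forall>k j. continuous_on UNIV (S k j)) \<and>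
    (\<exists>dP dS. (\<forall>k. continuous_on UNIV (dP k) \<and> has_dirderiv P (axis k 1) (dP k)) \<and>
       (\<forall>k j. continuous_on UNIV (dS k j) \<and> has_dirderiv (S k j) (axis j 1) (dS k j)) \<and>
       (\<forall>k x. dP k x = (\<Sum>j\<in>UNIV. dS k j x)))"

text \<open>The distributional form of \<open>\<nabla>P = div S\<close>: no derivative falls on \<open>P\<close> or \<open>S\<close>.\<close>

lemma stress_balance_weak:
  assumes "stress_balance P S"
    and \<phi>: "continuous_on UNIV \<phi>" "\<And>j. continuous_on UNIV (\<phi>' j)"
      "\<And>j. has_dirderiv \<phi> (axis j 1) (\<phi>' j)" "vanishes_beyond r \<phi>"
  shows "(\<integral>x. P x * \<phi>' k x \<partial>lborel) = (\<Sum>j\<in>UNIV. \<integral>x. S k j x * \<phi>' j x \<partial>lborel)"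
proof -
  obtain dP dS where P: "continuous_on UNIV P" "continuous_on UNIV (dP k)" "has_dirderiv P (axis k 1) (dP k)"
    and S: "\<And>j. continuous_on UNIV (S k j)" "\<And>j. continuous_on UNIV (dS k j)"
      "\<And>j. has_dirderiv (S k j) (axis j 1) (dS k j)"
    and eq: "\<And>x. dP k x = (\<Sum>j\<in>UNIV. dS k j x)"
    using assms(1) unfolding stress_balance_def by blast
  have int: "integrable lborel (\<lambda>x. dS k j x * \<phi> x)" for j
    using S \<phi> by (auto intro!: integrable_compactly_supported[of _ r] vanishes_beyond_mult2 continuous_intros)
  have "(\<integral>x. P x * \<phi>' k x \<partial>lborel) = - (\<integral>x. dP k x * \<phi> x \<partial>lborel)"
    by (rule integration_by_parts[OF P \<phi>])
  also have "\<dots> = - (\<Sum>j\<in>UNIV. \<integral>x. dS k j x * \<phi> x \<partial>lborel)"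
    using int by (simp add: eq sum_distrib_right)
  also have "\<dots> = (\<Sum>j\<in>UNIV. \<integral>x. S k j x * \<phi>' j x \<partial>lborel)"
    unfolding sum_negf[symmetric]
    by (intro sum.cong refl integration_by_parts[OF S \<phi>, symmetric])
  finally show ?thesis .
qed

lemma stress_balance_scale:
  assumes "stress_balance P S"
  shows "stress_balance (\<lambda>x. P (R *\<^sub>R x)) (\<lambda>k j x. S k j (R *\<^sub>R x))"
proof -
  obtain dP dS where P: "continuous_on UNIV P" "\<And>k. continuous_on UNIV (dP k)" "\<And>k. has_dirderiv P (axis k 1) (dP k)"
    and S: "\<And>k j. continuous_on UNIV (S k j)" "\<And>k j. continuous_on UNIV (dS k j)"
      "\<And>k j. has_dirderiv (S k j) (axis j 1) (dS k j)"
    and eq: "\<And>k x. dP k x = (\<Sum>j\<in>UNIV. dS k j x)"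
    using assms(1) unfolding stress_balance_def by blast
  have sc: "continuous_on UNIV (\<lambda>x. R *\<^sub>R x :: real^3)" by (intro continuous_intros)
  show ?thesis unfolding stress_balance_def
  proof (intro conjI exI[of _ "\<lambda>k x. R * dP k (R *\<^sub>R x)"] exI[of _ "\<lambda>k j x. R * dS k j (R *\<^sub>R x)"] allI)
    fix k j
    show "continuous_on UNIV (\<lambda>x. P (R *\<^sub>R x))" using continuous_on_UNIV_compose[OF P(1) sc] .
    show "continuous_on UNIV (\<lambda>x. S k j (R *\<^sub>R x))" using continuous_on_UNIV_compose[OF S(1) sc] .
    show "continuous_on UNIV (\<lambda>x. R * dP k (R *\<^sub>R x))"
      using continuous_on_UNIV_compose[OF P(2) sc] by (intro continuous_intros)
    show "continuous_on UNIV (\<lambda>x. R * dS k j (R *\<^sub>R x))"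
      using continuous_on_UNIV_compose[OF S(2) sc] by (intro continuous_intros)
    show "has_dirderiv (\<lambda>x. P (R *\<^sub>R x)) (axis k 1) (\<lambda>x. R * dP k (R *\<^sub>R x))"
      using P(3) by (rule has_dirderiv_scale)
    show "has_dirderiv (\<lambda>x. S k j (R *\<^sub>R x)) (axis j 1) (\<lambda>x. R * dS k j (R *\<^sub>R x))"
      using S(3) by (rule has_dirderiv_scale)
    show "R * dP k (R *\<^sub>R x) = (\<Sum>j\<in>UNIV. R * dS k j (R *\<^sub>R x))" for x
      by (simp add: eq sum_distrib_left)
  qed
qed

definition stress_energy :: "real \<Rightarrow> (3 \<Rightarrow> 3 \<Rightarrow> real^3 \<Rightarrow> real) \<Rightarrow> real" where
  "stress_energy r S = (LINT x:cball 0 r|lborel. \<Sum>k\<in>UNIV. \<Sum>j\<in>UNIV. (S k j x)\<^sup>2)"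

lemma stress_energy_ge:
  assumes "stress_balance P S"
  shows "(LINT x:cball 0 r|lborel. (S k j x)\<^sup>2) \<le> stress_energy r S"
proof -
  have c: "continuous_on UNIV (S k j)" for k j using assms by (simp add: stress_balance_def)
  have "(S k j x)\<^sup>2 \<le> (\<Sum>k\<in>UNIV. \<Sum>j\<in>UNIV. (S k j x)\<^sup>2)" for x
    by (rule order_trans[OF member_le_sum[of j UNIV "\<lambda>j. (S k j x)\<^sup>2"]
          member_le_sum[of k UNIV "\<lambda>k. \<Sum>j\<in>UNIV. (S k j x)\<^sup>2"]])
      (auto intro: sum_nonneg)
  then show ?thesis
    unfolding stress_energy_def using c
    by (intro set_integral_mono integral_set_cball continuous_intros) auto
qed

lemma stress_energy_nonneg: "0 \<le> stress_energy r S"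
  unfolding stress_energy_def set_lebesgue_integral_def
  by (intro integral_nonneg_AE always_eventually) (auto intro!: sum_nonneg mult_nonneg_nonneg)

lemma stress_pairing_le:
  assumes "stress_balance P S" "continuous_on UNIV g" "vanishes_beyond r g" "(\<integral>x. (g x)\<^sup>2 \<partial>lborel) \<le> H"
  shows "\<bar>\<integral>x. S k j x * g x \<partial>lborel\<bar> \<le> sqrt (stress_energy r S) * sqrt H"
proof -
  have "\<bar>\<integral>x. S k j x * g x \<partial>lborel\<bar> \<le> sqrt (LINT x:cball 0 r|lborel. (S k j x)\<^sup>2) * sqrt (\<integral>x. (g x)\<^sup>2 \<partial>lborel)"
    using assms by (intro integral_mult_le_local) (auto simp: stress_balance_def)
  also have "\<dots> \<le> sqrt (stress_energy r S) * sqrt H"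
    using stress_energy_ge[OF assms(1)] assms(4) stress_energy_nonneg
    by (intro mult_mono real_sqrt_le_mono real_sqrt_ge_zero) auto
  finally show ?thesis .
qed

abbreviation bump_deriv :: "'a::real_inner \<Rightarrow> 'a \<Rightarrow> real" where
  "bump_deriv e x \<equiv> - 4 * max 0 (1 - x \<bullet> x) * (x \<bullet> e)"

text \<open>A first derivative of the mollified pressure is, by \<open>\<nabla>P = div S\<close>, a sum of convolutions of \<open>S\<close> with first
  derivatives of the bump.\<close>

lemma convol_bump_deriv_le:
  assumes S: "stress_balance P S" and z: "norm z \<le> 2"
  shows "\<bar>convol (bump_deriv (axis k 1)) P z\<bar> \<le>
    sqrt (stress_energy 3 S) * (\<Sum>j\<in>UNIV. sqrt (\<integral>y. (bump_deriv (axis j 1) (y::real^3))\<^sup>2 \<partial>lborel))"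
proof -
  have cb: "continuous_on UNIV (bump_deriv e)" for e :: "real^3" by (intro continuous_intros)
  have vb: "vanishes_beyond 1 (bump_deriv e)" for e :: "real^3"
    using vanishes_beyond_dirderiv[OF vanishes_beyond_bump has_dirderiv_bump] .
  have v3: "vanishes_beyond 3 (\<lambda>y. f (z - y))" if "vanishes_beyond 1 f" for f :: "real^3 \<Rightarrow> real"
    using vanishes_beyond_mono[OF vanishes_beyond_shift[OF that]] z by simp
  have "(\<integral>y. P y * - bump_deriv (axis k 1) (z - y) \<partial>lborel)
      = (\<Sum>j\<in>UNIV. \<integral>y. S k j y * - bump_deriv (axis j 1) (z - y) \<partial>lborel)"
  proof (rule stress_balance_weak[OF S])
    show "has_dirderiv (\<lambda>y. bump (z - y)) (axis j 1) (\<lambda>y. - bump_deriv (axis j 1) (z - y))" for j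
      by (rule has_dirderiv_reflect[OF has_dirderiv_bump])
    show "vanishes_beyond 3 (\<lambda>y. bump (z - y))" using v3 vanishes_beyond_bump by blast
  qed (intro continuous_intros continuous_on_UNIV_compose[OF continuous_on_bump])+
  then have "convol (bump_deriv (axis k 1)) P z = - (\<Sum>j\<in>UNIV. \<integral>y. S k j y * - bump_deriv (axis j 1) (z - y) \<partial>lborel)"
    unfolding convol_def by (simp add: mult.commute[of "P _"])
  also have "\<bar>\<dots>\<bar> \<le> (\<Sum>j\<in>UNIV. \<bar>\<integral>y. S k j y * - bump_deriv (axis j 1) (z - y) \<partial>lborel\<bar>)"
    by (simp only: abs_minus_cancel sum_abs)
  also have "\<dots> \<le> (\<Sum>j\<in>UNIV. sqrt (stress_energy 3 S) * sqrt (\<integral>y. (bump_deriv (axis j 1) (y::real^3))\<^sup>2 \<partial>lborel))"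
  proof (intro sum_mono stress_pairing_le[OF S])
    fix j :: 3
    show "vanishes_beyond 3 (\<lambda>y. - bump_deriv (axis j 1) (z - y))"
      using v3[OF vb] by (simp add: vanishes_beyond_def)
    have "(\<integral>y. (- bump_deriv (axis j 1) (z - y))\<^sup>2 \<partial>lborel) = (\<integral>y. (bump_deriv (axis j 1) (z - y))\<^sup>2 \<partial>lborel)"
      by (simp only: power2_minus)
    also have "\<dots> = (\<integral>y. (bump_deriv (axis j 1) (y::real^3))\<^sup>2 \<partial>lborel)"
      by (rule integral_kernel_shift[of "\<lambda>y. (bump_deriv (axis j 1) y)\<^sup>2"]) (intro continuous_intros)
    finally show "(\<integral>y. (- bump_deriv (axis j 1) (z - y))\<^sup>2 \<partial>lborel) \<le> (\<integral>y. (bump_deriv (axis j 1) (y::real^3))\<^sup>2 \<partial>lborel)"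
      by simp
  qed (intro continuous_intros)
  finally show ?thesis by (simp add: sum_distrib_left)
qed

text \<open>The mean value theorem on the segment from 0 to \<open>x\<close>. Thus the pressure averaged at unit scale is constant on
  the ball of radius 2, up to an error controlled by the stress.\<close>

lemma convol_bump_oscillation:
  "\<exists>C\<ge>0. \<forall>P S x. stress_balance P S \<longrightarrow> norm x \<le> 2 \<longrightarrow>
     \<bar>convol bump P x - convol bump P 0\<bar> \<le> C * sqrt (stress_energy 3 S)"
proof -
  define B where "B = (\<Sum>j\<in>UNIV. sqrt (\<integral>y. (bump_deriv (axis j 1) (y::real^3))\<^sup>2 \<partial>lborel))"
  have B: "B \<ge> 0" unfolding B_def by (intro sum_nonneg) simp
  have "\<bar>convol bump P x - convol bump P 0\<bar> \<le> 6 * B * sqrt (stress_energy 3 S)"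
    if S: "stress_balance P S" and x: "norm x \<le> 2" for P S x
  proof -
    have P: "continuous_on UNIV P" using S by (simp add: stress_balance_def)
    have cb: "continuous_on UNIV (bump_deriv e)" for e :: "real^3" by (intro continuous_intros)
    have vb: "vanishes_beyond 1 (bump_deriv e)" for e :: "real^3"
      using vanishes_beyond_dirderiv[OF vanishes_beyond_bump has_dirderiv_bump] .
    have "has_dirderiv (convol bump P) x (convol (bump_deriv x) P)"
      by (rule has_dirderiv_convol[OF continuous_on_bump cb vanishes_beyond_bump has_dirderiv_bump P])
    then have der: "((\<lambda>t. convol bump P (0 + t *\<^sub>R x)) has_real_derivative convol (bump_deriv x) P (0 + t *\<^sub>R x)) (at t)" for t
      by (rule has_dirderiv_at)
    have "\<exists>t>0. t < 1 \<and> convol bump P (0 + 1 *\<^sub>R x) - convol bump P (0 + 0 *\<^sub>R x) = (1 - 0) * convol (bump_deriv x) P (0 + t *\<^sub>R x)"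
      by (rule MVT2[OF zero_less_one]) (rule der)
    then obtain t where t: "0 < t" "t < 1"
      "convol bump P x - convol bump P 0 = convol (bump_deriv x) P (t *\<^sub>R x)" by auto
    have ntx: "norm (t *\<^sub>R x) \<le> 2"
    proof -
      have "t * norm x \<le> 1 * 2" using t x by (intro mult_mono) auto
      then show ?thesis using t by simp
    qed
    have "bump_deriv x y = (\<Sum>k\<in>UNIV. x $ k * bump_deriv (axis k 1) y)" for y
      by (simp add: inner_vec_def[of y x] inner_axis sum_distrib_left sum_negf mult_ac)
    then have "convol (bump_deriv x) P z = (\<Sum>k\<in>UNIV. x $ k * convol (bump_deriv (axis k 1)) P z)" for z
      unfolding convol_def using convol_integrable[OF cb vb P, of z]
      by (simp only: sum_distrib_right mult.assoc[of "_ $ _"] Bochner_Integration.integral_sum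
          integral_mult_right_zero integrable_mult_right)
    then have "\<bar>convol bump P x - convol bump P 0\<bar> \<le> (\<Sum>k\<in>UNIV. \<bar>x $ k * convol (bump_deriv (axis k 1)) P (t *\<^sub>R x)\<bar>)"
      unfolding t(3) by (simp only: sum_abs)
    also have "\<dots> \<le> (\<Sum>k\<in>(UNIV::3 set). 2 * (sqrt (stress_energy 3 S) * B))"
      unfolding abs_mult
    proof (intro sum_mono mult_mono)
      fix k show "\<bar>x $ k\<bar> \<le> 2" using component_le_norm_cart[of x k] x by simp
      show "\<bar>convol (bump_deriv (axis k 1)) P (t *\<^sub>R x)\<bar> \<le> sqrt (stress_energy 3 S) * B"
        unfolding B_def by (rule convol_bump_deriv_le[OF S ntx])
    qed auto
    finally show ?thesis by (simp add: mult_ac)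
  qed
  then show ?thesis using B by (intro exI[of _ "6 * B"]) simp
qed

text \<open>Let \<open>w\<close> be the convolution of \<open>h\<close> with the difference of the Newtonian kernels at scales \<open>s\<close> and 1. Its Laplacian is
  \<open>105/8\<close> times the difference of the two mollifications of \<open>h\<close> below, while \<open>\<integral> (P - c) \<Delta>w = \<integral> S : \<nabla>\<^sup>2w\<close>, and
  \<open>\<nabla>\<^sup>2w\<close> is controlled by \<open>\<Delta>w\<close> in the square mean. The bound does not depend on \<open>s\<close>.\<close>

lemma pressure_duality:
  assumes S: "stress_balance P S" and h: "continuous_on UNIV h" "vanishes_beyond 2 h"
    and s: "0 < s" "s < 1"
  shows "\<bar>\<integral>x. (P x - c) * (convol bump h x - convol (dilate s bump) h x) \<partial>lborel\<bar>
    \<le> 18 * integral\<^sup>L lborel (bump :: real^3 \<Rightarrow> real) * sqrt (stress_energy 3 S) * sqrt (\<integral>x. (h x)\<^sup>2 \<partial>lborel)"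
proof -
  define N where "N = integral\<^sup>L lborel (bump :: real^3 \<Rightarrow> real)"
  define E where "E = (\<integral>x. (h x)\<^sup>2 \<partial>lborel)"
  have N: "0 < N" using integral_bump_pos by (simp add: N_def)
  have E: "0 \<le> E" by (simp add: E_def)
  have P: "continuous_on UNIV P" using S by (simp add: stress_balance_def)
  define \<Psi> where "\<Psi> = (\<lambda>x::real^3. newton_kernel s x - newton_kernel 1 x)"
  define \<Psi>1 where "\<Psi>1 i = (\<lambda>x::real^3. newton_kernel1 s (axis i 1) x - newton_kernel1 1 (axis i 1) x)" for i
  define \<Psi>2 where "\<Psi>2 i j = (\<lambda>x::real^3. newton_kernel2 s (axis i 1) (axis j 1) x
      - newton_kernel2 1 (axis i 1) (axis j 1) x)" for i j
  define \<Psi>3 where "\<Psi>3 i j k = (\<lambda>x::real^3. newton_kernel3 s (axis i 1) (axis j 1) (axis k 1) x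
      - newton_kernel3 1 (axis i 1) (axis j 1) (axis k 1) x)" for i j k
  have cont: "continuous_on UNIV \<Psi>" "continuous_on UNIV (\<Psi>1 i)" "continuous_on UNIV (\<Psi>2 i j)"
    "continuous_on UNIV (\<Psi>3 i j k)" for i j k
    unfolding \<Psi>_def \<Psi>1_def \<Psi>2_def \<Psi>3_def by (intro continuous_on_diff continuous_on_newton_kernel)+
  have dd: "has_dirderiv \<Psi> (axis i 1) (\<Psi>1 i)" "has_dirderiv (\<Psi>1 i) (axis j 1) (\<Psi>2 i j)"
    "has_dirderiv (\<Psi>2 i j) (axis k 1) (\<Psi>3 i j k)" for i j k
    unfolding \<Psi>_def \<Psi>1_def \<Psi>2_def \<Psi>3_def by (intro has_dirderiv_diff has_dirderiv_newton_kernel)+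
  have v: "vanishes_beyond 1 \<Psi>" unfolding \<Psi>_def by (rule vanishes_beyond_newton_kernel_diff[OF s])
  have v1: "vanishes_beyond 1 (\<Psi>1 i)" for i by (rule vanishes_beyond_dirderiv[OF v dd(1)])
  have v2: "vanishes_beyond 1 (\<Psi>2 i j)" for i j by (rule vanishes_beyond_dirderiv[OF v1 dd(2)])
  have v3: "vanishes_beyond 1 (\<Psi>3 i j k)" for i j k by (rule vanishes_beyond_dirderiv[OF v2 dd(3)])
  define w1 where "w1 i = convol (\<Psi>1 i) h" for i
  define w2 where "w2 i j = convol (\<Psi>2 i j) h" for i j
  define w3 where "w3 i j k = convol (\<Psi>3 i j k) h" for i j k
  have cw: "continuous_on UNIV (w1 i)" "continuous_on UNIV (w2 i j)" "continuous_on UNIV (w3 i j k)" for i j k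
    unfolding w1_def w2_def w3_def using cont v1 v2 v3 h continuous_on_convol by blast+
  have ddw: "has_dirderiv (w1 i) (axis j 1) (w2 i j)" "has_dirderiv (w2 i j) (axis k 1) (w3 i j k)" for i j k
    unfolding w1_def w2_def w3_def using cont v1 v2 dd h by (blast intro: has_dirderiv_convol)+
  have vw1: "vanishes_beyond 3 (w1 i)" for i
    unfolding w1_def using vanishes_beyond_convol[OF v1 h(2)] by simp
  have vw2: "vanishes_beyond 3 (w2 i j)" for i j by (rule vanishes_beyond_dirderiv[OF vw1 ddw(1)])
  let ?b = "convol bump h" and ?d = "convol (dilate s bump) h"
  note dil = dilate_basic[OF continuous_on_bump vanishes_beyond_bump s(1)]
  have cbd: "continuous_on UNIV ?b" "continuous_on UNIV ?d"
    using continuous_on_convol continuous_on_bump vanishes_beyond_bump dil h by blast+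
  have vbd: "vanishes_beyond 3 ?b" "vanishes_beyond 3 ?d"
    using vanishes_beyond_mono[OF vanishes_beyond_convol[OF vanishes_beyond_bump h(2)], of 3]
      vanishes_beyond_mono[OF vanishes_beyond_convol[OF dil(2) h(2)], of 3] s by auto
  have lap: "(\<Sum>i\<in>UNIV. w2 i i x) = (105/8) * (?b x - ?d x)" for x
  proof -
    have "(\<Sum>i\<in>UNIV. w2 i i x) = (\<integral>y. (\<Sum>i\<in>UNIV. \<Psi>2 i i (x - y) * h y) \<partial>lborel)"
      unfolding w2_def convol_def using convol_integrable[OF cont(3) v2 h(1)]
      by (subst Bochner_Integration.integral_sum) auto
    also have "\<dots> = (\<integral>y. (105/8) * (bump (x - y) * h y - dilate s bump (x - y) * h y) \<partial>lborel)"
    proof (rule Bochner_Integration.integral_cong[OF refl])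
      fix y
      have "(\<Sum>i\<in>UNIV. \<Psi>2 i i (x - y)) = (105/8) * (dilate 1 bump (x - y) - dilate s bump (x - y))"
        unfolding \<Psi>2_def sum_subtractf using newton_kernel_laplace[OF s(1), of "x - y"]
          newton_kernel_laplace[of 1 "x - y"] by simp
      note Q = this
      show "(\<Sum>i\<in>UNIV. \<Psi>2 i i (x - y) * h y) = (105/8) * (bump (x - y) * h y - dilate s bump (x - y) * h y)"
        unfolding sum_distrib_right[symmetric] Q by (simp add: dilate_def[of 1] field_simps)
    qed
    also have "\<dots> = (105/8) * (?b x - ?d x)"
      unfolding convol_def
      using convol_integrable[OF continuous_on_bump vanishes_beyond_bump h(1), of x]
        convol_integrable[OF dil(1,2) h(1), of x] by simp
    finally show ?thesis .
  qed
  \<comment> \<open>The constant drops out because \<open>w2 k k\<close> is a derivative of a compactly supported function.\<close>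
  have Pw: "(\<integral>x. (P x - c) * w2 k k x \<partial>lborel) = (\<Sum>j\<in>UNIV. \<integral>x. S k j x * w2 k j x \<partial>lborel)" for k
  proof -
    have i: "integrable lborel (\<lambda>x. P x * w2 k k x)" "integrable lborel (w2 k k)"
      using P cw vw2 by (auto intro!: integrable_compactly_supported[of _ 3] vanishes_beyond_mult2 continuous_intros)
    have "(\<integral>x. w2 k k x \<partial>lborel) = 0" by (rule integral_dirderiv_eq_0[OF cw(1,2) vw1 ddw(1)])
    then have "(\<integral>x. (P x - c) * w2 k k x \<partial>lborel) = (\<integral>x. P x * w2 k k x \<partial>lborel)"
      using i by (simp add: left_diff_distrib)
    also have "\<dots> = (\<Sum>j\<in>UNIV. \<integral>x. S k j x * w2 k j x \<partial>lborel)"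
      by (rule stress_balance_weak[OF S cw(1) cw(2) ddw(1) vw1])
    finally show ?thesis .
  qed
  define H where "H = (\<integral>x. (\<Sum>i\<in>UNIV. w2 i i x)\<^sup>2 \<partial>lborel)"
  have H: "(\<integral>x. (w2 k j x)\<^sup>2 \<partial>lborel) \<le> H" for k j
  proof -
    have sym: "w3 i j j x = w3 j j i x" for i j x
      by (simp add: w3_def \<Psi>3_def newton_kernel3_def inner_commute algebra_simps)
    have "(\<integral>x. (w2 k j x)\<^sup>2 \<partial>lborel) \<le> (\<Sum>i\<in>UNIV. \<Sum>j\<in>UNIV. \<integral>x. (w2 i j x)\<^sup>2 \<partial>lborel)"
      by (rule order_trans[OF member_le_sum[of j UNIV "\<lambda>j. \<integral>x. (w2 k j x)\<^sup>2 \<partial>lborel"]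
          member_le_sum[of k UNIV "\<lambda>k. \<Sum>j\<in>UNIV. \<integral>x. (w2 k j x)\<^sup>2 \<partial>lborel"]])
        (auto intro: sum_nonneg)
    also have "\<dots> = H" unfolding H_def
      by (rule integral_hessian_squared[OF cw vw1 ddw sym])
    finally show ?thesis .
  qed
  have H_le: "H \<le> ((105/8) * (2 * N))\<^sup>2 * E"
  proof -
    have ib: "integrable lborel (\<lambda>x. (?b x)\<^sup>2)" "integrable lborel (\<lambda>x. (?d x)\<^sup>2)"
      "integrable lborel (\<lambda>x. (?b x - ?d x)\<^sup>2)"
      using cbd vbd by (auto intro!: integrable_compactly_supported[of _ 3] continuous_intros simp: vanishes_beyond_def)
    have "(\<integral>x. (?b x - ?d x)\<^sup>2 \<partial>lborel) \<le> (\<integral>x. 2 * (?b x)\<^sup>2 + 2 * (?d x)\<^sup>2 \<partial>lborel)"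
    proof (rule integral_mono)
      fix x show "(?b x - ?d x)\<^sup>2 \<le> 2 * (?b x)\<^sup>2 + 2 * (?d x)\<^sup>2"
        using zero_le_power2[of "?b x + ?d x"] by (simp add: power2_eq_square algebra_simps)
    qed (use ib in auto)
    also have "\<dots> = 2 * (\<integral>x. (?b x)\<^sup>2 \<partial>lborel) + 2 * (\<integral>x. (?d x)\<^sup>2 \<partial>lborel)" using ib by simp
    also have "(\<integral>x. (?b x)\<^sup>2 \<partial>lborel) \<le> N\<^sup>2 * E"
      unfolding N_def E_def
      by (rule convol_L2_le[OF continuous_on_bump vanishes_beyond_bump bump_minus bump_nonneg h])
    also have "(\<integral>x. (?d x)\<^sup>2 \<partial>lborel) \<le> N\<^sup>2 * E"
      unfolding N_def E_def dil(3)[symmetric]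
      by (rule convol_L2_le[OF dil(1,2) _ _ h]) (use s in \<open>auto simp: dilate_def bump_minus bump_nonneg\<close>)
    finally have "(\<integral>x. (?b x - ?d x)\<^sup>2 \<partial>lborel) \<le> (2 * N)\<^sup>2 * E"
      by (simp add: power_mult_distrib mult_ac)
    then show ?thesis
      unfolding H_def lap power_mult_distrib[of "105/8"] integral_mult_right_zero mult.assoc[of _ _ E]
      by (rule mult_left_mono) simp
  qed
  have "(105/8) * \<bar>\<integral>x. (P x - c) * (?b x - ?d x) \<partial>lborel\<bar>
      = \<bar>\<integral>x. (\<Sum>k\<in>UNIV. (P x - c) * w2 k k x) \<partial>lborel\<bar>"
    unfolding sum_distrib_left[symmetric] lap mult.left_commute[of _ "105/8"] integral_mult_right_zero
    by (simp add: abs_mult)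
  also have "(\<integral>x. (\<Sum>k\<in>UNIV. (P x - c) * w2 k k x) \<partial>lborel) = (\<Sum>k\<in>UNIV. \<Sum>j\<in>UNIV. \<integral>x. S k j x * w2 k j x \<partial>lborel)"
    unfolding Pw[symmetric] using P cw vw2
    by (intro Bochner_Integration.integral_sum integrable_compactly_supported[of _ 3] vanishes_beyond_mult2 continuous_intros)
  also have "\<bar>\<dots>\<bar> \<le> (\<Sum>k\<in>UNIV. \<Sum>j\<in>UNIV. \<bar>\<integral>x. S k j x * w2 k j x \<partial>lborel\<bar>)"
    by (intro order_trans[OF sum_abs] sum_mono order_refl)
  also have "\<dots> \<le> (\<Sum>k\<in>(UNIV::3 set). \<Sum>j\<in>(UNIV::3 set). sqrt (stress_energy 3 S) * sqrt H)"
    by (intro sum_mono stress_pairing_le[OF S cw(2) vw2 H])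
  also have "\<dots> = 9 * sqrt (stress_energy 3 S) * sqrt H" by simp
  also have "\<dots> \<le> 9 * sqrt (stress_energy 3 S) * ((105/8) * (2 * N) * sqrt E)"
  proof -
    have "sqrt H \<le> sqrt (((105/8) * (2 * N))\<^sup>2 * E)" by (rule real_sqrt_le_mono[OF H_le])
    also have "\<dots> = (105/8) * (2 * N) * sqrt E" using N by (simp add: real_sqrt_mult)
    finally show ?thesis using stress_energy_nonneg by (intro mult_left_mono) auto
  qed
  finally show ?thesis unfolding N_def E_def by simp
qed

text \<open>Apply \<open>pressure_duality\<close> to \<open>h = \<zeta> (P - c)\<close> with a cutoff \<open>\<zeta>\<close> and let \<open>s\<close> tend to 0: the mollification at scale \<open>s\<close>
  reproduces \<open>\<integral> \<zeta> (P - c)\<^sup>2\<close>, which dominates \<open>\<integral> h\<^sup>2\<close>. For the mollification at scale 1 the constant \<open>c\<close> is chosen as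
  the average of \<open>P\<close> near the origin, so that \<open>convol_bump_oscillation\<close> applies; as an average of a nonnegative function
  it is nonnegative.\<close>

lemma pressure_estimate_unit:
  "\<exists>C\<ge>0. \<forall>P S. stress_balance P S \<longrightarrow> (\<forall>x. 0 \<le> P x) \<longrightarrow>
     (\<exists>c\<ge>0. (LINT x:cball 0 1|lborel. (P x - c)\<^sup>2) \<le> C * stress_energy 3 S)"
proof -
  obtain C1 where C1: "C1 \<ge> 0" "\<And>P S x. stress_balance P S \<Longrightarrow> norm x \<le> 2 \<Longrightarrow>
     \<bar>convol bump P x - convol bump P 0\<bar> \<le> C1 * sqrt (stress_energy 3 S)"
    using convol_bump_oscillation by blast
  define N where "N = integral\<^sup>L lborel (bump :: real^3 \<Rightarrow> real)"
  have N: "0 < N" using integral_bump_pos by (simp add: N_def)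
  define V where "V = sqrt (LINT x:cball (0::real^3) 2|lborel. (1::real)\<^sup>2)"
  have V: "V \<ge> 0" unfolding V_def set_lebesgue_integral_def by (intro real_sqrt_ge_zero integral_nonneg_AE always_eventually) auto
  define K where "K = 18 * N + C1 * V"
  have K: "K \<ge> 0" using N C1 V by (simp add: K_def)
  have "\<exists>c\<ge>0. (LINT x:cball 0 1|lborel. (P x - c)\<^sup>2) \<le> 256 / 81 * (K / N)\<^sup>2 * stress_energy 3 S"
    if S: "stress_balance P S" and P0: "\<And>x. 0 \<le> P x" for P S
  proof -
    have P: "continuous_on UNIV P" using S by (simp add: stress_balance_def)
    define c where "c = convol bump P 0 / N"
    have c: "c \<ge> 0" unfolding c_def convol_def using N P0
      by (intro divide_nonneg_pos Bochner_Integration.integral_nonneg mult_nonneg_nonneg bump_nonneg) auto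
    define \<zeta> where "\<zeta> x = bump ((1/2) *\<^sub>R x)" for x :: "real^3"
    define h where "h x = \<zeta> x * (P x - c)" for x
    have \<zeta>: "continuous_on UNIV \<zeta>" "\<And>x. 0 \<le> \<zeta> x" "\<And>x. \<zeta> x \<le> 1"
      unfolding \<zeta>_def[abs_def] using bump_nonneg bump_le_1
      by (auto intro!: continuous_intros continuous_on_UNIV_compose[OF continuous_on_bump])
    have v\<zeta>: "vanishes_beyond 2 \<zeta>"
      unfolding \<zeta>_def[abs_def] by (rule vanishes_beyond_scale[OF vanishes_beyond_bump]) simp
    have h: "continuous_on UNIV h" "vanishes_beyond 2 h"
      unfolding h_def[abs_def] using \<zeta> v\<zeta> P by (auto intro!: continuous_intros vanishes_beyond_mult1)
    define G where "G = sqrt (stress_energy 3 S)"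
    define E where "E = (\<integral>x. (h x)\<^sup>2 \<partial>lborel)"
    have G: "G \<ge> 0" and E: "E \<ge> 0" using stress_energy_nonneg by (auto simp: G_def E_def)
    have Pc: "continuous_on UNIV (\<lambda>x. P x - c)" using P by (intro continuous_intros)
    define T where "T = (\<integral>x. (P x - c) * h x \<partial>lborel)"
    have coarse: "\<bar>\<integral>x. (P x - c) * convol bump h x \<partial>lborel\<bar> \<le> C1 * V * G * sqrt E"
    proof -
      have "convol bump (\<lambda>x. P x - c) x = convol bump P x - convol bump P 0" for x
        using convol_integrable[OF continuous_on_bump vanishes_beyond_bump P, of x]
          convol_integrable[OF continuous_on_bump vanishes_beyond_bump continuous_on_const[of _ c], of x]
          integral_kernel_shift[OF continuous_on_bump, of x] N
        by (simp add: convol_def right_diff_distrib c_def N_def)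
      then have eq: "(\<integral>x. (P x - c) * convol bump h x \<partial>lborel) = (\<integral>x. h x * (convol bump P x - convol bump P 0) \<partial>lborel)"
        using integral_convol_swap[OF continuous_on_bump vanishes_beyond_bump bump_minus h Pc] by simp
      have cbP: "continuous_on UNIV (convol bump P)"
        by (rule continuous_on_convol[OF continuous_on_bump vanishes_beyond_bump P])
      have "\<bar>\<integral>x. h x * (convol bump P x - convol bump P 0) \<partial>lborel\<bar>
          \<le> (\<integral>x. \<bar>h x * (convol bump P x - convol bump P 0)\<bar> \<partial>lborel)"
        by (rule integral_abs_bound)
      also have "\<dots> \<le> (\<integral>x. (C1 * G) * \<bar>h x\<bar> \<partial>lborel)"
      proof (rule integral_mono)
        show "integrable lborel (\<lambda>x. \<bar>h x * (convol bump P x - convol bump P 0)\<bar>)"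
          "integrable lborel (\<lambda>x. (C1 * G) * \<bar>h x\<bar>)"
          using h cbP by (auto intro!: integrable_compactly_supported[of _ 2] vanishes_beyond_mult1 continuous_intros
              integrable_abs)
        fix x
        show "\<bar>h x * (convol bump P x - convol bump P 0)\<bar> \<le> (C1 * G) * \<bar>h x\<bar>"
        proof (cases "2 < norm x")
          case True then show ?thesis using h by (simp add: vanishes_beyond_def)
        next
          case False
          then have "\<bar>h x\<bar> * \<bar>convol bump P x - convol bump P 0\<bar> \<le> \<bar>h x\<bar> * (C1 * G)"
            unfolding G_def using C1(2)[OF S] by (intro mult_left_mono) auto
          then show ?thesis by (simp add: abs_mult mult.commute)
        qed
      qed
      also have "\<dots> = (C1 * G) * (\<integral>x. 1 * \<bar>h x\<bar> \<partial>lborel)" by simp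
      also have "\<dots> \<le> (C1 * G) * (V * sqrt E)"
      proof (rule mult_left_mono)
        show "(\<integral>x. 1 * \<bar>h x\<bar> \<partial>lborel) \<le> V * sqrt E"
          using integral_mult_le_local[OF continuous_on_const[of _ 1], of "\<lambda>x. \<bar>h x\<bar>" 2] h
          by (auto simp: V_def E_def vanishes_beyond_def intro: continuous_intros)
      qed (use C1 G in auto)
      finally show ?thesis unfolding eq by (simp only: mult_ac)
    qed
    have "N * T \<le> K * G * sqrt E + \<epsilon>" if eps: "\<epsilon> > 0" for \<epsilon>
    proof -
      obtain s where s: "0 < s" "s < 1" and
        le: "\<bar>(\<integral>x. (P x - c) * convol (dilate s bump) h x \<partial>lborel) - N * T\<bar> \<le> \<epsilon>"
        using convol_approximates[OF continuous_on_bump vanishes_beyond_bump bump_nonneg h Pc eps]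
        unfolding N_def T_def by blast
      have cd: "continuous_on UNIV (convol (dilate s bump) h)" "continuous_on UNIV (convol bump h)"
        "vanishes_beyond (s + 2) (convol (dilate s bump) h)" "vanishes_beyond (1 + 2) (convol bump h)"
        using dilate_basic[OF continuous_on_bump vanishes_beyond_bump s(1)] h
          continuous_on_bump vanishes_beyond_bump continuous_on_convol vanishes_beyond_convol by blast+
      have "integrable lborel (\<lambda>x. (P x - c) * convol (dilate s bump) h x)"
        "integrable lborel (\<lambda>x. (P x - c) * convol bump h x)"
        using Pc cd by (auto intro!: integrable_compactly_supported vanishes_beyond_mult2 continuous_on_mult)
      then have "(\<integral>x. (P x - c) * (convol bump h x - convol (dilate s bump) h x) \<partial>lborel)
        = (\<integral>x. (P x - c) * convol bump h x \<partial>lborel) - (\<integral>x. (P x - c) * convol (dilate s bump) h x \<partial>lborel)"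
        by (simp add: right_diff_distrib)
      moreover have "\<bar>\<integral>x. (P x - c) * (convol bump h x - convol (dilate s bump) h x) \<partial>lborel\<bar> \<le> 18 * N * G * sqrt E"
        unfolding N_def G_def E_def by (rule pressure_duality[OF S h s])
      moreover have "K * G * sqrt E = 18 * N * G * sqrt E + C1 * V * G * sqrt E"
        by (simp add: K_def algebra_simps)
      ultimately show ?thesis using coarse le by linarith
    qed
    \<comment> \<open>The bound no longer involves the scale \<open>s\<close>, so the tolerance can be sent to 0.\<close>
    then have NT: "N * T \<le> K * G * sqrt E" by (rule field_le_epsilon)
    have "E \<le> T"
      unfolding E_def T_def
    proof (rule integral_mono)
      show "integrable lborel (\<lambda>x. (h x)\<^sup>2)" "integrable lborel (\<lambda>x. (P x - c) * h x)"
        using h Pc by (auto intro!: integrable_compactly_supported[of _ 2] vanishes_beyond_mult2 continuous_intros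
            simp: power2_eq_square)
      fix x
      have "\<zeta> x * (\<zeta> x * (P x - c)\<^sup>2) \<le> 1 * (\<zeta> x * (P x - c)\<^sup>2)"
        using \<zeta>(2,3)[of x] by (intro mult_right_mono) auto
      then show "(h x)\<^sup>2 \<le> (P x - c) * h x" by (simp add: h_def power2_eq_square mult_ac)
    qed
    then have "N * E \<le> K * G * sqrt E" using NT N by (meson mult_left_mono order_trans less_imp_le)
    then have "(N * sqrt E) * sqrt E \<le> (K * G) * sqrt E" using E by (simp add: mult.assoc)
    then have "N * sqrt E \<le> K * G"
    proof (cases "E = 0")
      case False
      with E have "sqrt E > 0" by simp
      with \<open>(N * sqrt E) * sqrt E \<le> _\<close> show ?thesis by (rule mult_right_le_imp_le)
    qed (use K G in simp)
    then have "sqrt E \<le> K / N * G" using N by (simp add: field_simps)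
    then have "(sqrt E)\<^sup>2 \<le> (K / N * G)\<^sup>2" using E by (intro power_mono) auto
    then have E_le: "E \<le> (K / N)\<^sup>2 * stress_energy 3 S"
      using E stress_energy_nonneg by (simp add: power_mult_distrib power_divide G_def)
    have "(LINT x:cball 0 1|lborel. (P x - c)\<^sup>2) \<le> (\<integral>x. 256 / 81 * (h x)\<^sup>2 \<partial>lborel)"
      unfolding set_lebesgue_integral_def real_scaleR_def
    proof (rule integral_mono)
      show "integrable lborel (\<lambda>x. indicat_real (cball 0 1) x * (P x - c)\<^sup>2)"
        using P by (intro integral_set_cball continuous_intros)
      show "integrable lborel (\<lambda>x. 256 / 81 * (h x)\<^sup>2)"
        using h by (intro integrable_compactly_supported[of _ 2]) (auto intro!: continuous_intros simp: vanishes_beyond_def)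
      fix x :: "real^3"
      show "indicat_real (cball 0 1) x * (P x - c)\<^sup>2 \<le> 256 / 81 * (h x)\<^sup>2"
      proof (cases "norm x \<le> 1")
        case True
        then have "9/16 \<le> \<zeta> x" unfolding \<zeta>_def by (intro bump_half_ge) simp
        then have "(9/16)\<^sup>2 \<le> (\<zeta> x)\<^sup>2" by (intro power_mono) auto
        then have "81 / 256 * (P x - c)\<^sup>2 \<le> (h x)\<^sup>2"
          unfolding h_def power_mult_distrib by (intro mult_right_mono) (auto simp: power2_eq_square)
        then show ?thesis using True by simp
      qed simp
    qed
    also have "\<dots> = 256 / 81 * E" by (simp add: E_def)
    also have "\<dots> \<le> 256 / 81 * ((K / N)\<^sup>2 * stress_energy 3 S)" using E_le by (intro mult_left_mono) auto
    finally show ?thesis using c by (intro exI[of _ c]) (simp add: mult.assoc)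
  qed
  then show ?thesis by (intro exI[of _ "256 / 81 * (K / N)\<^sup>2"]) auto
qed

lemma set_integral_cball_scale:
  fixes f :: "'a::euclidean_space \<Rightarrow> real"
  assumes f: "continuous_on UNIV f" and R: "0 < R"
  shows "(LINT x:cball 0 (R * r)|lborel. f x) = R ^ DIM('a) * (LINT x:cball 0 r|lborel. f (R *\<^sub>R x))"
proof -
  have "(\<lambda>x. indicat_real (cball 0 (R * r)) x * f x) \<in> borel_measurable borel"
    by (intro borel_measurable_times borel_measurable_indicator borel_measurable_continuous_onI[OF f]) simp
  moreover have "indicat_real (cball 0 (R * r)) (R *\<^sub>R x) = indicat_real (cball 0 r) x" for x :: 'a
    using R by (simp add: indicator_def)
  ultimately show ?thesis
    unfolding set_lebesgue_integral_def using R by (simp add: lborel_integral_scale[of _ R])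
qed

text \<open>The equation \<open>\<nabla>P = div S\<close> is invariant under dilations, and so is the ratio of the two square integrals.\<close>

lemma pressure_estimate:
  "\<exists>C\<ge>0. \<forall>P S R. stress_balance P S \<longrightarrow> (\<forall>x. 0 \<le> P x) \<longrightarrow> 0 < R \<longrightarrow>
     (\<exists>c\<ge>0. (LINT x:cball 0 R|lborel. (P x - c)\<^sup>2) \<le> C * stress_energy (3 * R) S)"
proof -
  obtain C where C: "C \<ge> 0" "\<And>P S. stress_balance P S \<Longrightarrow> (\<And>x. 0 \<le> P x) \<Longrightarrow>
     (\<exists>c\<ge>0. (LINT x:cball 0 1|lborel. (P x - c)\<^sup>2) \<le> C * stress_energy 3 S)"
    using pressure_estimate_unit by blast
  have "\<exists>c\<ge>0. (LINT x:cball 0 R|lborel. (P x - c)\<^sup>2) \<le> C * stress_energy (3 * R) S"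
    if S: "stress_balance P S" and P0: "\<And>x. 0 \<le> P x" and R: "0 < R" for P S and R :: real
  proof -
    have P: "continuous_on UNIV P" "\<And>k j. continuous_on UNIV (S k j)" using S by (auto simp: stress_balance_def)
    obtain c where c: "c \<ge> 0" "(LINT x:cball 0 1|lborel. (P (R *\<^sub>R x) - c)\<^sup>2)
        \<le> C * stress_energy 3 (\<lambda>k j x. S k j (R *\<^sub>R x))"
      using C(2)[OF stress_balance_scale[OF S]] P0 by blast
    have "(LINT x:cball 0 (R * 1)|lborel. (P x - c)\<^sup>2) = R ^ DIM(real^3) * (LINT x:cball 0 1|lborel. (P (R *\<^sub>R x) - c)\<^sup>2)"
      using P R by (intro set_integral_cball_scale continuous_intros)
    also have "\<dots> \<le> R ^ DIM(real^3) * (C * stress_energy 3 (\<lambda>k j x. S k j (R *\<^sub>R x)))"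
      using c R by (intro mult_left_mono) auto
    also have "\<dots> = C * stress_energy (R * 3) S"
      unfolding stress_energy_def using P R
      by (subst set_integral_cball_scale) (auto intro!: continuous_intros)
    finally show ?thesis using c by (auto simp: mult.commute)
  qed
  then show ?thesis using C(1) by blast
qed

section \<open>Weak Lebesgue spaces and square-integrable gradients\<close>

text \<open>The usual condition that \<open>t\<close> times the distribution function to the power \<open>1/p\<close> be bounded, solved for the distribution
  function.\<close>

definition weak_Lp :: "real \<Rightarrow> ('a::euclidean_space \<Rightarrow> 'b::euclidean_space) \<Rightarrow> bool" where
  "weak_Lp p f \<longleftrightarrow> (\<exists>A\<ge>0. \<forall>t>0. emeasure lborel {x. t < norm (f x)} \<le> ennreal (A * t powr (- p)))"

lemma distribution_fun_UNIV:
  assumes "continuous_on UNIV f"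
  shows "distribution_fun UNIV f t = emeasure lborel {x. t < norm (f x)}"
proof -
  have "open {x. t < norm (f x)}"
    using assms by (intro open_Collect_less continuous_intros)
  then show ?thesis by (simp add: distribution_fun_def)
qed

text \<open>The common form of the bounds that the Lorentz norms give for finite and for infinite second exponent. Such a
  bound also forces the distribution function to be finite.\<close>

lemma weak_LpI_powr:
  fixes f :: "'a::euclidean_space \<Rightarrow> 'b::euclidean_space"
  assumes "0 < s" "0 < \<kappa>" "0 \<le> L"
    and le: "\<And>t. 0 < t \<Longrightarrow> ennreal_powr (emeasure lborel {x. t < norm (f x)}) s * ennreal (\<kappa> * t powr (s * p)) \<le> ennreal L"
  shows "weak_Lp p f"
  unfolding weak_Lp_def
proof (intro exI[of _ "(L / \<kappa>) powr (1 / s)"] conjI allI impI)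
  fix t :: real assume t: "0 < t"
  define D where "D = emeasure lborel {x. t < norm (f x)}"
  have pos: "0 < \<kappa> * t powr (s * p)" using t assms(2) by simp
  have ne: "D \<noteq> \<infinity>"
  proof
    assume "D = \<infinity>"
    then have "ennreal_powr D s * ennreal (\<kappa> * t powr (s * p)) = \<infinity>"
      using t assms(2) by (simp add: ennreal_powr_def ennreal_top_mult)
    then show False using le[OF t] unfolding D_def by (simp add: top_unique)
  qed
  then obtain d where d: "0 \<le> d" "D = ennreal d" by (cases D) auto
  have "ennreal (d powr s * (\<kappa> * t powr (s * p))) \<le> ennreal L"
    using le[OF t] ne d pos unfolding D_def[symmetric] by (simp add: ennreal_powr_def ennreal_mult)
  then have "d powr s * (\<kappa> * t powr (s * p)) \<le> L" using assms(3) by simp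
  then have "d powr s \<le> L / \<kappa> * t powr (- (s * p))"
    using pos t assms(2) by (simp add: powr_minus field_simps)
  then have "(d powr s) powr (1 / s) \<le> (L / \<kappa> * t powr (- (s * p))) powr (1 / s)"
    using assms(1) by (intro powr_mono2) auto
  also have "\<dots> = (L / \<kappa>) powr (1 / s) * t powr (- p)"
    using assms t by (subst powr_mult) (auto simp: powr_powr)
  also have "(d powr s) powr (1 / s) = d" using assms(1) d by (simp add: powr_powr)
  finally show "emeasure lborel {x. t < norm (f x)} \<le> ennreal ((L / \<kappa>) powr (1 / s) * t powr (- p))"
    using d unfolding D_def[symmetric] by (simp add: ennreal_leI)
qed simp

lemma ennreal_powr_mono:
  assumes "x \<le> y" "0 \<le> s"
  shows "ennreal_powr x s \<le> ennreal_powr y s"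
proof (cases "y = \<infinity>")
  case False
  then have "x \<noteq> \<infinity>" using assms by (auto simp: top_unique)
  then show ?thesis using assms False
    by (auto simp: ennreal_powr_def less_top intro!: ennreal_leI powr_mono2 enn2real_mono)
qed (simp add: ennreal_powr_def)

text \<open>For finite \<open>q\<close> the distribution function is decreasing, so the part of the integral over \<open>[t/2, t]\<close> already
  bounds its value at \<open>t\<close>.\<close>

lemma in_lorentz_imp_weak_Lp:
  assumes f: "continuous_on UNIV f" and "in_lorentz p q UNIV f" and p: "0 < p" and q: "1 \<le> q"
  shows "weak_Lp p f"
proof (cases "q = \<infinity>")
  case True
  have fin: "(SUP t\<in>{0<..}. ennreal t * ennreal_powr (distribution_fun UNIV f t) (1 / p)) < \<infinity>"
    using assms(2) True by (simp add: in_lorentz_def lorentz_norm_def)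
  then obtain L where L: "0 \<le> L"
    "(SUP t\<in>{0<..}. ennreal t * ennreal_powr (distribution_fun UNIV f t) (1 / p)) = ennreal L"
    by (cases "(SUP t\<in>{0<..}. ennreal t * ennreal_powr (distribution_fun UNIV f t) (1 / p))") auto
  show ?thesis
  proof (rule weak_LpI_powr[of "1 / p" 1 L])
    fix t :: real assume t: "0 < t"
    have "ennreal t * ennreal_powr (distribution_fun UNIV f t) (1 / p) \<le> ennreal L"
      unfolding L(2)[symmetric] using t by (intro SUP_upper) auto
    then show "ennreal_powr (emeasure lborel {x. t < norm (f x)}) (1 / p) * ennreal (1 * t powr (1 / p * p)) \<le> ennreal L"
      using t p by (simp add: distribution_fun_UNIV[OF f] mult.commute)
  qed (use p L in auto)
next
  case False
  define r where "r = enn2real q"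
  have qr: "q = ennreal r" using False by (simp add: r_def less_top)
  then have r: "1 \<le> r" using q by (simp add: ennreal_1[symmetric] ennreal_le_iff2 del: ennreal_1)
  let ?F = "\<lambda>t. ennreal (t powr (r - 1)) * ennreal_powr (distribution_fun UNIV f t) (r / p)"
  define I where "I = (\<integral>\<^sup>+t\<in>{0<..}. ?F t \<partial>lborel)"
  have "ennreal_powr I (1 / r) < \<infinity>"
    using assms(2) False by (simp add: in_lorentz_def lorentz_norm_def Let_def r_def I_def)
  then have "I \<noteq> \<infinity>" by (auto simp: ennreal_powr_def)
  then obtain L where L: "0 \<le> L" "I = ennreal L" by (cases I) auto
  show ?thesis
  proof (rule weak_LpI_powr[of "r / p" "(1/2) powr r" L])
    fix t :: real assume t: "0 < t"
    let ?c = "ennreal ((t / 2) powr (r - 1)) * ennreal_powr (distribution_fun UNIV f t) (r / p)"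
    have "?c * ennreal (t / 2) = (\<integral>\<^sup>+\<tau>. ?c * indicator {t/2..t} \<tau> \<partial>lborel)"
      using t by (simp add: nn_integral_cmult_indicator)
    also have "\<dots> \<le> I"
      unfolding I_def
    proof (rule nn_integral_mono)
      fix \<tau> :: real
      show "?c * indicator {t/2..t} \<tau> \<le> ?F \<tau> * indicator {0<..} \<tau>"
      proof (cases "\<tau> \<in> {t/2..t}")
        case True
        then have "distribution_fun UNIV f t \<le> distribution_fun UNIV f \<tau>"
          unfolding distribution_fun_UNIV[OF f]
          using f by (intro emeasure_mono) (auto intro!: borel_open open_Collect_less continuous_intros)
        then have "?c \<le> ?F \<tau>"
          using True t r p by (intro mult_mono ennreal_powr_mono ennreal_leI powr_mono2) auto
        then show ?thesis using True t by (simp add: indicator_def)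
      qed simp
    qed
    finally have "?c * ennreal (t / 2) \<le> ennreal L" using L by simp
    moreover have "?c * ennreal (t / 2) = ennreal_powr (emeasure lborel {x. t < norm (f x)}) (r / p)
        * ennreal ((1/2) powr r * t powr (r / p * p))"
    proof -
      have "(t / 2) powr (r - 1) * (t / 2) = (t / 2) powr ((r - 1) + 1)"
        using t by (subst powr_add) simp
      also have "\<dots> = (1/2) powr r * t powr (r / p * p)"
        using t p by (simp add: powr_divide powr_mult[symmetric])
      finally have "ennreal ((t / 2) powr (r - 1)) * ennreal (t / 2) = ennreal ((1/2) powr r * t powr (r / p * p))"
        using t by (simp add: ennreal_mult[symmetric])
      note Q = this
      have "?c * ennreal (t / 2) = ennreal_powr (emeasure lborel {x. t < norm (f x)}) (r / p)
          * (ennreal ((t / 2) powr (r - 1)) * ennreal (t / 2))"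
        by (simp only: distribution_fun_UNIV[OF f] mult_ac)
      then show ?thesis unfolding Q .
    qed
    ultimately show "ennreal_powr (emeasure lborel {x. t < norm (f x)}) (r / p)
        * ennreal ((1/2) powr r * t powr (r / p * p)) \<le> ennreal L" by simp
  qed (use p r L in auto)
qed

lemma nn_integral_shift:
  fixes f :: "'a::euclidean_space \<Rightarrow> ennreal"
  assumes "f \<in> borel_measurable borel"
  shows "(\<integral>\<^sup>+x. f (c + x) \<partial>lborel) = integral\<^sup>N lborel f"
  by (subst (2) lborel_distr_plus[of c, symmetric], subst nn_integral_distr) (use assms in auto)

text \<open>The fundamental theorem of calculus on the segment from \<open>x\<close> to \<open>x + z\<close>; \<open>k\<close> bounds the operator norm of the
  derivative.\<close>

lemma increment_le_integral:
  fixes u :: "'a::euclidean_space \<Rightarrow> 'b::euclidean_space"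
  assumes du: "\<And>x. (u has_derivative u' x) (at x)" and cu': "\<And>z. continuous_on UNIV (\<lambda>x. u' x z)"
    and k: "continuous_on UNIV k" "\<And>x z. norm (u' x z) \<le> k x * norm z"
  shows "ennreal ((norm (u (x + z) - u x))\<^sup>2) \<le>
     ennreal ((norm z)\<^sup>2) * (\<integral>\<^sup>+t. ennreal ((k (x + t *\<^sub>R z))\<^sup>2) * indicator {0..1} t \<partial>lborel)"
proof -
  let ?I = "indicator {0..1} :: real \<Rightarrow> real"
  have kc: "continuous_on A (\<lambda>t. k (x + t *\<^sub>R z))" for A
    by (rule continuous_on_compose2[OF k(1)]) (auto intro!: continuous_intros)
  have uc: "continuous_on A (\<lambda>t. u' (x + t *\<^sub>R z) z)" for A
    by (rule continuous_on_compose2[OF cu']) (auto intro!: continuous_intros)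
  have km: "(\<lambda>t. k (x + t *\<^sub>R z)) \<in> borel_measurable borel"
    by (rule borel_measurable_continuous_onI[OF kc])
  have der: "((\<lambda>t. u (x + t *\<^sub>R z)) has_vector_derivative u' (x + t *\<^sub>R z) z) (at t within A)" for t A
  proof -
    have 1: "((\<lambda>t. x + t *\<^sub>R z) has_derivative (\<lambda>t. t *\<^sub>R z)) (at t within A)"
      by (auto intro!: derivative_eq_intros)
    have "((\<lambda>t. u (x + t *\<^sub>R z)) has_derivative (\<lambda>s. u' (x + t *\<^sub>R z) (s *\<^sub>R z))) (at t within A)"
      using has_derivative_compose[OF 1 du] .
    then show ?thesis
      unfolding has_vector_derivative_def
      using linear_scale[OF has_derivative_linear[OF du]] by simp
  qed
  have int: "integrable lborel (\<lambda>t. ?I t *\<^sub>R u' (x + t *\<^sub>R z) z)"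
    and int2: "integrable lborel (\<lambda>t. ?I t *\<^sub>R (k (x + t *\<^sub>R z) * norm z))"
    by (intro borel_integrable_compact uc continuous_intros kc compact_Icc)+
  have "norm (u (x + z) - u x) = norm (\<integral>t. ?I t *\<^sub>R u' (x + t *\<^sub>R z) z \<partial>lborel)"
    using integral_FTC_Icc[OF zero_le_one der uc] by simp
  also have "\<dots> \<le> (\<integral>t. ?I t *\<^sub>R (k (x + t *\<^sub>R z) * norm z) \<partial>lborel)"
    using k(2) by (intro order_trans[OF integral_norm_bound] integral_mono integrable_norm int int2)
      (auto simp: indicator_def)
  also have "\<dots> = (\<integral>t. norm z * (?I t * (?I t * k (x + t *\<^sub>R z))) \<partial>lborel)"
    by (intro Bochner_Integration.integral_cong refl) (auto simp: indicator_def)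
  also have "\<dots> = norm z * (\<integral>t. ?I t * (?I t * k (x + t *\<^sub>R z)) \<partial>lborel)" by simp
  finally have "norm (u (x + z) - u x) \<le> norm z * (\<integral>t. ?I t * (?I t * k (x + t *\<^sub>R z)) \<partial>lborel)" .
  from power_mono[OF this norm_ge_zero, of 2]
  have "(norm (u (x + z) - u x))\<^sup>2 \<le> (norm z)\<^sup>2 * (\<integral>t. ?I t * (?I t * k (x + t *\<^sub>R z)) \<partial>lborel)\<^sup>2"
    by (simp only: power_mult_distrib)
  also have "(\<integral>t. ?I t * (?I t * k (x + t *\<^sub>R z)) \<partial>lborel)\<^sup>2
      \<le> (\<integral>t. (?I t)\<^sup>2 \<partial>lborel) * (\<integral>t. (?I t * k (x + t *\<^sub>R z))\<^sup>2 \<partial>lborel)"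
  proof (rule integral_Cauchy_Schwarz)
    have "integrable lborel (\<lambda>t. ?I t *\<^sub>R (1::real))" "integrable lborel (\<lambda>t. ?I t *\<^sub>R (k (x + t *\<^sub>R z))\<^sup>2)"
      "integrable lborel (\<lambda>t. ?I t *\<^sub>R k (x + t *\<^sub>R z))"
      by (intro borel_integrable_compact continuous_intros kc compact_Icc)+
    moreover have "(\<lambda>t. (?I t)\<^sup>2) = (\<lambda>t. ?I t *\<^sub>R 1)" "(\<lambda>t. (?I t * k (x + t *\<^sub>R z))\<^sup>2) = (\<lambda>t. ?I t *\<^sub>R (k (x + t *\<^sub>R z))\<^sup>2)"
      "(\<lambda>t. ?I t * (?I t * k (x + t *\<^sub>R z))) = (\<lambda>t. ?I t *\<^sub>R k (x + t *\<^sub>R z))"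
      by (auto simp: fun_eq_iff indicator_def)
    ultimately show "integrable lborel (\<lambda>t. (?I t)\<^sup>2)" "integrable lborel (\<lambda>t. (?I t * k (x + t *\<^sub>R z))\<^sup>2)"
      "integrable lborel (\<lambda>t. ?I t * (?I t * k (x + t *\<^sub>R z)))" by simp_all
  qed
  also have "(\<integral>t. (?I t)\<^sup>2 \<partial>lborel) = 1"
  proof -
    have "(\<lambda>t. (?I t)\<^sup>2) = ?I" by (auto simp: fun_eq_iff indicator_def)
    then show ?thesis by simp
  qed
  also have "(\<lambda>t. (?I t * k (x + t *\<^sub>R z))\<^sup>2) = (\<lambda>t. ?I t *\<^sub>R (k (x + t *\<^sub>R z))\<^sup>2)"
    by (auto simp: fun_eq_iff indicator_def)
  finally have le: "(norm (u (x + z) - u x))\<^sup>2 \<le> (norm z)\<^sup>2 * (\<integral>t. ?I t *\<^sub>R (k (x + t *\<^sub>R z))\<^sup>2 \<partial>lborel)"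
    by (simp add: mult_left_mono)
  have "integrable lborel (\<lambda>t. ?I t *\<^sub>R (k (x + t *\<^sub>R z))\<^sup>2)"
    by (intro borel_integrable_compact continuous_intros kc compact_Icc)
  then have "(\<integral>\<^sup>+t. ennreal (?I t *\<^sub>R (k (x + t *\<^sub>R z))\<^sup>2) \<partial>lborel) = ennreal (\<integral>t. ?I t *\<^sub>R (k (x + t *\<^sub>R z))\<^sup>2 \<partial>lborel)"
    by (rule nn_integral_eq_integral) (auto simp: indicator_def)
  moreover have "ennreal (?I t *\<^sub>R (k (x + t *\<^sub>R z))\<^sup>2) = ennreal ((k (x + t *\<^sub>R z))\<^sup>2) * indicator {0..1} t" for t
    by (simp add: indicator_def)
  ultimately show ?thesis using le by (simp add: ennreal_mult''[symmetric] ennreal_leI)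
qed

lemma translation_estimate:
  fixes u :: "'a::euclidean_space \<Rightarrow> 'b::euclidean_space"
  assumes du: "\<And>x. (u has_derivative u' x) (at x)" and cu': "\<And>z. continuous_on UNIV (\<lambda>x. u' x z)"
    and k: "continuous_on UNIV k" "\<And>x z. norm (u' x z) \<le> k x * norm z"
  shows "(\<integral>\<^sup>+x. ennreal ((norm (u (x + z) - u x))\<^sup>2) \<partial>lborel) \<le>
     ennreal ((norm z)\<^sup>2) * (\<integral>\<^sup>+x. ennreal ((k x)\<^sup>2) \<partial>lborel)"
proof -
  have km: "(\<lambda>x. k x) \<in> borel_measurable borel" by (rule borel_measurable_continuous_onI[OF k(1)])
  have jm: "(\<lambda>(x, t). ennreal ((k (x + t *\<^sub>R z))\<^sup>2) * indicator {0..1::real} t) \<in> borel_measurable (lborel \<Otimes>\<^sub>M lborel)"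
  proof -
    have "(\<lambda>w::'a \<times> real. k (fst w + snd w *\<^sub>R z)) \<in> borel_measurable borel"
      by (intro borel_measurable_continuous_onI continuous_on_compose2[OF k(1)] continuous_intros) auto
    then have [measurable]: "(\<lambda>w::'a \<times> real. k (fst w + snd w *\<^sub>R z)) \<in> borel_measurable (lborel \<Otimes>\<^sub>M lborel)"
      by (simp add: lborel_prod)
    show ?thesis unfolding case_prod_beta by measurable
  qed
  have "(\<integral>\<^sup>+x. ennreal ((norm (u (x + z) - u x))\<^sup>2) \<partial>lborel) \<le>
     (\<integral>\<^sup>+x. ennreal ((norm z)\<^sup>2) * (\<integral>\<^sup>+t. ennreal ((k (x + t *\<^sub>R z))\<^sup>2) * indicator {0..1} t \<partial>lborel) \<partial>lborel)"
    by (intro nn_integral_mono increment_le_integral[OF assms])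
  also have "\<dots> = ennreal ((norm z)\<^sup>2) * (\<integral>\<^sup>+x. (\<integral>\<^sup>+t. ennreal ((k (x + t *\<^sub>R z))\<^sup>2) * indicator {0..1} t \<partial>lborel) \<partial>lborel)"
    by (rule nn_integral_cmult[OF lborel.borel_measurable_nn_integral[OF jm]])
  also have "(\<integral>\<^sup>+x. (\<integral>\<^sup>+t. ennreal ((k (x + t *\<^sub>R z))\<^sup>2) * indicator {0..1} t \<partial>lborel) \<partial>lborel)
     = (\<integral>\<^sup>+t. (\<integral>\<^sup>+x. ennreal ((k (x + t *\<^sub>R z))\<^sup>2) * indicator {0..1} t \<partial>lborel) \<partial>lborel)"
    by (rule lborel_pair.Fubini'[OF jm, symmetric])
  also have "\<dots> = (\<integral>\<^sup>+t. (\<integral>\<^sup>+x. ennreal ((k x)\<^sup>2) \<partial>lborel) * indicator {0..1::real} t \<partial>lborel)"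
  proof (rule nn_integral_cong)
    fix t :: real
    have "(\<integral>\<^sup>+x. ennreal ((k (x + t *\<^sub>R z))\<^sup>2) \<partial>lborel) = (\<integral>\<^sup>+x. ennreal ((k x)\<^sup>2) \<partial>lborel)"
      using nn_integral_shift[of "\<lambda>x. ennreal ((k x)\<^sup>2)" "t *\<^sub>R z"] km by (simp add: add.commute)
    moreover have "(\<lambda>x. ennreal ((k (x + t *\<^sub>R z))\<^sup>2)) \<in> borel_measurable lborel"
      using km by measurable
    ultimately show "(\<integral>\<^sup>+x. ennreal ((k (x + t *\<^sub>R z))\<^sup>2) * indicator {0..1} t \<partial>lborel) =
       (\<integral>\<^sup>+x. ennreal ((k x)\<^sup>2) \<partial>lborel) * indicator {0..1} t"
      by (simp add: nn_integral_multc)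
  qed
  also have "\<dots> = (\<integral>\<^sup>+x. ennreal ((k x)\<^sup>2) \<partial>lborel)"
    by (simp add: nn_integral_cmult_indicator)
  finally show ?thesis .
qed

text \<open>Where \<open>\<bar>u(x)\<bar> > t\<close>, at least half of the shifts \<open>z\<close> in a ball of volume \<open>2m\<close> lead to a point with
  \<open>\<bar>u(x + z)\<bar> \<le> t/2\<close>, because the set where \<open>\<bar>u\<bar> > t/2\<close> has measure at most \<open>m\<close>. There \<open>u\<close> changes by at least \<open>t/2\<close>, and the
  square mean of such changes is bounded by \<open>translation_estimate\<close>.\<close>

lemma level_set_le:
  fixes u :: "'a::euclidean_space \<Rightarrow> 'b::euclidean_space"
  assumes du: "\<And>x. (u has_derivative u' x) (at x)" and cu': "\<And>z. continuous_on UNIV (\<lambda>x. u' x z)"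
    and k: "continuous_on UNIV k" "\<And>x z. norm (u' x z) \<le> k x * norm z"
    and D: "(\<integral>\<^sup>+x. ennreal ((k x)\<^sup>2) \<partial>lborel) \<le> ennreal D" "0 \<le> D"
    and t: "0 < t" and m: "0 < m" "emeasure lborel {x. t / 2 < norm (u x)} \<le> ennreal m"
    and r: "0 < r" "measure lborel (cball (0::'a) r) = 2 * m"
  shows "emeasure lborel {x. t < norm (u x)} \<le> ennreal (8 * r\<^sup>2 * D / t\<^sup>2)"
proof -
  have cu: "continuous_on UNIV u"
    using du by (auto intro: continuous_at_imp_continuous_on has_derivative_continuous)
  have um [measurable]: "u \<in> borel_measurable borel" by (rule borel_measurable_continuous_onI[OF cu])
  let ?B = "cball (0::'a) r"
  have B: "emeasure lborel ?B = ennreal (2 * m)"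
    using r(2) emeasure_lborel_cball_finite[of "0::'a" r] by (metis emeasure_eq_ennreal_measure less_irrefl infinity_ennreal_def)
  have Bm [measurable]: "?B \<in> sets borel" by simp
  define L where "L s = {x. s < norm (u x)}" for s
  have L [measurable]: "L s \<in> sets borel" for s unfolding L_def by measurable
  define J where "J x z = ennreal ((norm (u (x + z) - u x))\<^sup>2) * indicator ?B z" for x z
  have jm: "(\<lambda>(x, z). J x z) \<in> borel_measurable (lborel \<Otimes>\<^sub>M lborel)"
  proof -
    have "(\<lambda>w::'a \<times> 'a. u (fst w + snd w) - u (fst w)) \<in> borel_measurable borel"
      by (intro borel_measurable_continuous_onI continuous_intros continuous_on_compose2[OF cu]) auto
    then have [measurable]: "(\<lambda>w::'a \<times> 'a. u (fst w + snd w) - u (fst w)) \<in> borel_measurable (lborel \<Otimes>\<^sub>M lborel)"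
      by (simp add: lborel_prod)
    show ?thesis unfolding case_prod_beta J_def by measurable
  qed
  have lower: "ennreal (t\<^sup>2 / 4 * m) * indicator (L t) x \<le> (\<integral>\<^sup>+z. J x z \<partial>lborel)" for x
  proof (cases "x \<in> L t")
    case True
    let ?G = "?B - {z. x + z \<in> L (t/2)}"
    have G [measurable]: "?G \<in> sets borel" by measurable
    have eq: "emeasure lborel {z. x + z \<in> L (t/2)} = emeasure lborel (L (t/2))"
    proof -
      have "emeasure (distr lborel borel ((+) x)) (L (t/2)) = emeasure lborel ((+) x -` L (t/2) \<inter> space lborel)"
        by (rule emeasure_distr) auto
      then show ?thesis by (simp add: lborel_distr_plus vimage_def)
    qed
    have "ennreal (2 * m) - ennreal m \<le> emeasure lborel ?B - emeasure lborel {z. x + z \<in> L (t/2)}"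
      unfolding B eq using m(2) by (intro ennreal_minus_mono) (auto simp: L_def)
    also have "\<dots> \<le> emeasure lborel ?G"
    proof -
      have "emeasure lborel ?B \<le> emeasure lborel (?G \<union> {z. x + z \<in> L (t/2)})"
        by (intro emeasure_mono) auto
      also have "\<dots> \<le> emeasure lborel ?G + emeasure lborel {z. x + z \<in> L (t/2)}"
        by (intro emeasure_subadditive) auto
      finally show ?thesis
        by (subst ennreal_minus_le_iff) (use B in \<open>auto simp: add.commute\<close>)
    qed
    finally have Gm: "ennreal m \<le> emeasure lborel ?G" using m by (simp add: ennreal_minus)
    have "ennreal (t\<^sup>2 / 4 * m) = ennreal (t\<^sup>2 / 4) * ennreal m" 
      using m by (subst ennreal_mult[symmetric]) auto
    also have "\<dots> \<le> ennreal (t\<^sup>2 / 4) * emeasure lborel ?G" using Gm by (intro mult_left_mono) auto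
    also have "\<dots> = (\<integral>\<^sup>+z. ennreal (t\<^sup>2 / 4) * indicator ?G z \<partial>lborel)"
      by (simp add: nn_integral_cmult_indicator)
    also have "\<dots> \<le> (\<integral>\<^sup>+z. J x z \<partial>lborel)"
    proof (rule nn_integral_mono)
      fix z
      show "ennreal (t\<^sup>2 / 4) * indicator ?G z \<le> J x z"
      proof (cases "z \<in> ?G")
        case z: True
        have "norm (u x) \<le> norm (u (x + z)) + norm (u (x + z) - u x)"
          by (metis norm_minus_commute norm_triangle_sub)
        then have "t / 2 \<le> norm (u (x + z) - u x)" using True z by (auto simp: L_def)
        then have "(t / 2)\<^sup>2 \<le> (norm (u (x + z) - u x))\<^sup>2" using t by (intro power_mono) auto
        then show ?thesis using z by (auto simp: J_def power_divide intro!: ennreal_leI)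
      qed simp
    qed
    finally show ?thesis using True by simp
  qed simp
  have "ennreal (t\<^sup>2 / 4 * m) * emeasure lborel (L t) = (\<integral>\<^sup>+x. ennreal (t\<^sup>2 / 4 * m) * indicator (L t) x \<partial>lborel)"
    by (simp add: nn_integral_cmult_indicator)
  also have "\<dots> \<le> (\<integral>\<^sup>+x. (\<integral>\<^sup>+z. J x z \<partial>lborel) \<partial>lborel)" by (intro nn_integral_mono lower)
  also have "\<dots> = (\<integral>\<^sup>+z. (\<integral>\<^sup>+x. J x z \<partial>lborel) \<partial>lborel)"
    by (rule lborel_pair.Fubini'[OF jm, symmetric])
  also have "\<dots> \<le> (\<integral>\<^sup>+z. ennreal (r\<^sup>2 * D) * indicator ?B z \<partial>lborel)"
  proof (rule nn_integral_mono)
    fix z :: 'a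
    have "(\<integral>\<^sup>+x. J x z \<partial>lborel) = (\<integral>\<^sup>+x. ennreal ((norm (u (x + z) - u x))\<^sup>2) \<partial>lborel) * indicator ?B z"
      unfolding J_def by (rule nn_integral_multc) measurable
    also have "\<dots> \<le> ennreal (r\<^sup>2 * D) * indicator ?B z"
    proof (cases "z \<in> ?B")
      case True
      have "(\<integral>\<^sup>+x. ennreal ((norm (u (x + z) - u x))\<^sup>2) \<partial>lborel) \<le> ennreal ((norm z)\<^sup>2) * ennreal D"
        using translation_estimate[OF du cu' k, of z] D(1) by (meson mult_left_mono order_trans zero_le)
      also have "\<dots> \<le> ennreal (r\<^sup>2) * ennreal D"
        using True by (intro mult_right_mono ennreal_leI power_mono) auto
      also have "\<dots> = ennreal (r\<^sup>2 * D)" using D(2) by (simp add: ennreal_mult)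
      finally show ?thesis using True by simp
    qed simp
    finally show "(\<integral>\<^sup>+x. J x z \<partial>lborel) \<le> ennreal (r\<^sup>2 * D) * indicator ?B z" .
  qed
  also have "\<dots> = ennreal (r\<^sup>2 * D * (2 * m))"
    using B D m by (simp add: nn_integral_cmult_indicator ennreal_mult)
  finally have le: "ennreal (t\<^sup>2 / 4 * m) * emeasure lborel (L t) \<le> ennreal (r\<^sup>2 * D * (2 * m))" .
  have pos: "0 < t\<^sup>2 / 4 * m" using t m by simp
  have "emeasure lborel (L t) \<noteq> \<infinity>"
    using le t m by (auto simp: ennreal_mult_top top_unique)
  then obtain d where d: "0 \<le> d" "emeasure lborel (L t) = ennreal d"
    by (cases "emeasure lborel (L t)") auto
  then have "t\<^sup>2 / 4 * m * d \<le> r\<^sup>2 * D * (2 * m)"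
    using le pos D m by (simp add: ennreal_mult[symmetric])
  then have "t\<^sup>2 * d \<le> 8 * r\<^sup>2 * D" using m by (simp add: field_simps)
  then have "d \<le> 8 * r\<^sup>2 * D / t\<^sup>2" using t by (simp add: field_simps)
  then show ?thesis using d by (simp add: L_def ennreal_leI)
qed

text \<open>With \<open>m\<close> of size \<open>t\<^sup>-\<^sup>p\<close> the ball in \<open>level_set_le\<close> has radius of size \<open>t\<^bsup>-p/3\<^esup>\<close>, whence the new exponent
  \<open>2 + 2p/3\<close>. Its fixed point is the Sobolev exponent 6.\<close>

lemma weak_Lp_gradient_improve:
  fixes u :: "real^3 \<Rightarrow> 'b::euclidean_space"
  assumes du: "\<And>x. (u has_derivative u' x) (at x)" and cu': "\<And>z. continuous_on UNIV (\<lambda>x. u' x z)"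
    and k: "continuous_on UNIV k" "\<And>x z. norm (u' x z) \<le> k x * norm z"
    and D: "(\<integral>\<^sup>+x. ennreal ((k x)\<^sup>2) \<partial>lborel) < \<infinity>"
    and w: "weak_Lp p u"
  shows "weak_Lp (2 + 2 * p / 3) u"
proof -
  obtain A where A: "A \<ge> 0" "\<And>t. t > 0 \<Longrightarrow> emeasure lborel {x. t < norm (u x)} \<le> ennreal (A * t powr (- p))"
    using w unfolding weak_Lp_def by blast
  obtain D' where D': "0 \<le> D'" "(\<integral>\<^sup>+x. ennreal ((k x)\<^sup>2) \<partial>lborel) = ennreal D'"
    using D by (cases "\<integral>\<^sup>+x. ennreal ((k x)\<^sup>2) \<partial>lborel") auto
  define V where "V = measure lborel (cball (0::real^3) 1)"
  have V: "V > 0" unfolding V_def by (simp add: content_cball_pos)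
  define B where "B = 2 * ((A + 1) * 2 powr p) / V"
  have B: "B > 0" using A V unfolding B_def by (intro divide_pos_pos mult_pos_pos) auto
  have "emeasure lborel {x. t < norm (u x)} \<le> ennreal (8 * B powr (2/3) * D' * t powr (- (2 + 2 * p / 3)))"
    if t: "t > 0" for t
  proof -
    define m where "m = (A + 1) * (t / 2) powr (- p)"
    have m: "m > 0" using A t by (simp add: m_def)
    have "ennreal (A * (t / 2) powr (- p)) \<le> ennreal m"
      unfolding m_def by (intro ennreal_leI mult_right_mono) auto
    then have mm: "emeasure lborel {x. t / 2 < norm (u x)} \<le> ennreal m"
      using A(2)[of "t / 2"] t by (auto intro: order_trans)
    \<comment> \<open>The radius for which the ball has volume \<open>2 m\<close>.\<close>
    define r where "r = (2 * m / V) powr (1/3)"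
    have r: "r > 0" using m V by (simp add: r_def)
    have "r ^ 3 = r powr 3" using r by (simp add: powr_numeral)
    also have "\<dots> = 2 * m / V" using m V by (simp add: r_def powr_powr)
    finally have r3: "r ^ 3 = 2 * m / V" .
    have "measure lborel (cball (0::real^3) r) = V * r ^ 3"
      using r by (simp add: V_def content_cball)
    then have vol: "measure lborel (cball (0::real^3) r) = 2 * m" using r3 V by simp
    have "emeasure lborel {x. t < norm (u x)} \<le> ennreal (8 * r\<^sup>2 * D' / t\<^sup>2)"
      by (rule level_set_le[OF du cu' k _ D'(1) t m mm r vol]) (simp add: D')
    also have "8 * r\<^sup>2 * D' / t\<^sup>2 = 8 * B powr (2/3) * D' * t powr (- (2 + 2 * p / 3))"
    proof -
      have "2 * m / V = B * t powr (- p)"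
        using t by (simp add: m_def B_def powr_divide powr_minus field_simps)
      then have "r = (B * t powr (- p)) powr (1/3)" by (simp add: r_def)
      then have "r\<^sup>2 = ((B * t powr (- p)) powr (1/3)) powr 2" using r by (simp add: powr_numeral)
      also have "\<dots> = B powr (2/3) * t powr (- (2 * p / 3))"
        using B t by (simp add: powr_powr powr_mult mult.commute)
      finally have "r\<^sup>2 / t\<^sup>2 = B powr (2/3) * (t powr (- (2 * p / 3)) / t powr 2)"
        using t by (simp add: powr_numeral)
      also have "t powr (- (2 * p / 3)) / t powr 2 = t powr (- (2 + 2 * p / 3))"
      proof -
        have "- (2 + 2 * p / 3) = - (2 * p / 3) - 2" by simp
        then show ?thesis by (simp only: powr_diff)
      qed
      finally have "8 * D' * (r\<^sup>2 / t\<^sup>2) = 8 * D' * (B powr (2/3) * t powr (- (2 + 2 * p / 3)))" by (simp only:)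
      then show ?thesis by (simp add: mult.assoc mult.left_commute mult.commute[of _ D'])
    qed
    finally show ?thesis .
  qed
  then show ?thesis
    unfolding weak_Lp_def using D' by (intro exI[of _ "8 * B powr (2/3) * D'"]) auto
qed

text \<open>The smaller exponent serves for small \<open>t\<close>, the larger one for large \<open>t\<close>.\<close>

lemma weak_Lp_interpolate:
  assumes "weak_Lp p u" "weak_Lp r u" "p \<le> q" "q \<le> r"
  shows "weak_Lp q u"
proof -
  obtain A where A: "A \<ge> 0" "\<And>t. t > 0 \<Longrightarrow> emeasure lborel {x. t < norm (u x)} \<le> ennreal (A * t powr (- p))"
    using assms(1) unfolding weak_Lp_def by blast
  obtain B where B: "B \<ge> 0" "\<And>t. t > 0 \<Longrightarrow> emeasure lborel {x. t < norm (u x)} \<le> ennreal (B * t powr (- r))"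
    using assms(2) unfolding weak_Lp_def by blast
  have "emeasure lborel {x. t < norm (u x)} \<le> ennreal ((A + B) * t powr (- q))" if t: "t > 0" for t
  proof (cases "t \<le> 1")
    case True
    have "t powr (- p) \<le> t powr (- q)" using True t assms by (intro powr_mono') auto
    then have "A * t powr (- p) \<le> (A + B) * t powr (- q)" using A B by (intro mult_mono) auto
    then show ?thesis using A(2)[OF t] by (meson ennreal_leI order_trans)
  next
    case False
    then have "t powr (- r) \<le> t powr (- q)" using assms by (intro powr_mono) auto
    then have "B * t powr (- r) \<le> (A + B) * t powr (- q)" using A B by (intro mult_mono) auto
    then show ?thesis using B(2)[OF t] by (meson ennreal_leI order_trans)
  qed
  then show ?thesis unfolding weak_Lp_def using A B by (intro exI[of _ "A + B"]) auto
qed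

text \<open>Layer cake formula. Levels below \<open>T\<close> are estimated by the volume of the ball, levels above \<open>T\<close> by the weak bound; the
  latter part converges at infinity because \<open>p > 4\<close>.\<close>

lemma weak_Lp_L4_growth:
  fixes u :: "real^3 \<Rightarrow> 'b::euclidean_space"
  assumes cu: "continuous_on UNIV u" and w: "weak_Lp p u" and p: "4 < p"
  shows "\<exists>C\<ge>0. \<forall>R>0. (LINT x:cball 0 R|lborel. (norm (u x))^4) \<le> C * R powr (3 - 12 / p)"
proof -
  obtain A where A: "A \<ge> 0" "\<And>t. t > 0 \<Longrightarrow> emeasure lborel {x. t < norm (u x)} \<le> ennreal (A * t powr (- p))"
    using w unfolding weak_Lp_def by blast
  define V where "V = measure lborel (cball (0::real^3) 1)"
  have V: "V \<ge> 0" unfolding V_def by simp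
  have um [measurable]: "u \<in> borel_measurable borel" by (rule borel_measurable_continuous_onI[OF cu])
  have "(LINT x:cball 0 R|lborel. (norm (u x))^4) \<le> (V + 4 * A / (p - 4)) * R powr (3 - 12 / p)" if R: "R > 0" for R
  proof -
    let ?B = "cball (0::real^3) R"
    have Bm [measurable]: "?B \<in> sets borel" by simp
    have B: "emeasure lborel ?B = ennreal (V * R ^ 3)"
      using R emeasure_eq_ennreal_measure[of lborel ?B] emeasure_lborel_cball_finite[of "0::real^3" R]
      by (simp add: V_def content_cball)
    \<comment> \<open>At this level the volume of the ball and the weak bound on the level set are of the same size.\<close>
    define T where "T = R powr (- (3 / p))"
    have T: "T > 0" using R by (simp add: T_def)
    define J where "J x s = ennreal (4 * s^3) * indicator {0<..} s * indicator {x. s < norm (u x)} x * indicator ?B x"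
      for x and s :: real
    have jm: "(\<lambda>(x, s). J x s) \<in> borel_measurable (lborel \<Otimes>\<^sub>M lborel)"
    proof -
      have "(\<lambda>(x, s). J x s) = (\<lambda>w. ennreal (4 * (snd w)^3) * indicator {0<..} (snd w)
          * indicator {w. snd w < norm (u (fst w))} w * indicator ?B (fst w))"
        by (auto simp: J_def fun_eq_iff indicator_def)
      moreover have "(\<lambda>w. ennreal (4 * (snd w)^3) * indicator {0<..} (snd w)
          * indicator {w. snd w < norm (u (fst w))} w * indicator ?B (fst w)) \<in> borel_measurable (lborel \<Otimes>\<^sub>M lborel)"
        by measurable
      ultimately show ?thesis by simp
    qed
    have layer: "ennreal ((norm (u x))^4) * indicator ?B x = (\<integral>\<^sup>+s. J x s \<partial>lborel)" for x
    proof -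
      have "(\<integral>\<^sup>+s. ennreal (4 * s^3) * indicator {0..norm (u x)} s \<partial>lborel) = ennreal ((norm (u x))^4 - 0^4)"
        by (rule nn_integral_FTC_Icc) (auto intro!: derivative_eq_intros)
      moreover have "(\<integral>\<^sup>+s. ennreal (4 * s^3) * indicator {0..norm (u x)} s \<partial>lborel)
          = (\<integral>\<^sup>+s. ennreal (4 * s^3) * indicator {0<..} s * indicator {x. s < norm (u x)} x \<partial>lborel)"
      proof (rule nn_integral_cong_AE)
        have "AE s in lborel. s \<noteq> norm (u x)" by (rule AE_lborel_singleton)
        then show "AE s in lborel. ennreal (4 * s^3) * indicator {0..norm (u x)} s =
           ennreal (4 * s^3) * indicator {0<..} s * indicator {x. s < norm (u x)} x"
          by eventually_elim (auto simp: indicator_def)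
      qed
      ultimately show ?thesis by (cases "x \<in> ?B") (auto simp: J_def)
    qed
    have "(\<integral>\<^sup>+x. ennreal ((norm (u x))^4) * indicator ?B x \<partial>lborel) = (\<integral>\<^sup>+x. (\<integral>\<^sup>+s. J x s \<partial>lborel) \<partial>lborel)"
      by (simp add: layer)
    also have "\<dots> = (\<integral>\<^sup>+s. (\<integral>\<^sup>+x. J x s \<partial>lborel) \<partial>lborel)"
      by (rule lborel_pair.Fubini'[OF jm, symmetric])
    also have "\<dots> \<le> (\<integral>\<^sup>+s. ennreal (V * R^3) * (ennreal (4 * s^3) * indicator {0..T} s)
        + ennreal (4 * A * s powr (3 - p)) * indicator {T..} s \<partial>lborel)"
    proof (rule nn_integral_mono)
      fix s :: real
      have eq: "(\<integral>\<^sup>+x. J x s \<partial>lborel) = ennreal (4 * s^3) * indicator {0<..} s * emeasure lborel ({x. s < norm (u x)} \<inter> ?B)"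
      proof -
        have "J x s = ennreal (4 * s^3) * indicator {0<..} s * indicator ({x. s < norm (u x)} \<inter> ?B) x" for x
          by (auto simp: J_def indicator_def)
        then show ?thesis by (simp add: nn_integral_cmult_indicator)
      qed
      show "(\<integral>\<^sup>+x. J x s \<partial>lborel) \<le> ennreal (V * R^3) * (ennreal (4 * s^3) * indicator {0..T} s)
        + ennreal (4 * A * s powr (3 - p)) * indicator {T..} s"
      proof (cases "s > 0")
        case s: True
        show ?thesis
        proof (cases "s \<le> T")
          case True
          have le: "emeasure lborel ({x. s < norm (u x)} \<inter> ?B) \<le> ennreal (V * R^3)"
            unfolding B[symmetric] by (intro emeasure_mono) auto
          then have "(\<integral>\<^sup>+x. J x s \<partial>lborel) \<le> ennreal (V * R^3) * (ennreal (4 * s^3) * indicator {0..T} s)"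
            using mult_right_mono[OF le, of "ennreal (4 * s^3)"] s True by (simp add: eq mult.commute)
          then show ?thesis by (rule order_trans) simp
        next
          case False
          have "emeasure lborel ({x. s < norm (u x)} \<inter> ?B) \<le> emeasure lborel {x. s < norm (u x)}"
            by (intro emeasure_mono) auto
          then have "emeasure lborel ({x. s < norm (u x)} \<inter> ?B) \<le> ennreal (A * s powr (- p))"
            using A(2)[OF s] by (rule order_trans)
          then have "(\<integral>\<^sup>+x. J x s \<partial>lborel) \<le> ennreal (4 * s^3) * ennreal (A * s powr (- p))"
            unfolding eq using s by (simp add: mult_left_mono)
          also have "\<dots> = ennreal (4 * A * (s powr 3 * s powr (- p)))"
            using s A by (simp add: ennreal_mult[symmetric] powr_numeral mult_ac)
          also have "s powr 3 * s powr (- p) = s powr (3 - p)" by (simp add: powr_add[symmetric])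
          finally show ?thesis using False s by (simp add: indicator_def)
        qed
      qed (simp add: eq)
    qed
    also have "\<dots> = (\<integral>\<^sup>+s. ennreal (V * R^3) * (ennreal (4 * s^3) * indicator {0..T} s) \<partial>lborel)
        + (\<integral>\<^sup>+s. ennreal (4 * A * s powr (3 - p)) * indicator {T..} s \<partial>lborel)"
      by (rule nn_integral_add) auto
    also have "(\<integral>\<^sup>+s. ennreal (V * R^3) * (ennreal (4 * s^3) * indicator {0..T} s) \<partial>lborel) = ennreal (V * R^3) * ennreal (T^4 - 0^4)"
    proof (subst nn_integral_cmult)
      have "(\<integral>\<^sup>+s. ennreal (4 * s^3) * indicator {0..T} s \<partial>lborel) = ennreal (T^4 - 0^4)"
        by (rule nn_integral_FTC_Icc) (use T in \<open>auto intro!: derivative_eq_intros\<close>)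
      then show "ennreal (V * R^3) * (\<integral>\<^sup>+s. ennreal (4 * s^3) * indicator {0..T} s \<partial>lborel) = ennreal (V * R^3) * ennreal (T^4 - 0^4)"
        by simp
    qed auto
    also have "(\<integral>\<^sup>+s. ennreal (4 * A * s powr (3 - p)) * indicator {T..} s \<partial>lborel)
       = ennreal (0 - 4 * A / (4 - p) * T powr (4 - p))"
    proof (rule nn_integral_FTC_atLeast)
      show "((\<lambda>s. 4 * A / (4 - p) * s powr (4 - p)) has_real_derivative 4 * A * s powr (3 - p)) (at s)" if "T \<le> s" for s
        using that T p by (auto intro!: derivative_eq_intros has_real_derivative_powr)
      have "((\<lambda>s::real. s powr (4 - p)) \<longlongrightarrow> 0) at_top"
        using p by (intro tendsto_neg_powr filterlim_ident) auto
      then show "((\<lambda>s. 4 * A / (4 - p) * s powr (4 - p)) \<longlongrightarrow> 0) at_top"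
        by (rule tendsto_mult_right_zero)
    qed (use A in auto)
    also have "ennreal (V * R^3) * ennreal (T^4 - 0^4) + ennreal (0 - 4 * A / (4 - p) * T powr (4 - p))
        = ennreal (V * R^3 * T^4 + 4 * A / (p - 4) * T powr (4 - p))"
    proof -
      have "0 - 4 * A / (4 - p) * T powr (4 - p) = 4 * A / (p - 4) * T powr (4 - p)"
        using p by (simp add: field_simps)
      moreover have "0 \<le> 4 * A / (p - 4) * T powr (4 - p)" using A p by (intro mult_nonneg_nonneg) auto
      ultimately show ?thesis using V R T by (simp add: ennreal_mult[symmetric] ennreal_plus)
    qed
    also have "V * R^3 * T^4 + 4 * A / (p - 4) * T powr (4 - p) = (V + 4 * A / (p - 4)) * R powr (3 - 12 / p)"
    proof -
      have "R^3 * T^4 = R powr 3 * R powr (- (3 / p) * 4)"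
        using R T unfolding T_def powr_powr[symmetric] by (simp add: powr_numeral)
      also have "\<dots> = R powr (3 - 12 / p)" by (simp add: powr_add[symmetric])
      finally have 1: "R^3 * T^4 = R powr (3 - 12 / p)" .
      have "T powr (4 - p) = R powr (3 - 12 / p)"
      proof -
        have e: "- (3 / p) * (4 - p) = 3 - 12 / p" using p by (simp add: field_simps)
        show ?thesis unfolding T_def powr_powr e ..
      qed
      with 1 show ?thesis by (simp add: algebra_simps)
    qed
    finally have le: "(\<integral>\<^sup>+x. ennreal ((norm (u x))^4) * indicator ?B x \<partial>lborel)
        \<le> ennreal ((V + 4 * A / (p - 4)) * R powr (3 - 12 / p))" .
    have "(\<integral>\<^sup>+x. ennreal ((norm (u x))^4) * indicator ?B x \<partial>lborel)
        = (\<integral>\<^sup>+x. ennreal (indicat_real ?B x * (norm (u x))^4) \<partial>lborel)"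
      by (intro nn_integral_cong) (auto simp: indicator_def)
    also have "\<dots> = ennreal (LINT x:cball 0 R|lborel. (norm (u x))^4)"
      unfolding set_lebesgue_integral_def real_scaleR_def
    proof (rule nn_integral_eq_integral)
      have "integrable lborel (\<lambda>x. indicat_real ?B x *\<^sub>R (norm (u x))^4)"
        using cu by (intro borel_integrable_compact continuous_intros) (auto intro: continuous_on_subset)
      then show "integrable lborel (\<lambda>x. indicat_real ?B x * (norm (u x))^4)" by simp
    qed auto
    finally show ?thesis using le A V p by (simp add: ennreal_le_iff)
  qed
  moreover have "0 \<le> V + 4 * A / (p - 4)" using V A p by simp
  ultimately show ?thesis by blast
qed

section \<open>Energy balance of a stationary barotropic flow\<close>

lemma sqrt_mult_powr: "0 \<le> C \<Longrightarrow> sqrt (C * R powr k) = sqrt C * R powr (k / 2)"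
  by (simp add: real_sqrt_mult powr_half_sqrt[symmetric] powr_powr)

text \<open>For \<open>s \<ge> r\<close> replace the first factor of \<open>s r\<^bsup>\<gamma>-1\<^esup>\<close> by \<open>r\<close>, which only decreases it; the other case is
  symmetric.\<close>

lemma powr_pressure_le:
  fixes s r \<gamma> :: real
  assumes "0 \<le> s" "0 \<le> r" "1 < \<gamma>"
  shows "\<bar>s powr \<gamma> - s * r powr (\<gamma> - 1)\<bar> \<le> \<bar>s powr \<gamma> - r powr \<gamma>\<bar>"
proof -
  have pw: "t powr \<gamma> = t * t powr (\<gamma> - 1)" if "0 \<le> t" for t :: real
  proof -
    have one: "t powr 1 = t" using that by simp
    have "t powr \<gamma> = t powr 1 * t powr (\<gamma> - 1)" by (simp only: powr_add[symmetric]) simp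
    then show ?thesis by (simp only: one)
  qed
  show ?thesis
  proof (cases "r \<le> s")
    case True
    have 1: "r powr (\<gamma> - 1) \<le> s powr (\<gamma> - 1)" using True assms by (intro powr_mono2) auto
    have "s * r powr (\<gamma> - 1) \<le> s * s powr (\<gamma> - 1)" using 1 assms by (intro mult_left_mono) auto
    moreover have "r * r powr (\<gamma> - 1) \<le> s * r powr (\<gamma> - 1)" using True by (intro mult_right_mono) auto
    ultimately show ?thesis using assms by (simp add: pw)
  next
    case False
    have 1: "s powr (\<gamma> - 1) \<le> r powr (\<gamma> - 1)" using False assms by (intro powr_mono2) auto
    have "s * s powr (\<gamma> - 1) \<le> s * r powr (\<gamma> - 1)" using 1 assms by (intro mult_left_mono) auto
    moreover have "s * r powr (\<gamma> - 1) \<le> r * r powr (\<gamma> - 1)" using False by (intro mult_right_mono) auto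
    ultimately show ?thesis using assms by (simp add: pw)
  qed
qed

text \<open>A flow in components, with \<open>\<mu>\<close> for the sum of the coefficients \<open>lam + \<nu>\<close>, \<open>D i j\<close> for \<open>\<partial>\<^sub>ju\<^sub>i\<close> and \<open>D2 i j k\<close> for
  \<open>\<partial>\<^sub>k\<partial>\<^sub>ju\<^sub>i\<close>. The velocity is controlled at infinity by the growth of the integral of \<open>\<bar>u\<bar>\<^sup>4\<close> over balls; the
  threshold \<open>1/3\<close> is where the bound on the total energy flux stops decaying.\<close>

locale barotropic_flow =
  fixes a \<gamma> \<nu> \<mu> M C4 \<kappa> :: real
    and \<rho> P :: "real^3 \<Rightarrow> real" and d\<rho> dP :: "3 \<Rightarrow> real^3 \<Rightarrow> real"
    and u :: "3 \<Rightarrow> real^3 \<Rightarrow> real" and D :: "3 \<Rightarrow> 3 \<Rightarrow> real^3 \<Rightarrow> real"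
    and D2 :: "3 \<Rightarrow> 3 \<Rightarrow> 3 \<Rightarrow> real^3 \<Rightarrow> real"
  assumes params: "0 < a" "1 < \<gamma>" "0 < \<nu>" "0 < \<mu>"
    and rho: "\<And>x. 0 \<le> \<rho> x" "\<And>x. \<rho> x \<le> M"
    and cont: "continuous_on UNIV \<rho>" "\<And>j. continuous_on UNIV (d\<rho> j)" "\<And>j. continuous_on UNIV (dP j)"
      "\<And>i. continuous_on UNIV (u i)" "\<And>i j. continuous_on UNIV (D i j)" "\<And>i j k. continuous_on UNIV (D2 i j k)"
      "continuous_on UNIV P"
    and dd: "\<And>j. has_dirderiv \<rho> (axis j 1) (d\<rho> j)" "\<And>j. has_dirderiv P (axis j 1) (dP j)"
      "\<And>i j. has_dirderiv (u i) (axis j 1) (D i j)" "\<And>i j k. has_dirderiv (D i j) (axis k 1) (D2 i j k)"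
    and P_eq: "\<And>x. P x = a * \<rho> x powr \<gamma>"
    and dP_eq: "\<And>j x. dP j x = a * \<gamma> * \<rho> x powr (\<gamma> - 1) * d\<rho> j x"
    and mass: "\<And>x. (\<Sum>i\<in>UNIV. d\<rho> i x * u i x + \<rho> x * D i i x) = 0"
    and momentum: "\<And>i x. (\<Sum>j\<in>UNIV. (d\<rho> j x * u i x + \<rho> x * D i j x) * u j x + \<rho> x * u i x * D j j x)
        - \<nu> * (\<Sum>j\<in>UNIV. D2 i j j x) - \<mu> * (\<Sum>k\<in>UNIV. D2 k k i x) + dP i x = 0"
    and D_int: "integrable lborel (\<lambda>x. \<Sum>i\<in>UNIV. \<Sum>j\<in>UNIV. (D i j x)\<^sup>2)"
    and L4: "0 \<le> C4" "\<And>R. 0 < R \<Longrightarrow> (LINT x:cball 0 R|lborel. (\<Sum>i\<in>UNIV. (u i x)\<^sup>2)\<^sup>2) \<le> C4 * R powr \<kappa>"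
    and kappa: "0 \<le> \<kappa>" "\<kappa> < 1 / 3"
begin

definition "sq_norm_D x = (\<Sum>i\<in>UNIV. \<Sum>j\<in>UNIV. (D i j x)\<^sup>2)"
definition "sq_norm_u x = (\<Sum>i\<in>UNIV. (u i x)\<^sup>2)"
definition "div_u x = (\<Sum>k\<in>UNIV. D k k x)"
definition "dissipation x = \<nu> * sq_norm_D x + \<mu> * (div_u x)\<^sup>2"

lemma cont_derived: "continuous_on UNIV sq_norm_D" "continuous_on UNIV sq_norm_u"
  "continuous_on UNIV div_u" "continuous_on UNIV dissipation"
  unfolding sq_norm_D_def[abs_def] sq_norm_u_def[abs_def] div_u_def[abs_def] dissipation_def[abs_def]
  by (intro continuous_intros cont)+

lemma nonneg_derived: "0 \<le> sq_norm_D x" "0 \<le> sq_norm_u x" "0 \<le> dissipation x"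
  unfolding sq_norm_D_def sq_norm_u_def dissipation_def using params
  by (auto intro!: sum_nonneg add_nonneg_nonneg mult_nonneg_nonneg)

lemma M_nonneg: "0 \<le> M" using rho[of 0] by linarith

text \<open>The momentum equation is \<open>\<nabla>P = div S\<close> for this tensor.\<close>

definition "stress i j x = \<nu> * D i j x + (if i = j then \<mu> else 0) * div_u x - \<rho> x * u i x * u j x"
definition "dstress i j x = \<nu> * D2 i j j x + (if i = j then \<mu> else 0) * (\<Sum>k\<in>UNIV. D2 k k j x)
   - ((d\<rho> j x * u i x + \<rho> x * D i j x) * u j x + \<rho> x * u i x * D j j x)"

lemma has_dirderiv_stress: "has_dirderiv (stress i j) (axis j 1) (dstress i j)"
proof -
  have "has_dirderiv div_u (axis j 1) (\<lambda>x. \<Sum>k\<in>UNIV. D2 k k j x)"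
    unfolding div_u_def[abs_def] by (intro has_dirderiv_sum dd)
  then show ?thesis
    unfolding stress_def[abs_def] dstress_def[abs_def]
    by (intro has_dirderiv_diff has_dirderiv_add has_dirderiv_cmult has_dirderiv_mult dd)
qed

lemma stress_balance: "stress_balance P stress"
  unfolding stress_balance_def
proof (intro conjI exI[of _ dP] exI[of _ dstress] allI)
  show "continuous_on UNIV (stress i j)" for i j
    unfolding stress_def[abs_def] by (intro continuous_intros cont cont_derived)
  show "continuous_on UNIV (dstress i j)" for i j
    unfolding dstress_def[abs_def] by (intro continuous_intros cont cont_derived)
  fix i x
  have "(\<Sum>j\<in>UNIV. dstress i j x) = \<nu> * (\<Sum>j\<in>UNIV. D2 i j j x)
      + (\<Sum>j\<in>UNIV. (if i = j then \<mu> else 0) * (\<Sum>k\<in>UNIV. D2 k k j x))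
      - (\<Sum>j\<in>UNIV. (d\<rho> j x * u i x + \<rho> x * D i j x) * u j x + \<rho> x * u i x * D j j x)"
    unfolding dstress_def sum_subtractf sum.distrib[of "\<lambda>j. \<nu> * _ j"] sum_distrib_left[of \<nu>] ..
  also have "(\<Sum>j\<in>UNIV. (if i = j then \<mu> else 0) * (\<Sum>k\<in>UNIV. D2 k k j x)) = \<mu> * (\<Sum>k\<in>UNIV. D2 k k i x)"
    by (simp add: if_distrib[of "\<lambda>c. c * _"] cong: if_cong)
  finally show "dP i x = (\<Sum>j\<in>UNIV. dstress i j x)" using momentum[of x i] by linarith
qed (use cont dd has_dirderiv_stress in auto)

lemma div_u_squared_le: "(div_u x)\<^sup>2 \<le> 3 * sq_norm_D x"
proof -
  have "(div_u x)\<^sup>2 \<le> (\<Sum>k\<in>UNIV. (D k k x)\<^sup>2) * (\<Sum>k\<in>(UNIV::3 set). 1\<^sup>2)"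
    unfolding div_u_def using Cauchy_Schwarz_ineq_sum[of "\<lambda>k. D k k x" "\<lambda>_. 1" UNIV] by simp
  also have "(\<Sum>k\<in>UNIV. (D k k x)\<^sup>2) \<le> sq_norm_D x"
    unfolding sq_norm_D_def by (intro sum_mono member_le_sum) auto
  finally show ?thesis by simp
qed

text \<open>The gradient part is bounded, the part \<open>\<rho> u \<otimes> u\<close> grows like the integral of \<open>\<bar>u\<bar>\<^sup>4\<close>.\<close>

lemma stress_energy_bound:
  "\<exists>C\<ge>0. \<forall>R\<ge>1. stress_energy (3 * R) stress \<le> C * R powr \<kappa>"
proof -
  define DD where "DD = integral\<^sup>L lborel sq_norm_D"
  define K where "K = 3 * \<nu>\<^sup>2 + 27 * \<mu>\<^sup>2 + 3 * M\<^sup>2"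
  have DD: "0 \<le> DD" unfolding DD_def using nonneg_derived by simp
  have K: "0 \<le> K" unfolding K_def by simp
  have pw: "(\<Sum>i\<in>UNIV. \<Sum>j\<in>UNIV. (stress i j x)\<^sup>2) \<le> K * (sq_norm_D x + (sq_norm_u x)\<^sup>2)" for x
  proof -
    have sq3: "(p + q - r)\<^sup>2 \<le> 3 * p\<^sup>2 + 3 * q\<^sup>2 + 3 * r\<^sup>2" for p q r :: real
      using zero_le_power2[of "p - q"] zero_le_power2[of "p + r"] zero_le_power2[of "q + r"]
      by (simp add: power2_eq_square algebra_simps)
    have "(\<Sum>i\<in>UNIV. \<Sum>j\<in>UNIV. (stress i j x)\<^sup>2) \<le> (\<Sum>i\<in>UNIV. \<Sum>j\<in>UNIV.
        3 * \<nu>\<^sup>2 * (D i j x)\<^sup>2 + 3 * \<mu>\<^sup>2 * (if i = j then (div_u x)\<^sup>2 else 0) + 3 * (\<rho> x)\<^sup>2 * ((u i x)\<^sup>2 * (u j x)\<^sup>2))"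
    proof (intro sum_mono)
      fix i j :: 3
      show "(stress i j x)\<^sup>2 \<le> 3 * \<nu>\<^sup>2 * (D i j x)\<^sup>2 + 3 * \<mu>\<^sup>2 * (if i = j then (div_u x)\<^sup>2 else 0) + 3 * (\<rho> x)\<^sup>2 * ((u i x)\<^sup>2 * (u j x)\<^sup>2)"
        unfolding stress_def using sq3[of "\<nu> * D i j x" "(if i = j then \<mu> else 0) * div_u x" "\<rho> x * u i x * u j x"]
        by (auto simp: power_mult_distrib mult.assoc)
    qed
    also have "\<dots> = 3 * \<nu>\<^sup>2 * sq_norm_D x + 3 * \<mu>\<^sup>2 * (3 * (div_u x)\<^sup>2) + 3 * (\<rho> x)\<^sup>2 * (sq_norm_u x)\<^sup>2"
      unfolding sum.distrib sum_distrib_left[symmetric] sum_distrib_right[symmetric] sq_norm_D_def sq_norm_u_def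
      by (simp add: power2_eq_square[of "sum _ _"])
    also have "\<dots> \<le> 3 * \<nu>\<^sup>2 * sq_norm_D x + 3 * \<mu>\<^sup>2 * (3 * (3 * sq_norm_D x)) + 3 * M\<^sup>2 * (sq_norm_u x)\<^sup>2"
      using div_u_squared_le[of x] rho[of x]
      by (intro add_mono mult_left_mono mult_right_mono power_mono) auto
    also have "\<dots> \<le> K * (sq_norm_D x + (sq_norm_u x)\<^sup>2)"
    proof -
      have "0 \<le> 3 * M\<^sup>2 * sq_norm_D x + (3 * \<nu>\<^sup>2 + 27 * \<mu>\<^sup>2) * (sq_norm_u x)\<^sup>2"
        using nonneg_derived by simp
      then show ?thesis unfolding K_def by (simp add: algebra_simps)
    qed
    finally show ?thesis .
  qed
  have "stress_energy (3 * R) stress \<le> K * (DD + C4 * 3 powr \<kappa>) * R powr \<kappa>" if R: "R \<ge> 1" for R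
  proof -
    have cS: "continuous_on UNIV (stress i j)" for i j using stress_balance by (simp add: stress_balance_def)
    have "stress_energy (3 * R) stress \<le> (LINT x:cball 0 (3 * R)|lborel. K * (sq_norm_D x + (sq_norm_u x)\<^sup>2))"
      unfolding stress_energy_def
      by (intro set_integral_mono integral_set_cball continuous_intros cont_derived cS pw)
    also have "\<dots> = K * ((LINT x:cball 0 (3 * R)|lborel. sq_norm_D x) + (LINT x:cball 0 (3 * R)|lborel. (sq_norm_u x)\<^sup>2))"
      by (subst set_integral_mult_right, subst set_integral_add)
        (auto intro!: integral_set_cball continuous_intros cont_derived)
    also have "\<dots> \<le> K * (DD + C4 * (3 * R) powr \<kappa>)"
    proof (intro mult_left_mono add_mono K)
      show "(LINT x:cball 0 (3 * R)|lborel. sq_norm_D x) \<le> DD"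
        unfolding DD_def set_lebesgue_integral_def
        using D_int nonneg_derived integral_set_cball(1)[OF cont_derived(1)]
        by (intro integral_mono) (auto simp: sq_norm_D_def[abs_def] indicator_def)
      show "(LINT x:cball 0 (3 * R)|lborel. (sq_norm_u x)\<^sup>2) \<le> C4 * (3 * R) powr \<kappa>"
        unfolding sq_norm_u_def using R by (intro L4) simp
    qed
    also have "\<dots> \<le> K * ((DD + C4 * 3 powr \<kappa>) * R powr \<kappa>)"
    proof (rule mult_left_mono[OF _ K])
      have "1 \<le> R powr \<kappa>" using R kappa by (simp add: ge_one_powr_ge_zero)
      then have "DD * 1 \<le> DD * R powr \<kappa>" using DD by (intro mult_left_mono)
      then show "DD + C4 * (3 * R) powr \<kappa> \<le> (DD + C4 * 3 powr \<kappa>) * R powr \<kappa>"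
        using R by (simp add: powr_mult algebra_simps)
    qed
    finally show ?thesis by (simp add: mult.assoc)
  qed
  moreover have "0 \<le> K * (DD + C4 * 3 powr \<kappa>)" using K DD L4 by simp
  ultimately show ?thesis by blast
qed

text \<open>The free parameter \<open>\<beta>\<close> multiplies the mass flux \<open>\<rho> u\<close>, which is divergence free.\<close>

definition "energy_flux \<beta> j x = 1/2 * (\<rho> x * u j x * sq_norm_u x) - \<nu> * (\<Sum>i\<in>UNIV. u i x * D i j x)
    - \<mu> * (u j x * div_u x) + \<gamma> / (\<gamma> - 1) * (P x * u j x) - \<beta> * (\<rho> x * u j x)"

definition "energy_flux_deriv \<beta> j x =
    1/2 * ((d\<rho> j x * u j x + \<rho> x * D j j x) * sq_norm_u x + \<rho> x * u j x * (\<Sum>i\<in>UNIV. 2 * (u i x * D i j x)))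
    - \<nu> * (\<Sum>i\<in>UNIV. D i j x * D i j x + u i x * D2 i j j x)
    - \<mu> * (D j j x * div_u x + u j x * (\<Sum>k\<in>UNIV. D2 k k j x))
    + \<gamma> / (\<gamma> - 1) * (dP j x * u j x + P x * D j j x) - \<beta> * (d\<rho> j x * u j x + \<rho> x * D j j x)"

lemma has_dirderiv_energy_flux: "has_dirderiv (energy_flux \<beta> j) (axis j 1) (energy_flux_deriv \<beta> j)"
proof -
  have 1: "has_dirderiv div_u (axis j 1) (\<lambda>x. \<Sum>k\<in>UNIV. D2 k k j x)"
    unfolding div_u_def[abs_def] by (intro has_dirderiv_sum dd)
  have "has_dirderiv (\<lambda>x. u i x * u i x) (axis j 1) (\<lambda>x. D i j x * u i x + u i x * D i j x)" for i
    by (intro has_dirderiv_mult dd)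
  then have "has_dirderiv (\<lambda>x. (u i x)\<^sup>2) (axis j 1) (\<lambda>x. 2 * (u i x * D i j x))" for i
    by (simp add: power2_eq_square mult.commute)
  then have 2: "has_dirderiv sq_norm_u (axis j 1) (\<lambda>x. \<Sum>i\<in>UNIV. 2 * (u i x * D i j x))"
    unfolding sq_norm_u_def[abs_def] by (intro has_dirderiv_sum)
  show ?thesis
    unfolding energy_flux_def[abs_def] energy_flux_deriv_def[abs_def]
    by (intro has_dirderiv_diff has_dirderiv_add has_dirderiv_cmult has_dirderiv_mult has_dirderiv_sum dd 1 2)
qed

lemma cont_energy_flux: "continuous_on UNIV (energy_flux \<beta> j)" "continuous_on UNIV (energy_flux_deriv \<beta> j)"
  unfolding energy_flux_def[abs_def] energy_flux_deriv_def[abs_def]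
  by (intro continuous_intros cont cont_derived)+

text \<open>Local energy balance. The momentum equation is paired with \<open>u\<close>; conservation of mass gives
  \<open>\<nabla>P \<sqdot> u = - \<gamma> P div u\<close> and therefore \<open>\<gamma>/(\<gamma>-1) div (P u) = \<nabla>P \<sqdot> u\<close>. No derivative of \<open>\<rho>\<^bsup>\<gamma>-1\<^esup>\<close> appears, so
  the zeros of \<open>\<rho>\<close> cause no difficulty.\<close>

lemma divergence_energy_flux: "(\<Sum>j\<in>UNIV. energy_flux_deriv \<beta> j x) = - dissipation x"
proof -
  define Q where "Q = sq_norm_u x"
  define T where "T = (\<Sum>i\<in>UNIV. \<Sum>j\<in>UNIV. u i x * u j x * D i j x)"
  define L where "L = (\<Sum>i\<in>UNIV. u i x * (\<Sum>j\<in>UNIV. D2 i j j x))"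
  define G where "G = (\<Sum>j\<in>UNIV. u j x * (\<Sum>k\<in>UNIV. D2 k k j x))"
  define W where "W = (\<Sum>j\<in>UNIV. dP j x * u j x)"
  have m: "(\<Sum>j\<in>UNIV. d\<rho> j x * u j x) + \<rho> x * div_u x = 0"
    using mass[of x] by (simp add: sum.distrib sum_distrib_left div_u_def)
  have mom: "\<rho> x * T - \<nu> * L - \<mu> * G + W = 0"
  proof -
    have "(\<Sum>j\<in>UNIV. (d\<rho> j x * u i x + \<rho> x * D i j x) * u j x + \<rho> x * u i x * D j j x)
        = u i x * (\<Sum>j\<in>UNIV. d\<rho> j x * u j x + \<rho> x * D j j x) + \<rho> x * (\<Sum>j\<in>UNIV. u j x * D i j x)" for i
      by (simp add: sum.distrib sum_distrib_left algebra_simps)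
    then have "\<rho> x * (\<Sum>j\<in>UNIV. u j x * D i j x) - \<nu> * (\<Sum>j\<in>UNIV. D2 i j j x)
        - \<mu> * (\<Sum>k\<in>UNIV. D2 k k i x) + dP i x = 0" for i
      using momentum[of x i] mass[of x] by simp
    then have "0 = (\<Sum>i\<in>UNIV. u i x * (\<rho> x * (\<Sum>j\<in>UNIV. u j x * D i j x) - \<nu> * (\<Sum>j\<in>UNIV. D2 i j j x)
        - \<mu> * (\<Sum>k\<in>UNIV. D2 k k i x) + dP i x))" by simp
    also have "\<dots> = \<rho> x * T - \<nu> * L - \<mu> * G + W"
      unfolding T_def L_def G_def W_def
      by (simp add: sum.distrib sum_subtractf sum_distrib_left algebra_simps)
    finally show ?thesis by simp
  qed
  have W: "W = - \<gamma> * (P x * div_u x)"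
  proof -
    have "W = a * \<gamma> * \<rho> x powr (\<gamma> - 1) * (\<Sum>j\<in>UNIV. d\<rho> j x * u j x)"
      unfolding W_def dP_eq by (simp add: sum_distrib_left mult.assoc)
    also have "\<dots> = - (a * \<gamma> * (\<rho> x powr (\<gamma> - 1) * \<rho> x) * div_u x)"
      using m by (simp add: add_eq_0_iff2)
    also have "\<rho> x powr (\<gamma> - 1) * \<rho> x = \<rho> x powr \<gamma>"
    proof -
      have one: "\<rho> x powr 1 = \<rho> x" using rho(1)[of x] by simp
      have "\<rho> x powr (\<gamma> - 1) * \<rho> x = \<rho> x powr (\<gamma> - 1) * \<rho> x powr 1" by (simp only: one)
      also have "\<dots> = \<rho> x powr \<gamma>" by (simp only: powr_add[symmetric] diff_add_cancel)
      finally show ?thesis .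
    qed
    finally show ?thesis by (simp add: P_eq)
  qed
  have press: "\<gamma> / (\<gamma> - 1) * (W + P x * div_u x) = W"
  proof -
    have "P x * div_u x = - W / \<gamma>" using W params by simp
    then show ?thesis using params by (simp add: field_simps)
  qed
  have "(\<Sum>j\<in>UNIV. energy_flux_deriv \<beta> j x) =
      1/2 * (((\<Sum>j\<in>UNIV. d\<rho> j x * u j x) + \<rho> x * div_u x) * Q) + \<rho> x * T
      - \<nu> * (sq_norm_D x + L) - \<mu> * ((div_u x)\<^sup>2 + G) + \<gamma> / (\<gamma> - 1) * (W + P x * div_u x)
      - \<beta> * ((\<Sum>j\<in>UNIV. d\<rho> j x * u j x) + \<rho> x * div_u x)"
  proof -
    have t1: "(\<Sum>j\<in>UNIV. 1/2 * ((d\<rho> j x * u j x + \<rho> x * D j j x) * sq_norm_u x + \<rho> x * u j x * (\<Sum>i\<in>UNIV. 2 * (u i x * D i j x))))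
       = 1/2 * (((\<Sum>j\<in>UNIV. d\<rho> j x * u j x) + \<rho> x * div_u x) * Q) + \<rho> x * T"
    proof -
      have "T = (\<Sum>j\<in>UNIV. \<Sum>i\<in>UNIV. u i x * u j x * D i j x)" unfolding T_def by (rule sum.swap)
      then show ?thesis unfolding Q_def div_u_def
        by (simp add: sum.distrib sum_distrib_left sum_distrib_right algebra_simps add_divide_distrib sum_divide_distrib)
    qed
    have t2: "(\<Sum>j\<in>UNIV. \<nu> * (\<Sum>i\<in>UNIV. D i j x * D i j x + u i x * D2 i j j x)) = \<nu> * (sq_norm_D x + L)"
    proof -
      have "sq_norm_D x = (\<Sum>j\<in>UNIV. \<Sum>i\<in>UNIV. D i j x * D i j x)"
        unfolding sq_norm_D_def power2_eq_square by (rule sum.swap)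
      moreover have "L = (\<Sum>j\<in>UNIV. \<Sum>i\<in>UNIV. u i x * D2 i j j x)"
        unfolding L_def sum_distrib_left by (rule sum.swap)
      ultimately show ?thesis by (simp add: sum.distrib sum_distrib_left distrib_left)
    qed
    have t3: "(\<Sum>j\<in>UNIV. \<mu> * (D j j x * div_u x + u j x * (\<Sum>k\<in>UNIV. D2 k k j x))) = \<mu> * ((div_u x)\<^sup>2 + G)"
    proof -
      have "(div_u x)\<^sup>2 = (\<Sum>j\<in>UNIV. D j j x * div_u x)"
        unfolding power2_eq_square sum_distrib_right[symmetric] by (simp add: div_u_def)
      then show ?thesis by (simp add: G_def sum.distrib sum_distrib_left[symmetric])
    qed
    have t4: "(\<Sum>j\<in>UNIV. \<gamma> / (\<gamma> - 1) * (dP j x * u j x + P x * D j j x)) = \<gamma> / (\<gamma> - 1) * (W + P x * div_u x)"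
      unfolding W_def div_u_def sum_distrib_left[symmetric] sum.distrib ..
    have t5: "(\<Sum>j\<in>UNIV. \<beta> * (d\<rho> j x * u j x + \<rho> x * D j j x)) = \<beta> * ((\<Sum>j\<in>UNIV. d\<rho> j x * u j x) + \<rho> x * div_u x)"
      unfolding div_u_def sum_distrib_left[symmetric] sum.distrib ..
    show ?thesis unfolding energy_flux_deriv_def sum_subtractf sum.distrib[of "\<lambda>j. _ j - _ j - _ j"] t1 t2 t3 t4 t5
      by simp
  qed
  also have "\<dots> = - dissipation x"
    unfolding m press dissipation_def using mom by (simp add: algebra_simps)
  finally show ?thesis .
qed

lemma energy_identity:
  assumes R: "0 < R"
  shows "(\<integral>x. bump ((1/R) *\<^sub>R x) * dissipation x \<partial>lborel)
    = (\<Sum>j\<in>UNIV. \<integral>x. energy_flux \<beta> j x * ((1/R) * bump_deriv (axis j 1) ((1/R) *\<^sub>R x)) \<partial>lborel)"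
proof -
  let ?\<phi> = "\<lambda>x::real^3. bump ((1/R) *\<^sub>R x)"
  let ?\<phi>' = "\<lambda>j (x::real^3). (1/R) * bump_deriv (axis j 1) ((1/R) *\<^sub>R x)"
  have c: "continuous_on UNIV ?\<phi>" by (intro continuous_on_UNIV_compose[OF continuous_on_bump] continuous_intros)
  have c': "continuous_on UNIV (?\<phi>' j)" for j by (intro continuous_intros)
  have d: "has_dirderiv ?\<phi> (axis j 1) (?\<phi>' j)" for j by (rule has_dirderiv_scale[OF has_dirderiv_bump])
  have v: "vanishes_beyond R ?\<phi>" by (rule vanishes_beyond_scale[OF vanishes_beyond_bump R])
  have int: "integrable lborel (\<lambda>x. energy_flux_deriv \<beta> j x * ?\<phi> x)" for j
    using v by (intro integrable_compactly_supported[of _ R] vanishes_beyond_mult2 continuous_on_mult cont_energy_flux c)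
  have "(\<Sum>j\<in>UNIV. \<integral>x. energy_flux \<beta> j x * ?\<phi>' j x \<partial>lborel)
      = (\<Sum>j\<in>UNIV. - (\<integral>x. energy_flux_deriv \<beta> j x * ?\<phi> x \<partial>lborel))"
    by (intro sum.cong refl integration_by_parts[OF cont_energy_flux has_dirderiv_energy_flux c c' d v])
  also have "\<dots> = - (\<integral>x. (\<Sum>j\<in>UNIV. energy_flux_deriv \<beta> j x * ?\<phi> x) \<partial>lborel)"
    using int by (simp add: sum_negf)
  also have "\<dots> = (\<integral>x. ?\<phi> x * dissipation x \<partial>lborel)"
    unfolding sum_distrib_right[symmetric] divergence_energy_flux by (simp add: mult.commute)
  finally show ?thesis by simp
qed

definition "flux_const = M / 2 + 3 * \<nu> + 3 * \<mu> + \<gamma> / (\<gamma> - 1)"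

lemma flux_const_nonneg: "0 \<le> flux_const"
  using params M_nonneg unfolding flux_const_def by simp

lemma abs_u_le: "\<bar>u j x\<bar> \<le> sqrt (sq_norm_u x)"
proof -
  have "(u j x)\<^sup>2 \<le> sq_norm_u x" unfolding sq_norm_u_def by (intro member_le_sum) auto
  then show ?thesis by (intro real_le_rsqrt) simp
qed

lemma abs_D_le: "\<bar>D i j x\<bar> \<le> sqrt (sq_norm_D x)"
proof -
  have "(D i j x)\<^sup>2 \<le> (\<Sum>j\<in>UNIV. (D i j x)\<^sup>2)" by (intro member_le_sum) auto
  also have "\<dots> \<le> sq_norm_D x" unfolding sq_norm_D_def
    by (rule member_le_sum[of i UNIV "\<lambda>i. \<Sum>j\<in>UNIV. (D i j x)\<^sup>2"]) (auto intro: sum_nonneg)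
  finally show ?thesis by (intro real_le_rsqrt) simp
qed

text \<open>If \<open>c = a r\<^sup>\<gamma>\<close>, the choice of \<open>\<beta>\<close> makes the last two terms of the flux equal to
  \<open>\<gamma>/(\<gamma>-1) a (\<rho>\<^sup>\<gamma> - \<rho> r\<^bsup>\<gamma>-1\<^esup>) u\<close>, and \<open>powr_pressure_le\<close> compares this with \<open>P - c\<close>.\<close>

lemma energy_flux_le:
  assumes c: "0 \<le> c" and \<beta>: "\<beta> = \<gamma> / (\<gamma> - 1) * a * ((c / a) powr (1 / \<gamma>)) powr (\<gamma> - 1)"
  shows "\<bar>energy_flux \<beta> j x\<bar> \<le> flux_const * (sqrt (sq_norm_u x) * sq_norm_u x
     + sqrt (sq_norm_u x) * sqrt (sq_norm_D x) + \<bar>P x - c\<bar> * sqrt (sq_norm_u x))"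
proof -
  define U where "U = sqrt (sq_norm_u x)"
  define E where "E = sqrt (sq_norm_D x)"
  have U: "0 \<le> U" "0 \<le> E" using nonneg_derived by (auto simp: U_def E_def)
  have q: "0 \<le> sq_norm_u x" by (rule nonneg_derived)
  have 1: "\<bar>1/2 * (\<rho> x * u j x * sq_norm_u x)\<bar> \<le> M / 2 * (U * sq_norm_u x)"
  proof -
    have "\<bar>\<rho> x\<bar> * \<bar>u j x\<bar> \<le> M * U" using rho[of x] abs_u_le[of j x] M_nonneg
      by (intro mult_mono) (auto simp: U_def)
    then have "(\<bar>\<rho> x\<bar> * \<bar>u j x\<bar>) * sq_norm_u x \<le> (M * U) * sq_norm_u x" using q by (rule mult_right_mono)
    then show ?thesis using q by (simp add: abs_mult)
  qed
  have 2: "\<bar>\<nu> * (\<Sum>i\<in>UNIV. u i x * D i j x)\<bar> \<le> 3 * \<nu> * (U * E)"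
  proof -
    have "\<bar>\<Sum>i\<in>UNIV. u i x * D i j x\<bar> \<le> (\<Sum>i\<in>UNIV. \<bar>u i x * D i j x\<bar>)" by (rule sum_abs)
    also have "\<dots> \<le> (\<Sum>i\<in>(UNIV::3 set). U * E)"
      unfolding abs_mult U_def E_def using nonneg_derived by (intro sum_mono mult_mono abs_u_le abs_D_le) auto
    finally have "\<bar>\<Sum>i\<in>UNIV. u i x * D i j x\<bar> \<le> 3 * (U * E)" by simp
    then have "\<nu> * \<bar>\<Sum>i\<in>UNIV. u i x * D i j x\<bar> \<le> \<nu> * (3 * (U * E))"
      using params by (intro mult_left_mono) auto
    then show ?thesis using params by (simp add: abs_mult mult_ac)
  qed
  have 3: "\<bar>\<mu> * (u j x * div_u x)\<bar> \<le> 3 * \<mu> * (U * E)"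
  proof -
    have "\<bar>div_u x\<bar> \<le> (\<Sum>k\<in>UNIV. \<bar>D k k x\<bar>)" unfolding div_u_def by (rule sum_abs)
    also have "\<dots> \<le> (\<Sum>k\<in>(UNIV::3 set). E)" unfolding E_def by (intro sum_mono abs_D_le)
    finally have "\<bar>u j x\<bar> * \<bar>div_u x\<bar> \<le> U * (3 * E)"
      using U abs_u_le[of j x] by (intro mult_mono) (auto simp: U_def)
    then have "\<mu> * (\<bar>u j x\<bar> * \<bar>div_u x\<bar>) \<le> \<mu> * (U * (3 * E))" using params by (intro mult_left_mono) auto
    then show ?thesis using params by (simp add: abs_mult mult_ac)
  qed
  have 4: "\<bar>\<gamma> / (\<gamma> - 1) * (P x * u j x) - \<beta> * (\<rho> x * u j x)\<bar> \<le> \<gamma> / (\<gamma> - 1) * (\<bar>P x - c\<bar> * U)"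
  proof -
    define r where "r = (c / a) powr (1 / \<gamma>)"
    have r: "0 \<le> r" by (simp add: r_def)
    have cr: "c = a * r powr \<gamma>" using params c by (simp add: r_def powr_powr)
    have "\<gamma> / (\<gamma> - 1) * (P x * u j x) - \<beta> * (\<rho> x * u j x)
        = \<gamma> / (\<gamma> - 1) * (a * (\<rho> x powr \<gamma> - \<rho> x * r powr (\<gamma> - 1)) * u j x)"
      unfolding \<beta> P_eq r_def[symmetric] by (simp add: algebra_simps)
    then have "\<bar>\<gamma> / (\<gamma> - 1) * (P x * u j x) - \<beta> * (\<rho> x * u j x)\<bar>
        = \<gamma> / (\<gamma> - 1) * (a * \<bar>\<rho> x powr \<gamma> - \<rho> x * r powr (\<gamma> - 1)\<bar> * \<bar>u j x\<bar>)"
      using params by (simp add: abs_mult)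
    also have "\<dots> \<le> \<gamma> / (\<gamma> - 1) * (a * \<bar>\<rho> x powr \<gamma> - r powr \<gamma>\<bar> * U)"
      using params powr_pressure_le[OF rho(1) r params(2)] abs_u_le[of j x] U
      by (intro mult_left_mono mult_mono) (auto simp: U_def)
    also have "a * \<bar>\<rho> x powr \<gamma> - r powr \<gamma>\<bar> = \<bar>P x - c\<bar>"
      unfolding P_eq cr using params by (simp add: right_diff_distrib[symmetric] abs_mult)
    finally show ?thesis .
  qed
  have "\<bar>energy_flux \<beta> j x\<bar> \<le> M / 2 * (U * sq_norm_u x) + 3 * \<nu> * (U * E) + 3 * \<mu> * (U * E)
      + \<gamma> / (\<gamma> - 1) * (\<bar>P x - c\<bar> * U)"
    unfolding energy_flux_def using 1 2 3 4 by linarith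
  also have "\<dots> \<le> flux_const * (U * sq_norm_u x) + flux_const * (U * E) + flux_const * (\<bar>P x - c\<bar> * U)"
  proof -
    have "0 \<le> \<gamma> / (\<gamma> - 1)" using params by simp
    then have f: "M / 2 \<le> flux_const" "3 * \<nu> + 3 * \<mu> \<le> flux_const" "\<gamma> / (\<gamma> - 1) \<le> flux_const"
      using M_nonneg params unfolding flux_const_def by linarith+
    have "M / 2 * (U * sq_norm_u x) \<le> flux_const * (U * sq_norm_u x)"
      "(3 * \<nu> + 3 * \<mu>) * (U * E) \<le> flux_const * (U * E)"
      "\<gamma> / (\<gamma> - 1) * (\<bar>P x - c\<bar> * U) \<le> flux_const * (\<bar>P x - c\<bar> * U)"
      by (intro mult_right_mono mult_nonneg_nonneg U q abs_ge_zero f)+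
    then show ?thesis by (simp add: distrib_right)
  qed
  finally show ?thesis by (simp add: U_def E_def distrib_left)
qed

lemma bump_deriv_le: "\<bar>bump_deriv (axis j 1) (y::real^3)\<bar> \<le> 4 * indicator (cball 0 1) y"
proof (cases "norm y \<le> 1")
  case True
  have "\<bar>max 0 (1 - y \<bullet> y)\<bar> * \<bar>y \<bullet> axis j 1\<bar> \<le> 1 * 1"
    using component_le_norm_cart[of y j] True by (intro mult_mono) (auto simp: inner_axis)
  then show ?thesis using True by (simp add: abs_mult)
next
  case False
  then have "1 < y \<bullet> y" by (simp add: norm_gt_1_iff[symmetric])
  then show ?thesis by simp
qed

lemma L2_growth:
  "\<exists>K\<ge>0. \<forall>R>0. sqrt (LINT x:cball 0 R|lborel. sq_norm_u x) \<le> K * R powr (3/4 + \<kappa>/4)"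
proof -
  define V where "V = measure lborel (cball (0::real^3) 1)"
  have V: "0 \<le> V" by (simp add: V_def)
  have "sqrt (LINT x:cball 0 R|lborel. sq_norm_u x) \<le> sqrt (sqrt V * sqrt C4) * R powr (3/4 + \<kappa>/4)"
    if R: "R > 0" for R
  proof -
    have "(LINT x:cball 0 R|lborel. 1 * sq_norm_u x)
        \<le> sqrt (LINT x:cball (0::real^3) R|lborel. 1\<^sup>2) * sqrt (LINT x:cball 0 R|lborel. (sq_norm_u x)\<^sup>2)"
      by (intro set_integral_Cauchy_Schwarz continuous_intros cont_derived)
    also have "\<dots> \<le> sqrt (V * R powr 3) * sqrt (C4 * R powr \<kappa>)"
    proof (intro mult_mono real_sqrt_le_mono)
      have "(LINT x:cball (0::real^3) R|lborel. (1::real)\<^sup>2) = measure lborel (cball (0::real^3) R)"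
        by (simp add: set_lebesgue_integral_def)
      also have "\<dots> = V * R powr 3" using R by (simp add: V_def content_cball powr_numeral)
      finally show "(LINT x:cball (0::real^3) R|lborel. (1::real)\<^sup>2) \<le> V * R powr 3" by simp
      show "(LINT x:cball 0 R|lborel. (sq_norm_u x)\<^sup>2) \<le> C4 * R powr \<kappa>"
        unfolding sq_norm_u_def by (rule L4(2)[OF R])
    qed (use V L4 in \<open>auto simp: set_lebesgue_integral_def\<close>)
    also have "\<dots> = (sqrt V * sqrt C4) * R powr (3/2 + \<kappa>/2)"
      using V L4 by (simp add: sqrt_mult_powr powr_add)
    finally have "sqrt (LINT x:cball 0 R|lborel. sq_norm_u x) \<le> sqrt ((sqrt V * sqrt C4) * R powr (3/2 + \<kappa>/2))"
      by (intro real_sqrt_le_mono) simp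
    also have "\<dots> = sqrt (sqrt V * sqrt C4) * R powr ((3/2 + \<kappa>/2) / 2)"
      using V L4 by (intro sqrt_mult_powr) auto
    finally show ?thesis by (simp add: add_divide_distrib)
  qed
  moreover have "0 \<le> sqrt (sqrt V * sqrt C4)" using V L4 by simp
  ultimately show ?thesis by blast
qed

text \<open>The three parts of the flux are products of \<open>\<bar>u\<bar>\<close> with \<open>\<bar>u\<bar>\<^sup>2\<close>, \<open>\<bar>\<nabla>u\<bar>\<close> and \<open>\<bar>P - c\<bar>\<close>. In the square mean over the
  ball of radius \<open>R\<close> the first factor is \<open>O(R\<^bsup>3/4 + \<kappa>/4\<^esup>)\<close> and each of the others is \<open>O(R\<^bsup>\<kappa>/2\<^esup>)\<close>; the gradient of the
  cutoff contributes \<open>1/R\<close>.\<close>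

lemma dissipation_decay:
  "\<exists>C. \<forall>R\<ge>1. (\<integral>x. bump ((1/R) *\<^sub>R x) * dissipation x \<partial>lborel) \<le> C * R powr (3/4 * \<kappa> - 1/4)"
proof -
  obtain Cp where Cp: "Cp \<ge> 0" "\<And>R. 0 < R \<Longrightarrow> \<exists>c\<ge>0. (LINT x:cball 0 R|lborel. (P x - c)\<^sup>2) \<le> Cp * stress_energy (3 * R) stress"
  proof -
    have "\<And>x. 0 \<le> P x" using params by (simp add: P_eq)
    then show thesis using pressure_estimate stress_balance that by metis
  qed
  obtain Cs where Cs: "Cs \<ge> 0" "\<And>R. 1 \<le> R \<Longrightarrow> stress_energy (3 * R) stress \<le> Cs * R powr \<kappa>"
    using stress_energy_bound by blast
  obtain K where K: "K \<ge> 0" "\<And>R. 0 < R \<Longrightarrow> sqrt (LINT x:cball 0 R|lborel. sq_norm_u x) \<le> K * R powr (3/4 + \<kappa>/4)"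
    using L2_growth by blast
  define DD where "DD = integral\<^sup>L lborel sq_norm_D"
  have DD: "0 \<le> DD" unfolding DD_def using nonneg_derived by simp
  define H where "H = sqrt C4 + sqrt DD + sqrt (Cp * Cs)"
  have "(\<integral>x. bump ((1/R) *\<^sub>R x) * dissipation x \<partial>lborel) \<le> 12 * flux_const * K * H * R powr (3/4 * \<kappa> - 1/4)"
    if R: "1 \<le> R" for R
  proof -
    have R0: "0 < R" using R by simp
    obtain c where c: "0 \<le> c" "(LINT x:cball 0 R|lborel. (P x - c)\<^sup>2) \<le> Cp * stress_energy (3 * R) stress"
      using Cp(2)[OF R0] by blast
    define \<beta> where "\<beta> = \<gamma> / (\<gamma> - 1) * a * ((c / a) powr (1 / \<gamma>)) powr (\<gamma> - 1)"
    let ?U = "\<lambda>x. sqrt (sq_norm_u x)" and ?E = "\<lambda>x. sqrt (sq_norm_D x)"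
    have cU: "continuous_on UNIV ?U" "continuous_on UNIV ?E" "continuous_on UNIV (\<lambda>x. \<bar>P x - c\<bar>)"
      by (intro continuous_intros cont cont_derived)+
    have sqU: "(?U x)\<^sup>2 = sq_norm_u x" "(?E x)\<^sup>2 = sq_norm_D x" for x using nonneg_derived by auto
    define X where "X = sqrt (LINT x:cball 0 R|lborel. sq_norm_u x)"
    have X: "0 \<le> X" "X \<le> K * R powr (3/4 + \<kappa>/4)"
      unfolding X_def using K(2)[OF R0] nonneg_derived by (auto simp: set_lebesgue_integral_def)
    have k1: "1 \<le> R powr (\<kappa> / 2)" using R kappa by (simp add: ge_one_powr_ge_zero)
    let ?A1 = "LINT x:cball 0 R|lborel. ?U x * sq_norm_u x"
    let ?A2 = "LINT x:cball 0 R|lborel. ?U x * ?E x"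
    let ?A3 = "LINT x:cball 0 R|lborel. \<bar>P x - c\<bar> * ?U x"
    have i1: "?A1 \<le> X * (sqrt C4 * R powr (\<kappa>/2))"
    proof -
      have "?A1 \<le> X * sqrt (LINT x:cball 0 R|lborel. (sq_norm_u x)\<^sup>2)"
        using set_integral_Cauchy_Schwarz[OF cU(1) cont_derived(2), of R] by (simp only: sqU X_def)
      also have "sqrt (LINT x:cball 0 R|lborel. (sq_norm_u x)\<^sup>2) \<le> sqrt (C4 * R powr \<kappa>)"
        unfolding sq_norm_u_def by (intro real_sqrt_le_mono L4(2) R0)
      also have "\<dots> = sqrt C4 * R powr (\<kappa>/2)" by (rule sqrt_mult_powr[OF L4(1)])
      finally show ?thesis using X(1) by (simp add: mult_left_mono)
    qed
    have i2: "?A2 \<le> X * (sqrt DD * R powr (\<kappa>/2))"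
    proof -
      have "?A2 \<le> X * sqrt (LINT x:cball 0 R|lborel. sq_norm_D x)"
        using set_integral_Cauchy_Schwarz[OF cU(1) cU(2), of R] by (simp only: sqU X_def)
      also have "(LINT x:cball 0 R|lborel. sq_norm_D x) \<le> DD"
        unfolding DD_def set_lebesgue_integral_def
        using D_int nonneg_derived integral_set_cball(1)[OF cont_derived(1)]
        by (intro integral_mono) (auto simp: sq_norm_D_def[abs_def] indicator_def)
      finally have "?A2 \<le> X * sqrt DD" using X(1) by (simp add: mult_left_mono)
      also have "\<dots> \<le> X * (sqrt DD * R powr (\<kappa>/2))"
        using X(1) DD k1 mult_left_mono[OF k1, of "sqrt DD"] by (intro mult_left_mono) auto
      finally show ?thesis .
    qed
    have i3: "?A3 \<le> X * (sqrt (Cp * Cs) * R powr (\<kappa>/2))"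
    proof -
      have "?A3 \<le> sqrt (LINT x:cball 0 R|lborel. (P x - c)\<^sup>2) * X"
        using set_integral_Cauchy_Schwarz[OF cU(3) cU(1), of R] by (simp only: sqU X_def power2_abs)
      also have "\<dots> \<le> sqrt ((Cp * Cs) * R powr \<kappa>) * X"
      proof (intro mult_right_mono real_sqrt_le_mono X(1))
        have "Cp * stress_energy (3 * R) stress \<le> Cp * (Cs * R powr \<kappa>)"
          using Cs(2)[OF R] Cp(1) by (intro mult_left_mono)
        then show "(LINT x:cball 0 R|lborel. (P x - c)\<^sup>2) \<le> (Cp * Cs) * R powr \<kappa>" using c(2) by simp
      qed
      also have "sqrt ((Cp * Cs) * R powr \<kappa>) = sqrt (Cp * Cs) * R powr (\<kappa>/2)"
        using Cp(1) Cs(1) by (intro sqrt_mult_powr) simp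
      finally show ?thesis by (simp add: mult.commute)
    qed
    have flux: "(\<integral>x. energy_flux \<beta> j x * ((1/R) * bump_deriv (axis j 1) ((1/R) *\<^sub>R x)) \<partial>lborel)
        \<le> 4 / R * (flux_const * (X * (H * R powr (\<kappa>/2))))" for j
    proof -
      let ?b = "\<lambda>x::real^3. (1/R) * bump_deriv (axis j 1) ((1/R) *\<^sub>R x)"
      let ?I = "indicat_real (cball (0::real^3) R)"
      let ?T = "\<lambda>x. ?U x * sq_norm_u x + ?U x * ?E x + \<bar>P x - c\<bar> * ?U x"
      have pt: "energy_flux \<beta> j x * ?b x \<le> 4 / R * (?I x * (flux_const * ?T x))" for x
      proof -
        have "\<bar>bump_deriv (axis j 1) ((1/R) *\<^sub>R x)\<bar> \<le> 4 * indicator (cball 0 1) ((1/R) *\<^sub>R x)"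
          by (rule bump_deriv_le)
        also have "indicat_real (cball 0 1) ((1/R) *\<^sub>R x) = ?I x"
          using R0 by (simp add: indicator_def)
        finally have b0: "\<bar>bump_deriv (axis j 1) ((1/R) *\<^sub>R x)\<bar> \<le> 4 * ?I x" .
        have pR: "0 < 1 / R" using R0 by simp
        have "\<bar>?b x\<bar> = (1/R) * \<bar>bump_deriv (axis j 1) ((1/R) *\<^sub>R x)\<bar>"
          by (simp only: abs_mult[of "1/R"] abs_of_pos[OF pR])
        also have "\<dots> \<le> (1/R) * (4 * ?I x)" by (rule mult_left_mono[OF b0 less_imp_le[OF pR]])
        finally have b: "\<bar>?b x\<bar> \<le> 4 / R * ?I x" by simp
        have "energy_flux \<beta> j x * ?b x
            \<le> \<bar>energy_flux \<beta> j x\<bar> * \<bar>?b x\<bar>"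
          unfolding abs_mult[symmetric] by (rule abs_ge_self)
        also have "\<dots> \<le> (flux_const * ?T x) * (4 / R * ?I x)"
          using b energy_flux_le[OF c(1) \<beta>_def, of j x] flux_const_nonneg nonneg_derived[of x]
          by (intro mult_mono) (auto intro!: mult_nonneg_nonneg add_nonneg_nonneg)
        finally show ?thesis by (simp only: mult_ac)
      qed
      have "(\<integral>x. energy_flux \<beta> j x * ?b x \<partial>lborel)
          \<le> (\<integral>x. 4 / R * (?I x * (flux_const * ?T x)) \<partial>lborel)"
      proof (rule integral_mono[OF _ _ pt])
        have c': "continuous_on UNIV ?b"
          by (intro continuous_intros)
        have v: "vanishes_beyond R ?b"
          by (rule vanishes_beyond_mult2, rule vanishes_beyond_scale[OF _ R0],
              rule vanishes_beyond_dirderiv[OF vanishes_beyond_bump has_dirderiv_bump])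
        show "integrable lborel (\<lambda>x. energy_flux \<beta> j x * ?b x)"
          by (intro integrable_compactly_supported[of _ R] vanishes_beyond_mult2 v continuous_on_mult cont_energy_flux c')
        show "integrable lborel (\<lambda>x. 4 / R * (?I x * (flux_const * ?T x)))"
          by (intro integrable_mult_right integral_set_cball continuous_intros cU cont cont_derived)
      qed
      also have "\<dots> = 4 / R * (flux_const * (LINT x:cball 0 R|lborel. ?T x))"
        unfolding set_lebesgue_integral_def by (simp add: mult.left_commute[of _ flux_const])
      also have "(LINT x:cball 0 R|lborel. ?T x) = ?A1 + ?A2 + ?A3"
      proof -
        have "set_integrable lborel (cball 0 R) (\<lambda>x. ?U x * sq_norm_u x)"
          "set_integrable lborel (cball 0 R) (\<lambda>x. ?U x * ?E x)"
          "set_integrable lborel (cball 0 R) (\<lambda>x. \<bar>P x - c\<bar> * ?U x)"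
          by (intro integral_set_cball continuous_on_mult cU cont_derived)+
        then show ?thesis by (simp add: set_integral_add)
      qed
      also have "4 / R * (flux_const * (?A1 + ?A2 + ?A3))
          \<le> 4 / R * (flux_const * (X * (H * R powr (\<kappa>/2))))"
      proof (intro mult_left_mono flux_const_nonneg)
        show "?A1 + ?A2 + ?A3 \<le> X * (H * R powr (\<kappa>/2))"
          using i1 i2 i3 unfolding H_def by (simp add: algebra_simps)
      qed (use R0 in simp)
      finally show ?thesis .
    qed
    have H: "0 \<le> H" unfolding H_def using DD L4 Cp Cs by simp
    have "(\<integral>x. bump ((1/R) *\<^sub>R x) * dissipation x \<partial>lborel)
        \<le> (\<Sum>j\<in>(UNIV::3 set). 4 / R * (flux_const * (X * (H * R powr (\<kappa>/2)))))"
      unfolding energy_identity[OF R0, of \<beta>] by (intro sum_mono flux)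
    also have "\<dots> = 12 * flux_const * H * (R powr (\<kappa>/2) / R) * X" by simp
    also have "\<dots> \<le> 12 * flux_const * H * (R powr (\<kappa>/2) / R) * (K * R powr (3/4 + \<kappa>/4))"
      using X H R0 flux_const_nonneg by (intro mult_left_mono) auto
    also have "\<dots> = 12 * flux_const * K * H * (R powr (\<kappa>/2) / R powr 1 * R powr (3/4 + \<kappa>/4))"
      using R0 by simp
    also have "R powr (\<kappa>/2) / R powr 1 * R powr (3/4 + \<kappa>/4) = R powr (\<kappa>/2 - 1 + (3/4 + \<kappa>/4))"
      by (simp only: powr_add powr_diff)
    also have "\<kappa>/2 - 1 + (3/4 + \<kappa>/4) = 3/4 * \<kappa> - 1/4" by simp
    finally show ?thesis .
  qed
  then show ?thesis by blast
qed

text \<open>The cutoffs increase with the radius, so the dissipation in a fixed ball is bounded by a quantity that tends to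
  0. Continuity turns vanishing almost everywhere into vanishing everywhere.\<close>

lemma gradient_eq_0: "D i j x = 0"
proof -
  obtain C where C: "\<And>R. 1 \<le> R \<Longrightarrow> (\<integral>x. bump ((1/R) *\<^sub>R x) * dissipation x \<partial>lborel) \<le> C * R powr (3/4 * \<kappa> - 1/4)"
    using dissipation_decay by blast
  define r where "r = norm x + 1"
  have r: "0 < r" "norm x < r" by (auto simp: r_def add_nonneg_pos)
  let ?h = "\<lambda>R y. bump ((1/R) *\<^sub>R y) * dissipation y"
  have hc: "continuous_on UNIV (?h R)" for R
    by (intro continuous_on_mult continuous_on_UNIV_compose[OF continuous_on_bump] continuous_intros cont_derived)
  have hv: "vanishes_beyond R (?h R)" if "0 < R" for R
    by (rule vanishes_beyond_mult1[OF vanishes_beyond_scale[OF vanishes_beyond_bump that]])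
  have hi: "integrable lborel (?h R)" if "0 < R" for R
    using integrable_compactly_supported[OF hc hv[OF that]] .
  have h0: "0 \<le> ?h R y" for R y by (intro mult_nonneg_nonneg bump_nonneg nonneg_derived)
  have le: "integral\<^sup>L lborel (?h r) \<le> C * R powr (3/4 * \<kappa> - 1/4)" if R: "max 1 r \<le> R" for R
  proof -
    have "?h r y \<le> ?h R y" for y
    proof (intro mult_right_mono nonneg_derived)
      have "(1/R)\<^sup>2 \<le> (1/r)\<^sup>2" using r R by (intro power_mono) (auto intro!: divide_left_mono)
      then have "(1/R)\<^sup>2 * (y \<bullet> y) \<le> (1/r)\<^sup>2 * (y \<bullet> y)" by (intro mult_right_mono) auto
      then show "bump ((1/r) *\<^sub>R y) \<le> bump ((1/R) *\<^sub>R y)"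
        unfolding bump_def by (intro power_mono) (auto simp: power2_eq_square)
    qed
    then have "integral\<^sup>L lborel (?h r) \<le> integral\<^sup>L lborel (?h R)"
      using r R by (intro integral_mono hi) auto
    also have "\<dots> \<le> C * R powr (3/4 * \<kappa> - 1/4)" using C[of R] R by simp
    finally show ?thesis .
  qed
  have "((\<lambda>R. C * R powr (3/4 * \<kappa> - 1/4)) \<longlongrightarrow> C * 0) at_top"
    using kappa by (intro tendsto_mult tendsto_const tendsto_neg_powr filterlim_ident) auto
  moreover have "eventually (\<lambda>R. integral\<^sup>L lborel (?h r) \<le> C * R powr (3/4 * \<kappa> - 1/4)) at_top"
    using eventually_ge_at_top[of "max 1 r"] by eventually_elim (rule le)
  ultimately have "integral\<^sup>L lborel (?h r) \<le> C * 0"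
    by (rule tendsto_lowerbound) simp
  then have "integral\<^sup>L lborel (?h r) = 0"
    using h0 by (simp add: order_antisym)
  then have ae: "AE y in lborel. ?h r y = 0"
    using integral_nonneg_eq_0_iff_AE[OF hi[OF r(1)]] h0 by simp
  have "?h r x = 0"
  proof (rule ccontr)
    assume ne: "?h r x \<noteq> 0"
    have op: "open {y. ?h r y \<noteq> 0}" by (intro open_Collect_neq hc continuous_on_const)
    have "{y. ?h r y \<noteq> 0} \<in> null_sets lborel"
      by (rule AE_iff_null_sets[THEN iffD2]) (use op ae in \<open>auto intro: borel_open\<close>)
    then have "negligible {y. ?h r y \<noteq> 0}" by (simp add: negligible_iff_null_sets null_sets_completionI)
    then show False using open_not_negligible[OF op] ne by auto
  qed
  moreover have "bump ((1/r) *\<^sub>R x) \<noteq> 0"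
  proof -
    have "norm ((1/r) *\<^sub>R x) < 1" using r by simp
    then show ?thesis using bump_pos by fastforce
  qed
  ultimately have "dissipation x = 0" by simp
  then have "\<nu> * sq_norm_D x \<le> 0" unfolding dissipation_def using params
    by (metis add_le_same_cancel1 add.commute less_imp_le mult_nonneg_nonneg zero_le_power2 add_increasing2 order_refl)
  then have "sq_norm_D x = 0" using params nonneg_derived(1)[of x] by (simp add: mult_le_0_iff)
  then show ?thesis using abs_D_le[of i j x] by simp
qed

end

section \<open>Liouville theorem\<close>

lemma frechet_derivative_component:
  assumes "f differentiable (at x)"
  shows "(\<lambda>y. f y $ i) differentiable (at x)"
    and "frechet_derivative (\<lambda>y. f y $ i) (at x) v = frechet_derivative f (at x) v $ i"
proof -
  have "(f has_derivative frechet_derivative f (at x)) (at x)"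
    using assms by (simp add: frechet_derivative_works)
  then have d: "((\<lambda>y. f y $ i) has_derivative (\<lambda>v. frechet_derivative f (at x) v $ i)) (at x)"
    by (rule bounded_linear.has_derivative[OF bounded_linear_vec_nth])
  then show "(\<lambda>y. f y $ i) differentiable (at x)" by (auto simp: differentiable_def)
  show "frechet_derivative (\<lambda>y. f y $ i) (at x) v = frechet_derivative f (at x) v $ i"
    using frechet_derivative_at[OF d] by metis
qed

text \<open>Differentiation commutes with taking a component.\<close>

lemma Ck_fun_component: "Ck_fun k f \<Longrightarrow> Ck_fun k (\<lambda>x. f x $ i)"
proof (induction k arbitrary: f)
  case 0 then show ?case by (auto intro!: continuous_intros)
next
  case (Suc k)
  then show ?case by (auto simp: frechet_derivative_component)
qed

lemma smooth_fun_component: "smooth_fun f \<Longrightarrow> smooth_fun (\<lambda>x. f x $ i)"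
  by (simp add: smooth_fun_def Ck_fun_component)

lemma smooth_funD:
  assumes "smooth_fun f"
  shows smooth_fun_differentiable: "f differentiable (at x)"
    and smooth_fun_continuous: "continuous_on UNIV f"
proof -
  have "Ck_fun 0 f" "Ck_fun (Suc 0) f" using assms unfolding smooth_fun_def by blast+
  then show "f differentiable (at x)" "continuous_on UNIV f" by auto
qed

lemma smooth_fun_partial_deriv: "smooth_fun f \<Longrightarrow> smooth_fun (partial_deriv j f)"
  unfolding smooth_fun_def partial_deriv_def[abs_def] by (metis Ck_fun.simps(2))

lemma has_dirderiv_partial_deriv:
  assumes "\<And>x. f differentiable (at x)"
  shows "has_dirderiv f (axis j 1) (partial_deriv j f)"
  unfolding partial_deriv_def[abs_def]
  by (rule has_dirderiv_has_derivative) (use assms in \<open>simp add: frechet_derivative_works\<close>)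

lemma has_dirderiv_unique:
  assumes "has_dirderiv f e g" "has_dirderiv f e h"
  shows "g x = h x"
  using assms unfolding has_dirderiv_def by (metis DERIV_unique)

lemma partial_deriv_eq:
  assumes "\<And>x. f differentiable (at x)" "has_dirderiv f (axis j 1) g"
  shows "partial_deriv j f x = g x"
  using has_dirderiv_unique[OF has_dirderiv_partial_deriv[OF assms(1)] assms(2)] .

text \<open>The pressure law is differentiable also at vacuum because \<open>\<gamma> > 1\<close>; the truncation by \<open>max 0\<close> makes it a
  differentiable function on the whole line, to which the chain rule applies.\<close>

lemma DERIV_max0_powr:
  fixes \<gamma> :: real
  assumes \<gamma>: "1 < \<gamma>"
  shows "((\<lambda>t. (max 0 t) powr \<gamma>) has_real_derivative \<gamma> * (max 0 t) powr (\<gamma> - 1)) (at t)"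
proof (cases t "0::real" rule: linorder_cases)
  case less
  then have "eventually (\<lambda>t. (max 0 t) powr \<gamma> = 0) (nhds t)"
    by (intro eventually_nhds_in_open[THEN eventually_mono, of "{..<0}"]) auto
  moreover have "((\<lambda>t. 0) has_real_derivative \<gamma> * (max 0 t) powr (\<gamma> - 1)) (at t)"
    using less by simp
  ultimately show ?thesis by (subst DERIV_cong_ev[OF refl _ refl])
next
  case greater
  then have "eventually (\<lambda>t. (max 0 t) powr \<gamma> = t powr \<gamma>) (nhds t)"
    by (intro eventually_nhds_in_open[THEN eventually_mono, of "{0<..}"]) auto
  moreover have "((\<lambda>t. t powr \<gamma>) has_real_derivative \<gamma> * (max 0 t) powr (\<gamma> - 1)) (at t)"
    using greater by (auto intro!: derivative_eq_intros has_real_derivative_powr)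
  ultimately show ?thesis by (subst DERIV_cong_ev[OF refl _ refl])
next
  case equal
  have "((\<lambda>h::real. (max 0 h) powr \<gamma> / h) \<longlongrightarrow> 0) (at 0)"
  proof (rule Lim_null_comparison[where g="\<lambda>h. \<bar>h\<bar> powr (\<gamma> - 1)"])
    show "((\<lambda>h::real. \<bar>h\<bar> powr (\<gamma> - 1)) \<longlongrightarrow> 0) (at 0)"
      using \<gamma> by (intro tendsto_zero_powrI[where b="\<gamma> - 1"] tendsto_rabs_zero tendsto_ident_at tendsto_const) auto
    have "norm ((max 0 h) powr \<gamma> / h) \<le> \<bar>h\<bar> powr (\<gamma> - 1)" for h :: real
    proof (cases "h > 0")
      case True then show ?thesis by (simp add: powr_diff max_absorb2)
    next
      case False then show ?thesis by (simp add: max_absorb1)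
    qed
    then show "eventually (\<lambda>h::real. norm ((max 0 h) powr \<gamma> / h) \<le> \<bar>h\<bar> powr (\<gamma> - 1)) (at 0)"
      by simp
  qed
  then show ?thesis using equal \<gamma> by (simp add: DERIV_def)
qed

lemma norm_matrix_vector_le: "norm ((A::real^'n^'m) *v z) \<le> norm A * norm z"
proof -
  have "norm (A *v z) = L2_set (\<lambda>i. \<bar>A $ i \<bullet> z\<bar>) UNIV"
    by (simp add: norm_vec_def matrix_vector_mul_component)
  also have "\<dots> \<le> L2_set (\<lambda>i. norm (A $ i) * norm z) UNIV"
    by (intro L2_set_mono Cauchy_Schwarz_ineq2) auto
  also have "\<dots> = norm A * norm z"
    by (simp add: norm_vec_def[of A] L2_set_left_distrib)
  finally show ?thesis .
qed

lemma continuous_AE_le: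
  fixes f :: "'a::euclidean_space \<Rightarrow> real"
  assumes f: "continuous_on UNIV f" and ae: "AE x in lebesgue. f x \<le> c"
  shows "f x \<le> c"
proof (rule ccontr)
  assume n: "\<not> f x \<le> c"
  have op: "open {y. c < f y}" using f by (intro open_Collect_less continuous_intros)
  have "{y. c < f y} \<in> null_sets lebesgue"
    by (rule AE_iff_null_sets[THEN iffD2]) (use op ae in \<open>auto simp: not_less\<close>)
  then have "negligible {y. c < f y}" by (simp add: negligible_iff_null_sets)
  then show False using open_not_negligible[OF op] n by (auto simp: not_le)
qed

lemma in_Linf_continuous_bounded:
  fixes f :: "'a::euclidean_space \<Rightarrow> real"
  assumes f: "continuous_on UNIV f" and "in_Linf f"
  obtains M where "\<And>x. f x \<le> M"
proof -
  obtain M where M: "esssup lebesgue (\<lambda>x. ereal (norm (f x))) \<le> ereal M"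
    using assms(2) unfolding in_Linf_def
    by (cases "esssup lebesgue (\<lambda>x. ereal (norm (f x)))") auto
  have "AE x in lebesgue. ereal (norm (f x)) \<le> esssup lebesgue (\<lambda>x. ereal (norm (f x)))"
    by (rule esssup_AE)
  then have "AE x in lebesgue. f x \<le> M"
  proof eventually_elim
    case (elim x)
    then have "ereal (norm (f x)) \<le> ereal M" using M by (rule order_trans)
    then show ?case by simp
  qed
  then show thesis using continuous_AE_le[OF f] that by blast
qed

text \<open>The level sets of a nonzero constant are the whole space, at all small levels.\<close>

lemma weak_Lp_const_eq_0:
  assumes "weak_Lp p f" "\<And>x::'a::euclidean_space. f x = c"
  shows "c = 0"
proof (rule ccontr)
  assume "c \<noteq> 0"
  then have t: "0 < norm c / 2" by simp
  obtain A where "emeasure lborel {x::'a. norm c / 2 < norm (f x)} \<le> ennreal (A * (norm c / 2) powr (- p))"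
    using assms(1) t unfolding weak_Lp_def by blast
  moreover have "{x::'a. norm c / 2 < norm (f x)} = UNIV" using \<open>c \<noteq> 0\<close> assms(2) by auto
  ultimately show False by (simp add: emeasure_lborel_UNIV top_unique)
qed

theorem theorem1p1:
  fixes a \<gamma> \<nu> lam p :: real and q :: ennreal
    and \<rho> P :: "real^3 \<Rightarrow> real" and u :: "real^3 \<Rightarrow> real^3"
  assumes "a > 0" and "\<gamma> > 1" and "\<nu> > 0" and "lam + 2 / 3 * \<nu> > 0"
    and "\<forall>x. \<rho> x \<ge> 0" and "smooth_fun \<rho>" and "smooth_fun u"
    and continuity: "\<forall>x. divergence (\<lambda>y. \<rho> y *\<^sub>R u y) x = 0"
    and momentum: "\<forall>x. tensor_divergence (\<lambda>y. \<rho> y *\<^sub>R tensor_product (u y) (u y)) x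
            - \<nu> *\<^sub>R vector_laplacian u x
            - (lam + \<nu>) *\<^sub>R gradient (divergence u) x
            + gradient P x = 0"
    and pressure: "\<forall>x. P x = a * \<rho> x powr \<gamma>"
    and "in_Linf \<rho>"
    and "in_L2 (\<lambda>x. jacobian u (at x))"
    and "in_lorentz p q UNIV u"
    and "(3 < p \<and> p < 9 / 2 \<and> 3 \<le> q) \<or> (p = 3 \<and> q = 3)"
  shows "(\<forall>x. u x = 0) \<and> (\<exists>c. \<forall>x. \<rho> x = c)"
proof -
  define v where "v i x = u x $ i" for i x
  define D where "D i j = partial_deriv j (v i)" for i j
  define D2 where "D2 i j k = partial_deriv k (D i j)" for i j k
  define d\<rho> where "d\<rho> j = partial_deriv j \<rho>" for j
  define dP where "dP j = partial_deriv j P" for j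
  have sm: "smooth_fun \<rho>" "\<And>i. smooth_fun (v i)" "\<And>i j. smooth_fun (D i j)"
    "\<And>j. smooth_fun (d\<rho> j)" "\<And>i j k. smooth_fun (D2 i j k)"
    using assms(6,7) smooth_fun_component[OF assms(7)]
    by (auto simp: v_def[abs_def] D_def D2_def d\<rho>_def intro!: smooth_fun_partial_deriv)
  note diff = sm[THEN smooth_fun_differentiable]
  note cont = sm[THEN smooth_fun_continuous]
  have dd: "has_dirderiv \<rho> (axis j 1) (d\<rho> j)" "has_dirderiv (v i) (axis j 1) (D i j)" "has_dirderiv (D i j) (axis k 1) (D2 i j k)" for i j k
    unfolding d\<rho>_def D_def D2_def by (intro has_dirderiv_partial_deriv diff[unfolded D_def])+
  have rho0: "0 \<le> \<rho> x" for x using assms(5) by blast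
  obtain M where M: "\<And>x. \<rho> x \<le> M" using in_Linf_continuous_bounded[OF cont(1) assms(11)] by blast
  \<comment> \<open>Written with \<open>max 0\<close>, the pressure is a differentiable function of a smooth one.\<close>
  have P_eq: "P = (\<lambda>x. a * (max 0 (\<rho> x)) powr \<gamma>)" using pressure rho0 by (auto simp: max_absorb2)
  have Pder: "(P has_derivative (\<lambda>h. a * (frechet_derivative \<rho> (at x) h * (\<gamma> * \<rho> x powr (\<gamma> - 1))))) (at x)" for x
  proof -
    have "(\<rho> has_derivative frechet_derivative \<rho> (at x)) (at x)" using diff(1) by (simp add: frechet_derivative_works)
    from DERIV_compose_FDERIV[OF DERIV_max0_powr[OF assms(2)] this]
    have "((\<lambda>x. (max 0 (\<rho> x)) powr \<gamma>) has_derivative (\<lambda>h. frechet_derivative \<rho> (at x) h * (\<gamma> * \<rho> x powr (\<gamma> - 1)))) (at x)"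
      using rho0[of x] by (simp add: max_absorb2)
    then show ?thesis unfolding P_eq by (rule has_derivative_mult_right)
  qed
  then have Pdiff: "P differentiable (at x)" for x by (auto simp: differentiable_def)
  have dP: "dP j x = a * \<gamma> * \<rho> x powr (\<gamma> - 1) * d\<rho> j x" for j x
    unfolding dP_def d\<rho>_def partial_deriv_def frechet_derivative_at[OF Pder, symmetric]
    by (simp only: mult_ac)
  have Pcont: "continuous_on UNIV P"
    using Pdiff by (intro continuous_at_imp_continuous_on ballI differentiable_imp_continuous_within)
  have dPcont: "continuous_on UNIV (dP j)" for j
    unfolding dP[abs_def] using rho0 assms(2) cont
    by (intro continuous_intros continuous_on_powr') auto
  have ddP: "has_dirderiv P (axis j 1) (dP j)" for j
    unfolding dP_def by (rule has_dirderiv_partial_deriv[OF Pdiff])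
  have mass: "(\<Sum>i\<in>UNIV. d\<rho> i x * v i x + \<rho> x * D i i x) = 0" for x
  proof -
    have eq: "partial_deriv i (\<lambda>y. \<rho> y * v i y) x = d\<rho> i x * v i x + \<rho> x * D i i x" for i
      by (rule partial_deriv_eq) (intro differentiable_mult diff has_dirderiv_mult dd)+
    have "(\<Sum>i\<in>UNIV. partial_deriv i (\<lambda>y. \<rho> y * v i y) x) = 0"
      using continuity by (simp add: divergence_def v_def)
    then show ?thesis by (simp only: eq)
  qed
  have div_eq: "divergence u = (\<lambda>x. \<Sum>k\<in>UNIV. D k k x)"
    by (simp add: divergence_def[abs_def] D_def v_def[abs_def])
  have mom: "(\<Sum>j\<in>UNIV. (d\<rho> j x * v i x + \<rho> x * D i j x) * v j x + \<rho> x * v i x * D j j x)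
      - \<nu> * (\<Sum>j\<in>UNIV. D2 i j j x) - (lam + \<nu>) * (\<Sum>k\<in>UNIV. D2 k k i x) + dP i x = 0" for i x
  proof -
    have 1: "partial_deriv j (\<lambda>y. \<rho> y * v i y * v j y) x
        = (d\<rho> j x * v i x + \<rho> x * D i j x) * v j x + \<rho> x * v i x * D j j x" for j
      by (rule partial_deriv_eq) (intro differentiable_mult diff has_dirderiv_mult dd)+
    have 2: "partial_deriv i (\<lambda>x. \<Sum>k\<in>UNIV. D k k x) x = (\<Sum>k\<in>UNIV. D2 k k i x)"
      by (rule partial_deriv_eq) (intro differentiable_sum diff has_dirderiv_sum dd finite ballI)+
    have "(tensor_divergence (\<lambda>y. \<rho> y *\<^sub>R tensor_product (u y) (u y)) x
            - \<nu> *\<^sub>R vector_laplacian u x - (lam + \<nu>) *\<^sub>R gradient (divergence u) x + gradient P x) $ i = 0"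
      using momentum by simp
    then have "(\<Sum>j\<in>UNIV. partial_deriv j (\<lambda>y. \<rho> y * v i y * v j y) x)
        - \<nu> * (\<Sum>j\<in>UNIV. D2 i j j x) - (lam + \<nu>) * partial_deriv i (\<lambda>x. \<Sum>k\<in>UNIV. D k k x) x + dP i x = 0"
      by (simp add: tensor_divergence_def tensor_product_def vector_laplacian_def gradient_def div_eq
          D2_def D_def v_def[abs_def] dP_def mult.assoc)
    then show ?thesis unfolding 1 2 .
  qed
  have udiff: "u differentiable (at x)" for x by (rule smooth_fun_differentiable[OF assms(7)])
  have ucont: "continuous_on UNIV u" by (rule smooth_fun_continuous[OF assms(7)])
  have jac: "jacobian u (at x) $ i $ j = D i j x" for x i j
    using udiff[of x] frechet_derivative_component(2)[OF udiff[of x], of i "axis j 1"]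
    by (simp add: jacobian_def matrix_def D_def v_def[abs_def] partial_deriv_def)
  have njac: "(norm (jacobian u (at x)))\<^sup>2 = (\<Sum>i\<in>UNIV. \<Sum>j\<in>UNIV. (D i j x)\<^sup>2)" for x
    unfolding power2_norm_eq_inner by (simp add: inner_vec_def jac power2_eq_square)
  have D_int: "integrable lborel (\<lambda>x. \<Sum>i\<in>UNIV. \<Sum>j\<in>UNIV. (D i j x)\<^sup>2)"
  proof -
    have "(\<lambda>x. \<Sum>i\<in>UNIV. \<Sum>j\<in>UNIV. (D i j x)\<^sup>2) \<in> borel_measurable lborel"
      by (simp, intro borel_measurable_continuous_onI continuous_intros cont)
    moreover have "integrable lebesgue (\<lambda>x. \<Sum>i\<in>UNIV. \<Sum>j\<in>UNIV. (D i j x)\<^sup>2)"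
      using assms(12) by (simp add: in_L2_def njac)
    ultimately show ?thesis by (simp add: integrable_completion)
  qed
  let ?k = "\<lambda>x. norm (jacobian u (at x))"
  let ?u' = "\<lambda>x z. jacobian u (at x) *v z"
  have ud: "(u has_derivative ?u' x) (at x)" for x using udiff jacobian_works by blast
  have cu': "continuous_on UNIV (\<lambda>x. ?u' x z)" for z
  proof -
    have "?u' x z = (\<chi> i. \<Sum>j\<in>UNIV. D i j x * z $ j)" for x
      by (simp add: matrix_vector_mult_def jac)
    then show ?thesis by (simp, intro continuous_on_vec_lambda continuous_intros cont)
  qed
  have kc: "continuous_on UNIV ?k"
  proof -
    have "?k x = sqrt (\<Sum>i\<in>UNIV. \<Sum>j\<in>UNIV. (D i j x)\<^sup>2)" for x
      unfolding njac[symmetric] by simp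
    then show ?thesis by (simp, intro continuous_intros cont)
  qed
  have kfin: "(\<integral>\<^sup>+x. ennreal ((?k x)\<^sup>2) \<partial>lborel) < \<infinity>"
    using D_int unfolding njac
    by (subst nn_integral_eq_integral) (auto intro!: sum_nonneg)
  have kle: "norm (?u' x z) \<le> ?k x * norm z" for x z by (rule norm_matrix_vector_le)
  have p: "3 \<le> p" "p < 9 / 2" and q: "1 \<le> q"
  proof -
    have one: "(1::ennreal) \<le> 3" by simp
    have "3 \<le> q" using assms(14) by auto
    then show "1 \<le> q" by (rule order_trans[OF one])
    show "3 \<le> p" "p < 9 / 2" using assms(14) by auto
  qed
  have w: "weak_Lp p u" using in_lorentz_imp_weak_Lp[OF ucont assms(13) _ q] p by simp
  have w1: "weak_Lp (2 + 2 * (2 + 2 * p / 3) / 3) u"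
    by (intro weak_Lp_gradient_improve[OF ud cu' kc kle kfin] w)
  \<comment> \<open>Any exponent strictly between 4 and \<open>9/2\<close> that is at least \<open>p\<close> would do; the improved exponent is at least \<open>14/3\<close>.\<close>
  define r where "r = max p (17 / 4)"
  have r: "4 < r" "r < 9 / 2" using p by (auto simp: r_def)
  have "weak_Lp r u" using p by (intro weak_Lp_interpolate[OF w w1]) (auto simp: r_def field_simps)
  then obtain C4 where C4: "0 \<le> C4" "\<And>R. R > 0 \<Longrightarrow> (LINT x:cball 0 R|lborel. (norm (u x))^4) \<le> C4 * R powr (3 - 12 / r)"
    using weak_Lp_L4_growth[OF ucont _ r(1)] by blast
  have n4: "(norm (u x))^4 = (\<Sum>i\<in>UNIV. (v i x)\<^sup>2)\<^sup>2" for x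
  proof -
    have "(norm (u x))\<^sup>2 = (\<Sum>i\<in>UNIV. (v i x)\<^sup>2)"
      unfolding power2_norm_eq_inner by (simp add: inner_vec_def v_def power2_eq_square)
    moreover have "(norm (u x))^4 = ((norm (u x))\<^sup>2)\<^sup>2"
      unfolding power_mult[symmetric] by simp
    ultimately show ?thesis by (simp only:)
  qed
  have kappa: "0 \<le> 3 - 12 / r" "3 - 12 / r < 1 / 3" using r by (simp_all add: field_simps)
  have L4: "(LINT x:cball 0 R|lborel. (\<Sum>i\<in>UNIV. (v i x)\<^sup>2)\<^sup>2) \<le> C4 * R powr (3 - 12 / r)" if "0 < R" for R
    using C4(2)[OF that] by (simp only: n4)
  have coercive: "0 < lam + \<nu>" using assms(3,4) by linarith
  interpret flow: barotropic_flow a \<gamma> \<nu> "lam + \<nu>" M C4 "3 - 12 / r" \<rho> P d\<rho> dP v D D2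
    by (rule barotropic_flow.intro)
      (fact assms(1-3) coercive rho0 M cont dPcont Pcont dd ddP pressure[rule_format] dP mass mom D_int
        C4(1) L4 kappa)+
  have D0: "D i j x = 0" for i j x by (rule flow.gradient_eq_0)
  have "jacobian u (at x) = 0" for x by (simp add: vec_eq_iff jac D0)
  then have "(u has_derivative (\<lambda>h. 0)) (at x within UNIV)" for x using ud[of x] by simp
  then obtain c where c: "\<And>x. u x = c" using has_derivative_zero_constant[of UNIV u] by auto
  have u0: "u x = 0" for x using weak_Lp_const_eq_0[OF w c] c by simp
  have "dP i x = 0" for i x
  proof -
    have "D2 i j k x = 0" for i j k
    proof -
      have "has_dirderiv (D i j) (axis k 1) (\<lambda>_. 0)" unfolding D0[abs_def] by (rule has_dirderiv_const)
      then show ?thesis using has_dirderiv_unique dd(3) by blast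
    qed
    moreover have "v j x = 0" for j by (simp add: v_def u0)
    ultimately show ?thesis using mom[of x i] by simp
  qed
  then have Pb: "frechet_derivative P (at x) b = 0" if "b \<in> Basis" for x b
    using that by (auto simp: Basis_vec_def dP_def partial_deriv_def)
  have "(P has_derivative (\<lambda>h. 0)) (at x within UNIV)" for x
  proof -
    have 1: "(P has_derivative frechet_derivative P (at x)) (at x)" using Pdiff by (simp add: frechet_derivative_works)
    have "frechet_derivative P (at x) = (\<lambda>h. 0)"
      by (rule linear_eq_stdbasis[OF has_derivative_linear[OF 1]]) (auto simp: Pb linear_zero)
    then show ?thesis using 1 by simp
  qed
  then obtain e where e: "\<And>x. P x = e" using has_derivative_zero_constant[of UNIV P] by auto
  have "\<rho> x = (e / a) powr (1 / \<gamma>)" for x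
  proof -
    have "\<rho> x powr \<gamma> = e / a" using e[of x] pressure assms(1) by (simp add: field_simps)
    then have "(e / a) powr (1 / \<gamma>) = \<rho> x" using assms(2) rho0[of x] by (simp add: powr_powr flip: \<open>\<rho> x powr \<gamma> = e / a\<close>)
    then show ?thesis by simp
  qed
  then show ?thesis using u0 by blast
qed

end
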